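(* Every finite dimensional systolic simplicial complex is contractible.
   Context: Simplicial complexes are not assumed locally finite, and are equipped with the CW topology. A simplicial complex is finite dimensional if there is a largest $n$ such that it contains an $n$-simplex. A simplicial complex is flag if every finite set of vertices pairwise connected by edges spans a simplex. A cycle is a subcomplex homeomorphic to $S^1$; its length is its number of edges. A diagonal of a cycle is an edge (of the ambient complex) connecting two nonconsecutive vertices of the cycle. The link $X_v$ of a vertex $v$ is the subcomplex of all simplices that do not contain $v$ but together with $v$ span a simplex of $X$. For $k\ge 4$, a simplicial complex is $k$-large if it is flag and every cycle of length $m$ with $4\le m<k$ has a diagonal; it is locally $k$-large if the links of all its vertices are $k$-large. A simplicial complex is $k$-systolic if it is locally $k$-large, connected (in particular nonempty) and simply connected. "Systolic" means $6$-systolic. *)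

theory Defs
  imports "HOL-Analysis.Analysis"
begin

section \<open>Simplicial complexes\<close>

text \<open>
  A simplicial complex is a family of nonempty finite vertex sets closed under nonempty subsets.
  The empty simplex is excluded, so the empty family is the empty complex. No local finiteness is
  assumed. (The constant \<^const>\<open>simplicial_complex\<close> of the library is about finite geometric
  complexes in a Euclidean space.)
\<close>

definition abstract_simplicial_complex :: "'a set set \<Rightarrow> bool" where
  "abstract_simplicial_complex X \<longleftrightarrow>
     (\<forall>\<sigma>\<in>X. finite \<sigma> \<and> \<sigma> \<noteq> {}) \<and>
     (\<forall>\<sigma>\<in>X. \<forall>\<tau>. \<tau> \<subseteq> \<sigma> \<and> \<tau> \<noteq> {} \<longrightarrow> \<tau> \<in> X)"

definition vertices :: "'a set set \<Rightarrow> 'a set" where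
  "vertices X = \<Union> X"

definition edges :: "'a set set \<Rightarrow> 'a set set" where
  "edges X = {e \<in> X. card e = 2}"

definition subcomplex :: "'a set set \<Rightarrow> 'a set set \<Rightarrow> bool" where
  "subcomplex C X \<longleftrightarrow> C \<subseteq> X \<and> abstract_simplicial_complex C"

text \<open>An \<open>n\<close>-simplex has \<open>n + 1\<close> vertices.\<close>

definition finite_dimensional :: "'a set set \<Rightarrow> bool" where
  "finite_dimensional X \<longleftrightarrow>
     (\<exists>n. (\<exists>\<sigma>\<in>X. card \<sigma> = n + 1) \<and> (\<forall>\<sigma>\<in>X. card \<sigma> \<le> n + 1))"

definition link :: "'a set set \<Rightarrow> 'a \<Rightarrow> 'a set set" where
  "link X v = {\<sigma> \<in> X. v \<notin> \<sigma> \<and> insert v \<sigma> \<in> X}"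


section \<open>Geometric realization with the CW topology\<close>

text \<open>
  Points are given by their barycentric coordinates. On a closed simplex, whose vertex set is
  finite, the topology inherited from the product topology on functions is the Euclidean one.
  A set is open in the realization iff it meets every closed simplex in a relatively open set.
\<close>

definition closed_simplex :: "'a set \<Rightarrow> ('a \<Rightarrow> real) set" where
  "closed_simplex \<sigma> = {x. (\<forall>v. 0 \<le> x v) \<and> (\<forall>v. v \<notin> \<sigma> \<longrightarrow> x v = 0) \<and> sum x \<sigma> = 1}"

definition realization_set :: "'a set set \<Rightarrow> ('a \<Rightarrow> real) set" where
  "realization_set X = (\<Union>\<sigma>\<in>X. closed_simplex \<sigma>)"

definition realization :: "'a set set \<Rightarrow> ('a \<Rightarrow> real) topology" where
  "realization X = topology (\<lambda>U. U \<subseteq> realization_set X \<and>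
     (\<forall>\<sigma>\<in>X. openin (top_of_set (closed_simplex \<sigma>)) (U \<inter> closed_simplex \<sigma>)))"

lemma istopology_realization:
  "istopology (\<lambda>U. U \<subseteq> realization_set X \<and>
     (\<forall>\<sigma>\<in>X. openin (top_of_set (closed_simplex \<sigma>)) (U \<inter> closed_simplex \<sigma>)))"
  unfolding istopology_def
proof (rule conjI; intro allI impI)
  fix S T
  assume S: "S \<subseteq> realization_set X \<and>
      (\<forall>\<sigma>\<in>X. openin (top_of_set (closed_simplex \<sigma>)) (S \<inter> closed_simplex \<sigma>))"
    and T: "T \<subseteq> realization_set X \<and>
      (\<forall>\<sigma>\<in>X. openin (top_of_set (closed_simplex \<sigma>)) (T \<inter> closed_simplex \<sigma>))"
  have "(S \<inter> T) \<inter> closed_simplex \<sigma> = (S \<inter> closed_simplex \<sigma>) \<inter> (T \<inter> closed_simplex \<sigma>)" for \<sigma>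
    by blast
  then show "S \<inter> T \<subseteq> realization_set X \<and>
      (\<forall>\<sigma>\<in>X. openin (top_of_set (closed_simplex \<sigma>)) (S \<inter> T \<inter> closed_simplex \<sigma>))"
    using S T by (metis openin_Int le_infI1)
next
  fix \<K>
  assume K: "\<forall>K\<in>\<K>. K \<subseteq> realization_set X \<and>
      (\<forall>\<sigma>\<in>X. openin (top_of_set (closed_simplex \<sigma>)) (K \<inter> closed_simplex \<sigma>))"
  have "openin (top_of_set (closed_simplex \<sigma>)) (\<Union>\<K> \<inter> closed_simplex \<sigma>)" if "\<sigma> \<in> X" for \<sigma>
  proof -
    have "\<Union>\<K> \<inter> closed_simplex \<sigma> = \<Union>((\<lambda>K. K \<inter> closed_simplex \<sigma>) ` \<K>)"
      by blast
    moreover have "openin (top_of_set (closed_simplex \<sigma>)) (\<Union>((\<lambda>K. K \<inter> closed_simplex \<sigma>) ` \<K>))"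
      using K that by (intro openin_Union) blast
    ultimately show ?thesis by simp
  qed
  then show "\<Union>\<K> \<subseteq> realization_set X \<and>
      (\<forall>\<sigma>\<in>X. openin (top_of_set (closed_simplex \<sigma>)) (\<Union>\<K> \<inter> closed_simplex \<sigma>))"
    using K by blast
qed

lemma openin_realization:
  "openin (realization X) U \<longleftrightarrow> U \<subseteq> realization_set X \<and>
     (\<forall>\<sigma>\<in>X. openin (top_of_set (closed_simplex \<sigma>)) (U \<inter> closed_simplex \<sigma>))"
  unfolding realization_def
  using topology_inverse'[OF istopology_realization[of X]] by simp

lemma topspace_realization: "topspace (realization X) = realization_set X"
proof
  show "topspace (realization X) \<subseteq> realization_set X"
    using openin_topspace[of "realization X"] openin_realization by blast
  have "realization_set X \<inter> closed_simplex \<sigma> = closed_simplex \<sigma>" if "\<sigma> \<in> X" for \<sigma>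
    using that by (auto simp: realization_set_def)
  then have "openin (realization X) (realization_set X)"
    by (simp add: openin_realization)
  then show "realization_set X \<subseteq> topspace (realization X)"
    by (rule openin_subset)
qed


section \<open>Simple connectedness\<close>

text \<open>
  The library defines \<^const>\<open>simply_connected\<close> only for subsets of a topological-space type. This is
  the same definition (any two loops are freely homotopic through loops, which includes path
  connectedness) for an arbitrary topology.
\<close>

definition simply_connected_space :: "'b topology \<Rightarrow> bool" where
  "simply_connected_space T \<longleftrightarrow>
     (\<forall>p q. pathin T p \<and> p 1 = p 0 \<and> pathin T q \<and> q 1 = q 0 \<longrightarrow>
        homotopic_with (\<lambda>r. r 1 = r 0) (top_of_set {0..1}) T p q)"

lemma simply_connected_space_top_of_set:
  "simply_connected_space (top_of_set S) \<longleftrightarrow> simply_connected S"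
  unfolding simply_connected_space_def simply_connected_def homotopic_loops_def
    pathin_def path_def pathstart_def pathfinish_def path_image_def
  by (auto simp: image_subset_iff_funcset)


section \<open>Systolic complexes\<close>

definition flag_complex :: "'a set set \<Rightarrow> bool" where
  "flag_complex X \<longleftrightarrow>
     (\<forall>S. S \<subseteq> vertices X \<and> finite S \<and> S \<noteq> {} \<and>
        (\<forall>v\<in>S. \<forall>w\<in>S. v \<noteq> w \<longrightarrow> {v, w} \<in> X) \<longrightarrow> S \<in> X)"

definition cycle_in :: "'a set set \<Rightarrow> 'a set set \<Rightarrow> bool" where
  "cycle_in C X \<longleftrightarrow>
     subcomplex C X \<and> realization C homeomorphic_space top_of_set (sphere (0::complex) 1)"

definition cycle_length :: "'a set set \<Rightarrow> nat" where
  "cycle_length C = card (edges C)"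

text \<open>Two distinct vertices of a cycle are consecutive iff they span an edge of the cycle.\<close>

definition has_diagonal :: "'a set set \<Rightarrow> 'a set set \<Rightarrow> bool" where
  "has_diagonal C X \<longleftrightarrow>
     (\<exists>v\<in>vertices C. \<exists>w\<in>vertices C. v \<noteq> w \<and> {v, w} \<in> edges X \<and> {v, w} \<notin> edges C)"

text \<open>The following three notions are intended for \<open>k \<ge> 4\<close>.\<close>

definition k_large :: "nat \<Rightarrow> 'a set set \<Rightarrow> bool" where
  "k_large k X \<longleftrightarrow>
     flag_complex X \<and>
     (\<forall>C. cycle_in C X \<and> 4 \<le> cycle_length C \<and> cycle_length C < k \<longrightarrow> has_diagonal C X)"

definition locally_k_large :: "nat \<Rightarrow> 'a set set \<Rightarrow> bool" where
  "locally_k_large k X \<longleftrightarrow> (\<forall>v\<in>vertices X. k_large k (link X v))"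

definition k_systolic :: "nat \<Rightarrow> 'a set set \<Rightarrow> bool" where
  "k_systolic k X \<longleftrightarrow>
     locally_k_large k X \<and>
     X \<noteq> {} \<and> connected_space (realization X) \<and> simply_connected_space (realization X)"

abbreviation systolic :: "'a set set \<Rightarrow> bool" where
  "systolic \<equiv> k_systolic 6"

end

theory Submission
  imports Defs
begin

text \<open>
  Fix a vertex \<open>v\<^sub>0\<close> and build the universal cover of \<open>X\<close> ball by ball. If the ball of radius \<open>n\<close> is
  known, the missing neighbours of its sphere are the pairs \<open>(w, z)\<close> where \<open>z\<close> is a neighbour of the image
  of \<open>w\<close> that is not yet covered; two pairs with the same \<open>z\<close> give the same new vertex if the two \<open>w\<close> are
  equal or span a triangle with \<open>z\<close>. Since links have no induced 4- or 5-cycles this relation is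
  transitive, and in the cover the neighbours of a vertex one level down form a simplex, while adjacent
  vertices of equal level have a common neighbour one level down. Simple connectedness, used through
  the Lebesgue number of a homotopy, makes the cover equal to \<open>X\<close>. So \<open>X\<close> itself is flag, and for every
  simplex \<open>A\<close> of level \<open>k + 1\<close> the common neighbours of \<open>A\<close> on level \<open>k\<close> form a nonempty simplex that
  spans a simplex together with \<open>A\<close>. This yields a deformation of the ball of radius \<open>k + 1\<close> into the
  ball of radius \<open>k\<close>, and the concatenation of these deformations contracts \<open>X\<close>.
\<close>

section \<open>The topology of the realization\<close>

text \<open>Only the links are assumed flag, so at first it is not even known that three pairwise
  adjacent vertices of \<open>X\<close> span a triangle. In the covering such facts hold by
  construction, level by level, and they descend once it is identified with \<open>X\<close>.
  Pentagons must be excluded because two consecutive horizontal edges bring two different lower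
  neighbours; together with the new vertex these make five points in a link.

  A projection onto a smaller ball is usually given on the barycentric subdivision, by sending the
  barycentre of \<open>A\<close> to a point below \<open>A\<close>. The formula used here avoids
  subdividing: the superlevel sets of the coordinates on the upper level form a chain of faces,
  which is what a point of the subdivision records, and maxima of coordinates are visibly
  continuous.

  The vertices below \<open>A\<close> form a clique, and finite dimension makes this clique a
  simplex. It also keeps the track of one closed simplex inside finitely many closed simplices, and
  there the CW topology is the product topology; so local finiteness is never an issue.\<close>

lemma asc_finite: "abstract_simplicial_complex X \<Longrightarrow> \<sigma> \<in> X \<Longrightarrow> finite \<sigma>"
  and asc_nonempty: "abstract_simplicial_complex X \<Longrightarrow> \<sigma> \<in> X \<Longrightarrow> \<sigma> \<noteq> {}"
  and asc_face: "abstract_simplicial_complex X \<Longrightarrow> \<sigma> \<in> X \<Longrightarrow> \<tau> \<subseteq> \<sigma> \<Longrightarrow> \<tau> \<noteq> {} \<Longrightarrow> \<tau> \<in> X"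
  unfolding abstract_simplicial_complex_def by blast+

lemma asc_vertex: "abstract_simplicial_complex X \<Longrightarrow> v \<in> vertices X \<longleftrightarrow> {v} \<in> X"
  unfolding vertices_def using asc_face[of X _ "{v}"] by blast

lemma continuous_on_coordinate:
  "continuous_on S (\<lambda>x :: 'a \<Rightarrow> 'b::topological_space. x i)"
  by (rule continuous_on_subset[OF continuous_on_product_coordinates]) simp

lemma closed_closed_simplex:
  assumes "finite \<sigma>"
  shows "closed (closed_simplex \<sigma> :: ('a \<Rightarrow> real) set)"
proof -
  have "closed_simplex \<sigma> =
      (\<Inter>v. {x. 0 \<le> x v}) \<inter> (\<Inter>v\<in>-\<sigma>. {x. x v = 0}) \<inter> {x :: 'a \<Rightarrow> real. sum x \<sigma> = 1}"
    unfolding closed_simplex_def by auto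
  moreover have "continuous_on UNIV (\<lambda>x :: 'a \<Rightarrow> real. x v)" for v
    by simp
  ultimately show ?thesis
    by (auto intro!: closed_Int closed_INT closed_Collect_le closed_Collect_eq continuous_on_sum)
qed

lemma closed_simplex_mono:
  assumes "\<sigma> \<subseteq> \<tau>" "finite \<tau>"
  shows "closed_simplex \<sigma> \<subseteq> closed_simplex \<tau>"
proof
  fix x assume x: "x \<in> closed_simplex \<sigma>"
  have "sum x \<sigma> = sum x \<tau>"
    using assms x by (intro sum.mono_neutral_left) (auto simp: closed_simplex_def)
  then show "x \<in> closed_simplex \<tau>"
    using x assms by (auto simp: closed_simplex_def)
qed

lemma realization_set_iff:
  assumes "abstract_simplicial_complex X"
  shows "x \<in> realization_set X \<longleftrightarrow>
    (\<forall>v. 0 \<le> x v) \<and> {v. 0 < x v} \<in> X \<and> sum x {v. 0 < x v} = 1"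
proof
  assume "x \<in> realization_set X"
  then obtain \<sigma> where s: "\<sigma> \<in> X" "x \<in> closed_simplex \<sigma>"
    unfolding realization_set_def by blast
  have sub: "{v. 0 < x v} \<subseteq> \<sigma>" using s(2) unfolding closed_simplex_def by force
  have "sum x {v. 0 < x v} = sum x \<sigma>"
    using s sub asc_finite[OF assms s(1)]
    by (intro sum.mono_neutral_left) (auto simp: closed_simplex_def order_le_less)
  then have 1: "sum x {v. 0 < x v} = 1" using s(2) by (simp add: closed_simplex_def)
  then have "{v. 0 < x v} \<noteq> {}" by (metis sum.empty zero_neq_one)
  then show "(\<forall>v. 0 \<le> x v) \<and> {v. 0 < x v} \<in> X \<and> sum x {v. 0 < x v} = 1"
    using 1 asc_face[OF assms s(1) sub] s(2) by (auto simp: closed_simplex_def)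
next
  assume "(\<forall>v. 0 \<le> x v) \<and> {v. 0 < x v} \<in> X \<and> sum x {v. 0 < x v} = 1"
  then have "x \<in> closed_simplex {v. 0 < x v}" "{v. 0 < x v} \<in> X"
    by (auto simp: closed_simplex_def order_le_less)
  then show "x \<in> realization_set X" unfolding realization_set_def by blast
qed

lemma closed_simplex_support:
  "x \<in> closed_simplex \<sigma> \<Longrightarrow> {v. 0 < x v} \<subseteq> \<sigma>"
  unfolding closed_simplex_def by force

lemma closed_simplex_subset_realization_set: "\<sigma> \<in> X \<Longrightarrow> closed_simplex \<sigma> \<subseteq> realization_set X"
  unfolding realization_set_def by blast

lemma closedin_realization_Int:
  assumes "closedin (realization X) C" "\<sigma> \<in> X"
  shows "closedin (top_of_set (closed_simplex \<sigma>)) (C \<inter> closed_simplex \<sigma>)"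
proof -
  have "openin (realization X) (realization_set X - C)"
    using assms(1) unfolding closedin_def topspace_realization by blast
  then have "openin (top_of_set (closed_simplex \<sigma>)) ((realization_set X - C) \<inter> closed_simplex \<sigma>)"
    using assms(2) openin_realization by blast
  moreover have "(realization_set X - C) \<inter> closed_simplex \<sigma> = closed_simplex \<sigma> - C \<inter> closed_simplex \<sigma>"
    using closed_simplex_subset_realization_set[OF assms(2)] by blast
  ultimately show ?thesis unfolding closedin_def by simp
qed

text \<open>The realization carries the subspace topology of the product topology on every finite union of
  closed simplices, since those are closed there.\<close>

lemma continuous_map_into_realization:
  fixes g :: "'z::topological_space \<Rightarrow> 'a \<Rightarrow> real"
  assumes X: "abstract_simplicial_complex X" and F: "finite F" "F \<subseteq> X"
    and g: "continuous_on S g" "g ` S \<subseteq> (\<Union>\<sigma>\<in>F. closed_simplex \<sigma>)"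
  shows "continuous_map (top_of_set S) (realization X) g"
  unfolding continuous_map_closedin
proof (intro conjI allI impI)
  show "g \<in> topspace (top_of_set S) \<rightarrow> topspace (realization X)"
    using g(2) F(2) unfolding topspace_realization realization_set_def by auto
  fix C assume C: "closedin (realization X) C"
  have cl: "closed (C \<inter> closed_simplex \<sigma>)" if "\<sigma> \<in> F" for \<sigma>
    using closedin_closed_trans[OF closedin_realization_Int[OF C] closed_closed_simplex]
      that F(2) asc_finite[OF X] by blast
  have "{x \<in> topspace (top_of_set S). g x \<in> C} = (\<Union>\<sigma>\<in>F. S \<inter> g -` (C \<inter> closed_simplex \<sigma>))"
    using g(2) by (simp add: image_subset_iff) blast
  moreover have "closedin (top_of_set S) (\<Union>\<sigma>\<in>F. S \<inter> g -` (C \<inter> closed_simplex \<sigma>))"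
    using F(1) continuous_closedin_preimage[OF g(1) cl] by (intro closedin_Union) auto
  ultimately show "closedin (top_of_set S) {x \<in> topspace (top_of_set S). g x \<in> C}" by simp
qed

lemma continuous_map_simplex_realization:
  assumes "abstract_simplicial_complex X" "\<sigma> \<in> X"
  shows "continuous_map (top_of_set (closed_simplex \<sigma>)) (realization X) id"
  by (rule continuous_map_into_realization[OF assms(1), of "{\<sigma>}"]) (use assms in auto)

lemma realization_finite_complex:
  assumes X: "abstract_simplicial_complex X" "finite X"
  shows "realization X = top_of_set (realization_set X)"
  unfolding topology_eq
proof (intro allI iffI)
  fix U
  have c: "continuous_map (top_of_set (realization_set X)) (realization X) id"
    by (rule continuous_map_into_realization[OF X(1) X(2) subset_refl])
      (auto simp: realization_set_def)
  assume U: "openin (realization X) U"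
  then have "openin (top_of_set (realization_set X)) {x \<in> realization_set X. id x \<in> U}"
    using c unfolding continuous_map_def by simp
  moreover have "{x \<in> realization_set X. id x \<in> U} = U"
    using openin_subset[OF U] by (auto simp: topspace_realization)
  ultimately show "openin (top_of_set (realization_set X)) U" by simp
next
  fix U assume U: "openin (top_of_set (realization_set X)) U"
  then have "openin (top_of_set (closed_simplex \<sigma>)) (U \<inter> closed_simplex \<sigma>)" if "\<sigma> \<in> X" for \<sigma>
    using closed_simplex_subset_realization_set[OF that] unfolding openin_open by blast
  then show "openin (realization X) U"
    using openin_subset[OF U] by (simp add: openin_realization)
qed

lemma continuous_map_subcomplex:
  assumes "K \<subseteq> X"
  shows "continuous_map (realization K) (realization X) id"
  unfolding continuous_map_def topspace_realization
proof (intro conjI allI impI)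
  show "id \<in> realization_set K \<rightarrow> realization_set X"
    using assms unfolding realization_set_def by auto
  fix U assume U: "openin (realization X) U"
  have "{x \<in> realization_set K. id x \<in> U} \<inter> closed_simplex \<sigma> = U \<inter> closed_simplex \<sigma>" if "\<sigma> \<in> K" for \<sigma>
    using closed_simplex_subset_realization_set[OF that] by auto
  then show "openin (realization K) {x \<in> realization_set K. id x \<in> U}"
    using U assms by (auto simp: openin_realization)
qed

text \<open>A product with a weak topology need not carry the weak topology of the products of the
  cells. With the interval as factor it does: time is first shrunk to a compact interval, and the
  tube lemma then works in every simplex separately.\<close>

lemma continuous_map_from_interval_times_realization:
  fixes F :: "real \<times> ('a \<Rightarrow> real) \<Rightarrow> 'c"
  assumes F: "\<And>\<sigma>. \<sigma> \<in> X \<Longrightarrow> continuous_map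
      (prod_topology (top_of_set {0..1}) (top_of_set (closed_simplex \<sigma>))) T F"
  shows "continuous_map (prod_topology (top_of_set {0..1}) (realization X)) T F"
  unfolding continuous_map_def
proof (intro conjI allI impI)
  have "F (s, x) \<in> topspace T" if "s \<in> {0..1}" "\<sigma> \<in> X" "x \<in> closed_simplex \<sigma>" for s x \<sigma>
    using continuous_map_image_subset_topspace[OF F[OF that(2)]] that(1,3) by auto
  then show "F \<in> topspace (prod_topology (top_of_set {0..1}) (realization X)) \<rightarrow> topspace T"
    by (auto simp: topspace_realization realization_set_def)
  fix U assume U: "openin T U"
  let ?W = "\<lambda>\<sigma>. {p \<in> {0..1} \<times> closed_simplex \<sigma>. F p \<in> U}"
  have W: "openin (prod_topology (top_of_set {0..1}) (top_of_set (closed_simplex \<sigma>))) (?W \<sigma>)"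
    if "\<sigma> \<in> X" for \<sigma>
    using F[OF that] U unfolding continuous_map_def by simp
  show "openin (prod_topology (top_of_set {0..1}) (realization X))
      {p \<in> topspace (prod_topology (top_of_set {0..1}) (realization X)). F p \<in> U}"
    unfolding openin_prod_topology_alt
  proof (intro allI impI)
    fix s0 x0
    assume "(s0, x0) \<in> {p \<in> topspace (prod_topology (top_of_set {0..1}) (realization X)). F p \<in> U}"
    then have s0: "s0 \<in> {0..1}" and x0: "x0 \<in> realization_set X" and u0: "F (s0, x0) \<in> U"
      by (auto simp: topspace_realization)
    obtain \<sigma>0 where \<sigma>0: "\<sigma>0 \<in> X" "x0 \<in> closed_simplex \<sigma>0"
      using x0 unfolding realization_set_def by blast
    have "(s0, x0) \<in> ?W \<sigma>0" using s0 \<sigma>0 u0 by auto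
    then obtain A B where AB: "openin (top_of_set {0..1}) A" "s0 \<in> A" "x0 \<in> B" "A \<times> B \<subseteq> ?W \<sigma>0"
      using W[OF \<sigma>0(1)] unfolding openin_prod_topology_alt by meson
    obtain e where e: "e > 0" "cball s0 e \<inter> {0..1} \<subseteq> A"
      using AB(1,2) unfolding openin_contains_cball by blast
    define J where "J = cball s0 e \<inter> {0..1}"
    have J: "compact J" "J \<subseteq> {0..1}" unfolding J_def by (auto intro: compact_Int_closed)
    have J0: "\<forall>s\<in>J. F (s, x0) \<in> U" using AB(3,4) e(2) unfolding J_def by blast
    \<comment> \<open>One compact \<open>J\<close> serves all simplices; asking for all of
      \<open>J\<close> at once is what lets the tube lemma show \<open>V\<close> open in each of
      them.\<close>
    define V where "V = {x \<in> realization_set X. \<forall>s\<in>J. F (s, x) \<in> U}"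
    have "openin (top_of_set (closed_simplex \<sigma>)) (V \<inter> closed_simplex \<sigma>)" if \<sigma>: "\<sigma> \<in> X" for \<sigma>
    proof (subst openin_subopen, intro ballI)
      fix x assume x: "x \<in> V \<inter> closed_simplex \<sigma>"
      then have "J \<times> {x} \<subseteq> ?W \<sigma>" using J(2) unfolding V_def by auto
      moreover have "compactin (top_of_set {0..1}) J"
        using J by (simp add: compactin_subtopology)
      ultimately obtain A' B' where *: "openin (top_of_set (closed_simplex \<sigma>)) B'" "J \<subseteq> A'" "x \<in> B'"
          "A' \<times> B' \<subseteq> ?W \<sigma>"
        using tube_lemma_left[OF W[OF \<sigma>], of J x] x by auto
      have "B' \<subseteq> V \<inter> closed_simplex \<sigma>"
        using * openin_subset[OF *(1)] closed_simplex_subset_realization_set[OF \<sigma>]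
        unfolding V_def by fastforce
      then show "\<exists>B'. openin (top_of_set (closed_simplex \<sigma>)) B' \<and> x \<in> B' \<and> B' \<subseteq> V \<inter> closed_simplex \<sigma>"
        using * by blast
    qed
    then have "openin (realization X) V"
      unfolding openin_realization V_def by blast
    moreover have "x0 \<in> V" using x0 J0 unfolding V_def by blast
    moreover have "openin (top_of_set {0..1}) (ball s0 e \<inter> {0..1})"
      by (auto simp: openin_open)
    moreover have "s0 \<in> ball s0 e \<inter> {0..1}" using s0 e(1) by auto
    moreover have "(ball s0 e \<inter> {0..1}) \<times> V
        \<subseteq> {p \<in> topspace (prod_topology (top_of_set {0..1}) (realization X)). F p \<in> U}"
      unfolding V_def J_def by (auto simp: topspace_realization)
    ultimately show "\<exists>A V. openin (top_of_set {0..1}) A \<and> openin (realization X) V \<and> s0 \<in> A \<and>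
        x0 \<in> V \<and> A \<times> V \<subseteq> {p \<in> topspace (prod_topology (top_of_set {0..1}) (realization X)). F p \<in> U}"
      by blast
  qed
qed

text \<open>Open stars pull back under a homotopy to the open cover of the square to which the
  Lebesgue number is applied.\<close>

lemma open_star:
  "openin (realization X) {x \<in> realization_set X. 0 < x v}"
  unfolding openin_realization
proof (intro conjI ballI)
  fix \<sigma> assume "\<sigma> \<in> X"
  then have "{x \<in> realization_set X. 0 < x v} \<inter> closed_simplex \<sigma> = closed_simplex \<sigma> \<inter> {x. 0 < x v}"
    using closed_simplex_subset_realization_set by blast
  moreover have "open {x :: 'a \<Rightarrow> real. 0 < x v}"
    by (intro open_Collect_less) simp_all
  ultimately show "openin (top_of_set (closed_simplex \<sigma>)) ({x \<in> realization_set X. 0 < x v} \<inter> closed_simplex \<sigma>)"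
    by (auto simp: openin_open)
qed blast

section \<open>Polygons and cycles\<close>

definition hat :: "real \<Rightarrow> real" where
  "hat x = max 0 (1 - \<bar>x\<bar>)"

text \<open>The piecewise linear edge path that passes \<open>u k\<close> at time \<open>k\<close>.
  As a sum of hat functions it is continuous coordinate by coordinate, and weights simply add up
  where consecutive vertices coincide.\<close>

definition polygon :: "(nat \<Rightarrow> 'a) \<Rightarrow> nat \<Rightarrow> real \<Rightarrow> 'a \<Rightarrow> real" where
  "polygon u m s = (\<lambda>v. \<Sum>k\<le>m. if u k = v then hat (s - real k) else 0)"

lemma continuous_polygon: "continuous_on S (polygon u m)"
  unfolding polygon_def hat_def
proof (intro continuous_on_coordinatewise_then_product continuous_on_sum)
  show "continuous_on S (\<lambda>s. if u k = v then max 0 (1 - \<bar>s - real k\<bar>) else 0)" for k v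
    by (cases "u k = v") (auto intro!: continuous_intros)
qed

lemma polygon_segment:
  assumes "k < m" "real k \<le> s" "s \<le> real k + 1"
  shows "polygon u m s = (\<lambda>v. (if u k = v then real k + 1 - s else 0) + (if u (Suc k) = v then s - real k else 0))"
proof
  fix v
  have "polygon u m s v = (\<Sum>j\<in>{k, Suc k}. if u j = v then hat (s - real j) else 0)"
    unfolding polygon_def
  proof (rule sum.mono_neutral_right)
    show "\<forall>j\<in>{..m} - {k, Suc k}. (if u j = v then hat (s - real j) else 0) = 0"
    proof
      fix j assume "j \<in> {..m} - {k, Suc k}"
      then have "j < k \<or> Suc k < j" by auto
      then have "real j + 1 \<le> real k \<or> real k + 2 \<le> real j" by linarith
      then have "hat (s - real j) = 0" using assms unfolding hat_def by (auto simp: max_def abs_if)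
      then show "(if u j = v then hat (s - real j) else 0) = 0" by simp
    qed
  qed (use assms in auto)
  moreover have "hat (s - real k) = real k + 1 - s" "hat (s - real (Suc k)) = s - real k"
    using assms unfolding hat_def by (auto simp: max_def abs_if)
  ultimately show "polygon u m s v = (if u k = v then real k + 1 - s else 0) + (if u (Suc k) = v then s - real k else 0)"
    by simp
qed

lemma polygon_vertex:
  assumes "k \<le> m"
  shows "polygon u m (real k) = (\<lambda>v. if u k = v then 1 else 0)"
proof (cases "k < m")
  case True
  then show ?thesis by (subst polygon_segment[of k]) auto
next
  case False
  show ?thesis
  proof (cases m)
    case 0
    then show ?thesis using assms by (auto simp: polygon_def hat_def)
  next
    case (Suc l)
    then show ?thesis using assms False by (subst polygon_segment[of l]) auto
  qed
qed

lemma polygon_in_simplex: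
  assumes "k < m" "real k \<le> s" "s \<le> real k + 1"
  shows "polygon u m s \<in> closed_simplex {u k, u (Suc k)}"
  unfolding polygon_segment[OF assms] closed_simplex_def using assms
  by (cases "u k = u (Suc k)") auto

lemma segment_index:
  assumes "0 < m" "0 \<le> s" "s \<le> real m"
  obtains k where "k < m" "real k \<le> s" "s \<le> real k + 1"
proof (cases "s = real m")
  case True
  \<comment> \<open>The floor of the right endpoint would be \<open>m\<close>, one past the last
    segment.\<close>
  then show ?thesis using assms(1) that[of "m - 1"] by (simp add: of_nat_diff)
next
  case False
  let ?k = "nat \<lfloor>s\<rfloor>"
  have "real ?k \<le> s" "s < real ?k + 1" using assms(2) by linarith+
  moreover have "?k < m" using False assms calculation by linarith
  ultimately show ?thesis using that[of ?k] by simp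
qed

lemma nat_floor_exists:
  assumes "0 \<le> (a::real)"
  obtains k where "real k \<le> a" "a < real k + 1"
proof
  show "real (nat \<lfloor>a\<rfloor>) \<le> a" "a < real (nat \<lfloor>a\<rfloor>) + 1"
    using assms by linarith+
qed

text \<open>The hat functions of \<open>a\<close> and \<open>b\<close> are compared at the inner nodes only, because the nodes \<open>0\<close>
  and \<open>n\<close> are identified in a closed polygon.\<close>

lemma hat_inj:
  assumes n: "3 \<le> n" and ab: "0 \<le> a" "a < b" "b \<le> real n"
    and eq: "\<And>k. 0 < k \<Longrightarrow> k < n \<Longrightarrow> hat (a - real k) = hat (b - real k)"
  shows "a = 0 \<and> b = real n"
proof -
  have hat_pos: "hat x = 1 - x" if "0 \<le> x" "x < 1" for x
    using that unfolding hat_def by auto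
  have hat_less: "hat y < 1 - x" if "0 \<le> x" "x < 1" "x < y" for x y
    using that unfolding hat_def by auto
  have hat_neg: "hat (- x) = 1 - x" if "0 \<le> x" "x < 1" for x
    using that unfolding hat_def by auto
  obtain k where k: "real k \<le> a" "a < real k + 1" using nat_floor_exists[OF ab(1)] .
  have kn: "k < n" using k ab by linarith
  show ?thesis
  proof (cases "0 < k")
    case True
    have "hat (b - real k) < 1 - (a - real k)" using k ab by (intro hat_less) auto
    moreover have "hat (a - real k) = 1 - (a - real k)" using k by (intro hat_pos) auto
    ultimately show ?thesis using eq[OF True kn] by linarith
  next
    case False
    then have a: "a < 1" using k by simp
    have e1: "hat (a - 1) = hat (b - 1)" using eq[of 1] n by simp
    have e2: "hat (a - 2) = hat (b - 2)" using eq[of 2] n by simp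
    \<comment> \<open>If \<open>a > 0\<close>, the only other point with the same hat value at node
      1 is \<open>b = 2 - a\<close>, where the hat at node 2 is positive while it vanishes at
      \<open>a\<close>. Node 2 is an inner node because \<open>n\<close> is at least 3.\<close>
    have a0: "a = 0"
    proof (rule ccontr)
      assume "a \<noteq> 0"
      then have "hat (b - 1) = a" "hat (b - 2) = 0" using e1 e2 a ab unfolding hat_def by auto
      then have "\<bar>b - 1\<bar> = 1 - a" "1 \<le> \<bar>b - 2\<bar>" using \<open>a \<noteq> 0\<close> ab unfolding hat_def by linarith+
      then show False using a ab \<open>a \<noteq> 0\<close> by linarith
    qed
    have "b = real n"
    proof (rule ccontr)
      assume bn: "b \<noteq> real n"
      have "0 \<le> b" using ab by linarith
      then obtain l where l: "real l \<le> b" "b < real l + 1" using nat_floor_exists by blast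
      have ln: "l < n" using l ab bn by linarith
      show False
      proof (cases "0 < l")
        case True
        have "hat (b - real l) = 1 - (b - real l)" using l by (intro hat_pos) auto
        moreover have "hat (a - real l) = 0" using True a0 unfolding hat_def by auto
        ultimately show ?thesis using eq[OF True ln] l by linarith
      next
        case False
        then have "b < 1" using l by simp
        then show ?thesis using e1 a0 ab unfolding hat_def by auto
      qed
    qed
    then show ?thesis using a0 by blast
  qed
qed

definition cycle_complex :: "(nat \<Rightarrow> 'a) \<Rightarrow> nat \<Rightarrow> 'a set set" where
  "cycle_complex u n = (\<Union>k<n. {{u k}, {u k, u (Suc k)}})"

lemma cycle_complex_asc:
  assumes "u n = u 0"
  shows "abstract_simplicial_complex (cycle_complex u n)"
proof -
  have v: "{u (Suc k)} \<in> cycle_complex u n" if "k < n" for k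
  proof (cases "Suc k < n")
    case False
    then have "Suc k = n" using that by simp
    then show ?thesis using assms that unfolding cycle_complex_def by force
  qed (auto simp: cycle_complex_def)
  have "\<tau> \<in> cycle_complex u n" if "\<sigma> \<in> cycle_complex u n" "\<tau> \<subseteq> \<sigma>" "\<tau> \<noteq> {}" for \<sigma> \<tau>
  proof -
    obtain k where k: "k < n" "\<sigma> = {u k} \<or> \<sigma> = {u k, u (Suc k)}"
      using \<open>\<sigma> \<in> _\<close> unfolding cycle_complex_def by blast
    then have "\<tau> = {u k} \<or> \<tau> = {u (Suc k)} \<or> \<tau> = {u k, u (Suc k)}"
      using that(2,3) by blast
    then show ?thesis using v[OF k(1)] k(1) unfolding cycle_complex_def by blast
  qed
  then show ?thesis
    unfolding abstract_simplicial_complex_def by (auto simp: cycle_complex_def)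
qed

lemma cycle_complex_vertices:
  assumes "u n = u 0" "\<sigma> \<in> cycle_complex u n"
  shows "\<sigma> \<subseteq> u ` {..<n}"
proof -
  have "u (Suc k) \<in> u ` {..<n}" if "k < n" for k
  proof (cases "Suc k < n")
    case False
    then have "Suc k = n" using that by simp
    then show ?thesis using assms(1) that by force
  qed auto
  then show ?thesis using assms(2) unfolding cycle_complex_def by auto
qed

text \<open>The polygon along the cycle is injective up to its endpoints and fills the realization,
  which is therefore the image of a closed simple path.\<close>

lemma cycle_complex_circle:
  assumes n: "3 \<le> n" and u: "u n = u 0" "inj_on u {..<n}"
  shows "realization (cycle_complex u n) homeomorphic_space top_of_set (sphere (0::complex) 1)"
proof -
  let ?C = "cycle_complex u n" and ?p = "\<lambda>t. polygon u n (real n * t)"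
  \<comment> \<open>\<open>\<Phi>\<close> reads off the coordinates along the cycle and
    \<open>\<Psi>\<close> restores them. This moves the curve into the metric space
    \<open>nat \<Rightarrow> real\<close>, where the theorem on closed simple paths is
    applied.\<close>
  define \<Phi> :: "('a \<Rightarrow> real) \<Rightarrow> nat \<Rightarrow> real" where "\<Phi> = (\<lambda>x k. if k < n then x (u k) else 0)"
  define \<Psi> :: "(nat \<Rightarrow> real) \<Rightarrow> 'a \<Rightarrow> real" where "\<Psi> = (\<lambda>y v. \<Sum>k<n. if u k = v then y k else 0)"
  have \<Phi>: "continuous_on S \<Phi>" for S unfolding \<Phi>_def
  proof (rule continuous_on_coordinatewise_then_product)
    show "continuous_on S (\<lambda>x. if k < n then x (u k) else 0)" for k
      by (cases "k < n") (auto intro: continuous_on_coordinate)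
  qed
  have \<Psi>: "continuous_on S \<Psi>" for S unfolding \<Psi>_def
  proof (intro continuous_on_coordinatewise_then_product continuous_on_sum)
    show "continuous_on S (\<lambda>y. if u k = v then y k else 0)" for k v
      by (cases "u k = v") (auto intro: continuous_on_coordinate)
  qed
  have coord: "polygon u n s (u k) = hat (s - real k)" if "0 < k" "k < n" for k s
  proof -
    have "(if u j = u k then hat (s - real j) else 0) = (if j = k then hat (s - real j) else 0)"
      if "j \<in> {..n}" for j
    proof (cases "j = n")
      case True
      then have "u j \<noteq> u k" using u inj_onD[OF u(2), of 0 k] \<open>0 < k\<close> \<open>k < n\<close> by auto
      then show ?thesis using True \<open>k < n\<close> by auto
    next
      case False
      then show ?thesis using that inj_onD[OF u(2), of j k] \<open>k < n\<close> by auto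
    qed
    then have "polygon u n s (u k) = (\<Sum>j\<le>n. if j = k then hat (s - real j) else 0)"
      unfolding polygon_def by (intro sum.cong) auto
    then show ?thesis using that by simp
  qed
  have path: "path (\<Phi> \<circ> ?p)" unfolding path_def
    by (intro continuous_on_compose \<Phi> continuous_on_compose2[OF continuous_polygon[of UNIV u n]])
      (auto intro!: continuous_intros)
  have simple: "simple_path (\<Phi> \<circ> ?p)"
  proof (rule simple_pathI[OF path])
    fix x y :: real assume xy: "0 \<le> x" "x < y" "y \<le> 1" "(\<Phi> \<circ> ?p) x = (\<Phi> \<circ> ?p) y"
    have "real n * x = 0 \<and> real n * y = real n"
    proof (rule hat_inj[OF n])
      show "hat (real n * x - real k) = hat (real n * y - real k)" if "0 < k" "k < n" for k
        using fun_cong[OF xy(4), of k] coord[OF that] that(2) by (simp add: \<Phi>_def)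
    qed (use xy n in auto)
    then show "x = 0 \<and> y = 1" using n by auto
  qed
  have loop: "pathfinish (\<Phi> \<circ> ?p) = pathstart (\<Phi> \<circ> ?p)"
    using polygon_vertex[of 0 n u] polygon_vertex[of n n u] u(1)
    by (simp add: pathfinish_def pathstart_def)
  have "path_image ?p = realization_set ?C"
  proof
    show "path_image ?p \<subseteq> realization_set ?C"
    proof
      fix x assume "x \<in> path_image ?p"
      then obtain t where t: "0 \<le> t" "t \<le> 1" "x = ?p t" unfolding path_image_def by auto
      have "0 < n" "0 \<le> real n * t" "real n * t \<le> real n"
        using n t by (auto simp: mult_left_le)
      then obtain k where k: "k < n" "real k \<le> real n * t" "real n * t \<le> real k + 1"
        by (rule segment_index)
      have "{u k, u (Suc k)} \<in> ?C" using k(1) unfolding cycle_complex_def by blast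
      then show "x \<in> realization_set ?C"
        using polygon_in_simplex[OF k, of u] t(3) unfolding realization_set_def by blast
    qed
    show "realization_set ?C \<subseteq> path_image ?p"
    proof
      fix x assume "x \<in> realization_set ?C"
      then obtain \<sigma> where s: "\<sigma> \<in> ?C" "x \<in> closed_simplex \<sigma>" unfolding realization_set_def by blast
      then obtain k where k: "k < n" "\<sigma> \<subseteq> {u k, u (Suc k)}"
        unfolding cycle_complex_def by blast
      have x: "x \<in> closed_simplex {u k, u (Suc k)}"
        using closed_simplex_mono[OF k(2)] s(2) by blast
      have ne: "u k \<noteq> u (Suc k)"
      proof (cases "Suc k = n")
        case True
        then show ?thesis using u n k inj_onD[OF u(2), of 0 k] by auto
      next
        case False
        then show ?thesis using k inj_onD[OF u(2), of k "Suc k"] by auto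
      qed
      define s where "s = real k + x (u (Suc k))"
      have xs: "x (u k) + x (u (Suc k)) = 1" "\<And>v. 0 \<le> x v" "\<And>v. v \<noteq> u k \<Longrightarrow> v \<noteq> u (Suc k) \<Longrightarrow> x v = 0"
        using x ne unfolding closed_simplex_def by auto
      have "real k \<le> s" "s \<le> real k + 1"
        using xs(1) xs(2)[of "u k"] xs(2)[of "u (Suc k)"] unfolding s_def by auto
      from polygon_segment[OF k(1) this, of u] have "x = polygon u n s"
        using xs(1,3) ne by (auto simp: s_def fun_eq_iff)
      moreover have "s / real n \<in> {0..1}" "real n * (s / real n) = s"
        using \<open>real k \<le> s\<close> \<open>s \<le> real k + 1\<close> k(1) by (auto simp: divide_simps)
      ultimately show "x \<in> path_image ?p" unfolding path_image_def by (metis image_eqI)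
    qed
  qed
  then have image: "\<Phi> ` realization_set ?C = path_image (\<Phi> \<circ> ?p)"
    unfolding path_image_def image_comp[symmetric] by simp
  have inverse: "\<Psi> (\<Phi> x) = x" if "x \<in> realization_set ?C" for x
  proof
    fix v
    have "{v. 0 < x v} \<subseteq> u ` {..<n}" and pos: "0 \<le> x v"
      using that cycle_complex_vertices[OF u(1)] unfolding realization_set_iff[OF cycle_complex_asc[OF u(1)]]
      by (auto simp: vertices_def)
    show "\<Psi> (\<Phi> x) v = x v"
    proof (cases "v \<in> u ` {..<n}")
      case True
      then obtain i where i: "i < n" "v = u i" by blast
      have "(if u k = v then \<Phi> x k else 0) = (if k = i then x v else 0)" if "k \<in> {..<n}" for k
        using inj_onD[OF u(2), of k i] i that by (auto simp: \<Phi>_def)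
      then have "\<Psi> (\<Phi> x) v = (\<Sum>k<n. if k = i then x v else 0)"
        unfolding \<Psi>_def by (rule sum.cong[OF refl])
      then show ?thesis using i by simp
    next
      case False
      then have "x v = 0" using \<open>{v. 0 < x v} \<subseteq> u ` {..<n}\<close> pos by (auto simp: order_le_less)
      moreover have "\<Psi> (\<Phi> x) v = 0"
        unfolding \<Psi>_def using False by (intro sum.neutral) auto
      ultimately show ?thesis by simp
    qed
  qed
  have "homeomorphism (realization_set ?C) (path_image (\<Phi> \<circ> ?p)) \<Phi> \<Psi>"
    unfolding image[symmetric] using \<Phi> \<Psi> inverse by (intro homeomorphismI) auto
  then have "realization_set ?C homeomorphic path_image (\<Phi> \<circ> ?p)"
    unfolding homeomorphic_def by blast
  also have "path_image (\<Phi> \<circ> ?p) homeomorphic sphere (0::complex) 1"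
    using homeomorphic_simple_path_image_circle[OF simple loop] by simp
  finally obtain f g where "homeomorphism (realization_set ?C) (sphere (0::complex) 1) f g"
    unfolding homeomorphic_def by blast
  then have "homeomorphic_maps (top_of_set (realization_set ?C)) (top_of_set (sphere (0::complex) 1)) f g"
    unfolding homeomorphism_def homeomorphic_maps_def by auto
  moreover have "realization ?C = top_of_set (realization_set ?C)"
    by (rule realization_finite_complex[OF cycle_complex_asc[OF u(1)]]) (simp add: cycle_complex_def)
  ultimately show ?thesis unfolding homeomorphic_space_def by auto
qed

lemma cycle_complex_length:
  assumes n: "3 \<le> n" and u: "u n = u 0" "inj_on u {..<n}"
  shows "edges (cycle_complex u n) = (\<lambda>k. {u k, u (Suc k)}) ` {..<n}"
    and "cycle_length (cycle_complex u n) = n"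
proof -
  have eq: "i = j \<or> i = 0 \<and> j = n \<or> i = n \<and> j = 0" if "u i = u j" "i \<le> n" "j \<le> n" for i j
    using that u(1) inj_onD[OF u(2), of i j] inj_onD[OF u(2), of i 0] inj_onD[OF u(2), of 0 j] n
    by (cases "i = n"; cases "j = n") auto
  have ne: "u k \<noteq> u (Suc k)" if "k < n" for k
    using eq[of k "Suc k"] that n by auto
  show e: "edges (cycle_complex u n) = (\<lambda>k. {u k, u (Suc k)}) ` {..<n}"
    unfolding edges_def cycle_complex_def using ne by (auto simp: card_insert_if)
  have "inj_on (\<lambda>k. {u k, u (Suc k)}) {..<n}"
  proof (rule inj_onI)
    fix i j assume ij: "i \<in> {..<n}" "j \<in> {..<n}" "{u i, u (Suc i)} = {u j, u (Suc j)}"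
    then have "u i = u j \<or> u i = u (Suc j) \<and> u (Suc i) = u j" by (auto simp: doubleton_eq_iff)
    then show "i = j" using eq[of i j] eq[of i "Suc j"] eq[of "Suc i" j] ij n by auto
  qed
  then show "cycle_length (cycle_complex u n) = n"
    unfolding cycle_length_def e by (simp add: card_image)
qed

text \<open>Here the topological notion of a cycle is traded for closed sequences of vertices; the
  homeomorphism with the circle is not mentioned again.\<close>

lemma k_large_diagonal:
  assumes L: "k_large k L" and n: "4 \<le> n" "n < k"
    and u: "u n = u 0" "inj_on u {..<n}"
    and e: "\<And>i. i < n \<Longrightarrow> {u i} \<in> L \<and> {u i, u (Suc i)} \<in> L"
  obtains i j where "i < n" "j < n" "{u i, u j} \<in> L" "u i \<noteq> u j"
    "\<And>l. l < n \<Longrightarrow> {u i, u j} \<noteq> {u l, u (Suc l)}"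
proof -
  let ?C = "cycle_complex u n"
  have n3: "3 \<le> n" using n by simp
  have "subcomplex ?C L"
    using cycle_complex_asc[OF u(1)] e unfolding subcomplex_def cycle_complex_def by auto
  then have "cycle_in ?C L" using cycle_complex_circle[OF n3 u] unfolding cycle_in_def by blast
  then have "has_diagonal ?C L"
    using L n cycle_complex_length(2)[OF n3 u] unfolding k_large_def by auto
  then obtain v w where vw: "v \<in> vertices ?C" "w \<in> vertices ?C" "v \<noteq> w" "{v, w} \<in> L" "{v, w} \<notin> edges ?C"
    unfolding has_diagonal_def edges_def by blast
  have vert: "x \<in> u ` {..<n}" if x: "x \<in> vertices ?C" for x
    using x cycle_complex_vertices[OF u(1)] unfolding vertices_def by blast
  obtain i j where "i < n" "j < n" "v = u i" "w = u j" using vert vw by blast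
  then show ?thesis
    using that[of i j] vw cycle_complex_length(1)[OF n3 u] by auto
qed

section \<open>Covering complexes built by levels\<close>

text \<open>\<open>T a b c\<close> stands for \<open>{a, b, c} \<in> X\<close>, where the vertices may coincide; so \<open>T a a b\<close> is an edge or a
  vertex. With degenerate triangles allowed, the conditions on links need no distinctness hypotheses.\<close>

locale locally_large =
  fixes T :: "'a \<Rightarrow> 'a \<Rightarrow> 'a \<Rightarrow> bool"
  assumes swap12: "T a b c \<Longrightarrow> T b a c"
    and swap23: "T a b c \<Longrightarrow> T a c b"
    and face: "T a b c \<Longrightarrow> T a a b"
    and double: "T a a b \<Longrightarrow> T a b b"
    and flag: "T v a b \<Longrightarrow> T v b c \<Longrightarrow> T v a c \<Longrightarrow> T a b c"
    and square: "T v a b \<Longrightarrow> T v b c \<Longrightarrow> T v c d \<Longrightarrow> T v d a \<Longrightarrow> T v a c \<or> T v b d"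
    and pentagon: "T v a b \<Longrightarrow> T v b c \<Longrightarrow> T v c d \<Longrightarrow> T v d e \<Longrightarrow> T v e a \<Longrightarrow>
      T v a c \<or> T v b d \<or> T v c e \<or> T v d a \<or> T v e b"
begin

definition E :: "'a \<Rightarrow> 'a \<Rightarrow> bool" where
  "E a b \<longleftrightarrow> a \<noteq> b \<and> T a a b"

lemma E_sym: "E a b \<Longrightarrow> E b a"
  unfolding E_def using swap12 swap23 double by blast

lemma E_T: "T a b c \<Longrightarrow> b \<noteq> c \<Longrightarrow> E b c"
  unfolding E_def by (meson swap12 swap23 face)+

end

locale tower = locally_large T for T :: "'a \<Rightarrow> 'a \<Rightarrow> 'a \<Rightarrow> bool" +
  fixes f :: "'b \<Rightarrow> 'a" and lev :: "'b \<Rightarrow> nat" and root :: 'b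
begin

text \<open>The clauses on \<open>f\<close> describe a covering map whose domain may still lack
  neighbours: it is locally injective, and triangles descend and lift. The last three clauses
  describe how a level sits over the previous one; they are the induction hypothesis of the
  construction and also what the contraction finally uses.\<close>

definition layered :: "'b set \<Rightarrow> ('b \<Rightarrow> 'b \<Rightarrow> bool) \<Rightarrow> bool" where
  "layered V R \<longleftrightarrow>
     root \<in> V \<and> (\<forall>y\<in>V. lev y = 0 \<longrightarrow> y = root) \<and>
     (\<forall>y a. R y a \<longrightarrow> y \<in> V \<and> a \<in> V \<and> R a y \<and> E (f y) (f a) \<and> lev a \<le> Suc (lev y)) \<and>
     (\<forall>y a b. R y a \<and> R y b \<and> f a = f b \<longrightarrow> a = b) \<and>
     (\<forall>a b c. R a b \<and> R b c \<and> R a c \<longrightarrow> T (f a) (f b) (f c)) \<and>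
     (\<forall>a b c. R a b \<and> R a c \<and> b \<noteq> c \<and> T (f a) (f b) (f c) \<longrightarrow> R b c) \<and>
     (\<forall>y\<in>V. \<forall>k. lev y = Suc k \<longrightarrow> (\<exists>x. R y x \<and> lev x = k)) \<and>
     (\<forall>y a b k. lev y = Suc k \<and> R y a \<and> R y b \<and> lev a = k \<and> lev b = k \<and> a \<noteq> b \<longrightarrow> R a b) \<and>
     (\<forall>y a k. lev y = Suc k \<and> R y a \<and> lev a = Suc k \<longrightarrow> (\<exists>x. R y x \<and> R a x \<and> lev x = k))"

definition stage :: "nat \<Rightarrow> 'b set \<Rightarrow> ('b \<Rightarrow> 'b \<Rightarrow> bool) \<Rightarrow> bool" where
  "stage n V R \<longleftrightarrow> layered V R \<and> (\<forall>y\<in>V. lev y \<le> n) \<and>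
     (\<forall>y\<in>V. \<forall>z. lev y < n \<and> E (f y) z \<longrightarrow> (\<exists>a. R y a \<and> f a = z))"

definition covering :: "'b set \<Rightarrow> ('b \<Rightarrow> 'b \<Rightarrow> bool) \<Rightarrow> bool" where
  "covering V R \<longleftrightarrow> layered V R \<and> (\<forall>y\<in>V. \<forall>z. E (f y) z \<longrightarrow> (\<exists>a. R y a \<and> f a = z))"

lemma layeredD:
  assumes "layered V R"
  shows "root \<in> V"
    and "y \<in> V \<Longrightarrow> lev y = 0 \<Longrightarrow> y = root"
    and "R y a \<Longrightarrow> y \<in> V"
    and "R y a \<Longrightarrow> a \<in> V"
    and "R y a \<Longrightarrow> R a y"
    and "R y a \<Longrightarrow> E (f y) (f a)"
    and "R y a \<Longrightarrow> lev a \<le> Suc (lev y)"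
    and "R y a \<Longrightarrow> R y b \<Longrightarrow> f a = f b \<Longrightarrow> a = b"
    and "R a b \<Longrightarrow> R b c \<Longrightarrow> R a c \<Longrightarrow> T (f a) (f b) (f c)"
    and "R a b \<Longrightarrow> R a c \<Longrightarrow> b \<noteq> c \<Longrightarrow> T (f a) (f b) (f c) \<Longrightarrow> R b c"
    and "y \<in> V \<Longrightarrow> lev y = Suc k \<Longrightarrow> \<exists>x. R y x \<and> lev x = k"
    and "lev y = Suc k \<Longrightarrow> R y a \<Longrightarrow> R y b \<Longrightarrow> lev a = k \<Longrightarrow> lev b = k \<Longrightarrow> a \<noteq> b \<Longrightarrow> R a b"
    and "lev y = Suc k \<Longrightarrow> R y a \<Longrightarrow> lev a = Suc k \<Longrightarrow> \<exists>x. R y x \<and> R a x \<and> lev x = k"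
proof -
  note h = assms[unfolded layered_def]
  note c1 = h[THEN conjunct1]
  note c2 = h[THEN conjunct2, THEN conjunct1]
  note c3 = h[THEN conjunct2, THEN conjunct2, THEN conjunct1]
  note c4 = h[THEN conjunct2, THEN conjunct2, THEN conjunct2, THEN conjunct1]
  note c5 = h[THEN conjunct2, THEN conjunct2, THEN conjunct2, THEN conjunct2, THEN conjunct1]
  note c6 = h[THEN conjunct2, THEN conjunct2, THEN conjunct2, THEN conjunct2, THEN conjunct2, THEN conjunct1]
  note c7 = h[THEN conjunct2, THEN conjunct2, THEN conjunct2, THEN conjunct2, THEN conjunct2, THEN conjunct2, THEN conjunct1]
  note c8 = h[THEN conjunct2, THEN conjunct2, THEN conjunct2, THEN conjunct2, THEN conjunct2, THEN conjunct2, THEN conjunct2, THEN conjunct1]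
  note c9 = h[THEN conjunct2, THEN conjunct2, THEN conjunct2, THEN conjunct2, THEN conjunct2, THEN conjunct2, THEN conjunct2, THEN conjunct2]
  show "root \<in> V" using c1 by blast
  show "y \<in> V \<Longrightarrow> lev y = 0 \<Longrightarrow> y = root" using c2 by blast
  show "R y a \<Longrightarrow> y \<in> V" using c3 by blast
  show "R y a \<Longrightarrow> a \<in> V" using c3 by blast
  show "R y a \<Longrightarrow> R a y" using c3 by blast
  show "R y a \<Longrightarrow> E (f y) (f a)" using c3 by blast
  show "R y a \<Longrightarrow> lev a \<le> Suc (lev y)" using c3 by blast
  show "R y a \<Longrightarrow> R y b \<Longrightarrow> f a = f b \<Longrightarrow> a = b" using c4 by blast
  show "R a b \<Longrightarrow> R b c \<Longrightarrow> R a c \<Longrightarrow> T (f a) (f b) (f c)" using c5 by blast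
  show "R a b \<Longrightarrow> R a c \<Longrightarrow> b \<noteq> c \<Longrightarrow> T (f a) (f b) (f c) \<Longrightarrow> R b c" using c6 by blast
  show "y \<in> V \<Longrightarrow> lev y = Suc k \<Longrightarrow> \<exists>x. R y x \<and> lev x = k" using c7 by blast
  show "lev y = Suc k \<Longrightarrow> R y a \<Longrightarrow> R y b \<Longrightarrow> lev a = k \<Longrightarrow> lev b = k \<Longrightarrow> a \<noteq> b \<Longrightarrow> R a b" using c8 by blast
  show "lev y = Suc k \<Longrightarrow> R y a \<Longrightarrow> lev a = Suc k \<Longrightarrow> \<exists>x. R y x \<and> R a x \<and> lev x = k" using c9 by blast
qed

section \<open>From the ball of radius \<open>n\<close> to the ball of radius
  \<open>n + 1\<close>\<close>

context
  fixes n :: nat and V :: "'b set" and R :: "'b \<Rightarrow> 'b \<Rightarrow> bool"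
begin

definition missing :: "'b \<Rightarrow> 'a \<Rightarrow> bool" where
  "missing w z \<longleftrightarrow> w \<in> V \<and> lev w = n \<and> E (f w) z \<and> (\<forall>y. R w y \<longrightarrow> f y \<noteq> z)"

definition same :: "'a \<Rightarrow> 'b \<Rightarrow> 'b \<Rightarrow> bool" where
  "same z w w' \<longleftrightarrow> w = w' \<or> R w w' \<and> T (f w) (f w') z"

context
  assumes stage: "stage n V R"
begin

lemma stage_layered: "layered V R"
  using stage unfolding stage_def by blast

lemmas sroot = layeredD(1)[OF stage_layered] and slev0 = layeredD(2)[OF stage_layered]
  and sin1 = layeredD(3)[OF stage_layered] and sin2 = layeredD(4)[OF stage_layered]
  and ssym = layeredD(5)[OF stage_layered] and sE = layeredD(6)[OF stage_layered] and slev_le = layeredD(7)[OF stage_layered]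
  and sinj = layeredD(8)[OF stage_layered] and sT = layeredD(9)[OF stage_layered] and slift = layeredD(10)[OF stage_layered]
  and sdown = layeredD(11)[OF stage_layered] and sclique = layeredD(12)[OF stage_layered] and sedge = layeredD(13)[OF stage_layered]

lemma slev: "y \<in> V \<Longrightarrow> lev y \<le> n"
  and ssurj: "y \<in> V \<Longrightarrow> lev y < n \<Longrightarrow> E (f y) z \<Longrightarrow> \<exists>a. R y a \<and> f a = z"
  using stage unfolding stage_def by blast+

text \<open>A neighbour of \<open>w'\<close> over \<open>z\<close> would also be a neighbour of
  \<open>w\<close>, since the triangle lifts. Moreover \<open>w'\<close> must be on the top level,
  because below it every neighbour already has a lift.\<close>

lemma missing_propagates:
  assumes "missing w z" "R w w'" "T (f w) (f w') z"
  shows "missing w' z"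
proof -
  have no: "\<not> (R w' y \<and> f y = z)" for y
  proof
    assume y: "R w' y \<and> f y = z"
    have "w \<noteq> y" using assms(1) y unfolding missing_def E_def by blast
    then have "R w y"
      using slift[of w' w y] ssym[OF assms(2)] y swap12[OF assms(3)] by blast
    then show False using assms(1) y unfolding missing_def by blast
  qed
  have "f w' \<noteq> z" using assms unfolding missing_def by blast
  then have e: "E (f w') z" using assms(3) E_T by blast
  have "w' \<in> V" using assms sin2 by blast
  moreover have "lev w' = n"
    using ssurj[OF \<open>w' \<in> V\<close> _ e] slev[OF \<open>w' \<in> V\<close>] no by (meson le_neq_implies_less)
  ultimately show ?thesis unfolding missing_def using e no by blast
qed

lemma same_sym: "same z w w' \<Longrightarrow> same z w' w"
  unfolding same_def using ssym[of w w'] swap12[of "f w" "f w'" z] by blast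

text \<open>A common neighbour one level down rules out a diagonal at \<open>z\<close>, since there \<open>f\<close> is locally
  surjective.\<close>

lemma no_lower_diagonal:
  assumes "missing w z" "R w x" "lev x < n"
  shows "\<not> T (f w) (f x) z" "\<not> T (f w) z (f x)"
  using missing_propagates[OF assms(1,2)] assms(3) swap23[of "f w" z "f x"] unfolding missing_def by auto

text \<open>Let \<open>x\<close> and \<open>y\<close> be common lower neighbours of
  \<open>w1\<close>, \<open>w2\<close> and of \<open>w2\<close>, \<open>w3\<close>. In the link of
  \<open>f w2\<close> the points \<open>f w1\<close>, \<open>f x\<close>, \<open>f y\<close>,
  \<open>f w3\<close>, \<open>z\<close> form a closed pentagon. Its two diagonals at
  \<open>z\<close> are excluded, the one from \<open>f w1\<close> to \<open>f w3\<close> would lift,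
  and each of the remaining two yields a single lower neighbour of all three \<open>w\<close>, which
  leaves a square.\<close>

lemma same_trans:
  assumes m: "missing w2 z" and "same z w1 w2" "same z w2 w3" and l: "lev w1 = n" "lev w3 = n"
  shows "same z w1 w3"
proof (cases "w1 = w2 \<or> w2 = w3 \<or> w1 = w3")
  case True
  then show ?thesis using assms unfolding same_def by auto
next
  case False
  then have s: "R w1 w2" "T (f w1) (f w2) z" "R w2 w3" "T (f w2) (f w3) z"
    using assms(2,3) unfolding same_def by auto
  have r: "R w2 w1" "R w2 w3" and t: "T (f w2) (f w1) z" "T (f w2) z (f w3)"
    using ssym[OF s(1)] s(3) swap12[OF s(2)] swap23[OF s(4)] .
  have l2: "lev w2 = n" and v2: "w2 \<in> V" using m unfolding missing_def by auto
  have no13: "\<not> T (f w2) (f w1) (f w3)" if "\<not> R w1 w3"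
    using slift[OF r] False that by auto
  show ?thesis
  proof (cases "R w1 w3")
    case True
    have "T (f w2) (f w1) (f w3)" using sT[OF r(1) True r(2)] .
    then have "T (f w1) (f w3) z" using flag[OF _ s(4) t(1)] by blast
    then show ?thesis using True unfolding same_def by blast
  next
    case nR: False
    show ?thesis
    proof (cases n)
      \<comment> \<open>Level 0 has no lower neighbours to use, but it consists of the root
        alone.\<close>
      case 0
      then have "w1 = root" "w2 = root"
        using slev0[OF sin2[OF r(1)]] slev0[OF v2] l l2 by auto
      then show ?thesis using False by blast
    next
      case (Suc k)
      obtain x where x: "R w2 x" "R w1 x" "lev x = k"
        using sedge[OF _ r(1), of k] l(1) l2 Suc by auto
      obtain y where y: "R w2 y" "R w3 y" "lev y = k"
        using sedge[OF _ r(2), of k] l(2) l2 Suc by auto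
      have tx: "T (f w2) (f w1) (f x)" using sT[OF r(1) x(2,1)] .
      have ty: "T (f w2) (f y) (f w3)" using sT[OF y(1) ssym[OF y(2)] r(2)] .
      have noz: "\<not> T (f w2) (f x) z" "\<not> T (f w2) z (f x)" "\<not> T (f w2) (f y) z" "\<not> T (f w2) z (f y)"
        using no_lower_diagonal[OF m x(1)] no_lower_diagonal[OF m y(1)] x y Suc by auto
      have x3: "R x w3" if "T (f w2) (f x) (f w3)"
        using slift[OF x(1) r(2) _ that] x(3) l Suc by force
      have y1: "R y w1" if "T (f w2) (f y) (f w1)"
        using slift[OF y(1) r(1) _ that] y(3) l Suc by force
      \<comment> \<open>The square \<open>f w1\<close>, \<open>f c\<close>, \<open>f w3\<close>,
        \<open>z\<close> in the link of \<open>f w2\<close> has no admissible diagonal.\<close>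
      have c4: False if c: "R w2 c" "R w1 c" "R w3 c" "lev c = k" for c
      proof -
        have "T (f w2) (f w1) (f c)" "T (f w2) (f c) (f w3)"
          using sT[OF r(1) c(2,1)] sT[OF c(1) ssym[OF c(3)] r(2)] .
        from square[OF this(1,2) swap23[OF t(2)] swap23[OF t(1)]]
        have "T (f w2) (f w1) (f w3) \<or> T (f w2) (f c) z" .
        then show False using no13[OF nR] no_lower_diagonal(1)[OF m c(1)] c Suc by auto
      qed
      have "x \<noteq> y" using c4[OF x(1,2) _ x(3)] y(2) by blast
      then have xy: "R x y" using sclique[of w2 k x y] l2 Suc x(1,3) y(1,3) by blast
      have "T (f w2) (f x) (f y)" using sT[OF x(1) xy y(1)] .
      from pentagon[OF tx this ty swap23[OF t(2)] swap23[OF t(1)]]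
      have "T (f w2) (f y) (f w1) \<or> T (f w2) (f x) (f w3) \<or> T (f w2) (f w1) (f w3)"
        using noz swap23[of "f w2" "f w1" "f y"] swap23[of "f w2" "f w1" "f w3"]
          swap23[of "f w2" "f w3" "f w1"] by blast
      then show ?thesis
        using no13[OF nR] ssym[OF x3] ssym[OF y1] c4[OF x(1,2) _ x(3)] c4[OF y(1) _ y(2,3)] by blast
    qed
  qed
qed

section \<open>Attaching the classes of missing neighbours as new vertices\<close>

context
  fixes W :: "'b set" and att :: "'b \<Rightarrow> 'b \<Rightarrow> bool"
begin

text \<open>New vertices are joined only across a triangle over an old vertex, so a horizontal edge
  on the new level has a common lower neighbour by construction.\<close>

definition adj :: "'b \<Rightarrow> 'b \<Rightarrow> bool" where
  "adj c c' \<longleftrightarrow> f c \<noteq> f c' \<and> (\<exists>w. att w c \<and> att w c' \<and> T (f w) (f c) (f c'))"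

definition extend :: "'b \<Rightarrow> 'b \<Rightarrow> bool" where
  "extend a b \<longleftrightarrow> R a b \<or> att a b \<or> att b a \<or> adj a b"

context
  assumes new_lev: "c \<in> W \<Longrightarrow> lev c = Suc n"
    and att_missing: "att w c \<Longrightarrow> c \<in> W \<and> missing w (f c)"
    and att_ex: "c \<in> W \<Longrightarrow> \<exists>w. att w c"
    and missing_att: "missing w z \<Longrightarrow> \<exists>c. att w c \<and> f c = z"
    and att_same: "att w c \<Longrightarrow> missing w' (f c) \<Longrightarrow> same (f c) w w' \<Longrightarrow> att w' c"
    and same_att: "att w c \<Longrightarrow> att w' c \<Longrightarrow> same (f c) w w'"
    and att_inj: "att w c \<Longrightarrow> att w c' \<Longrightarrow> f c = f c' \<Longrightarrow> c = c'"
begin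

lemma W_V: "c \<in> W \<Longrightarrow> c \<notin> V"
  using new_lev slev by fastforce

lemma att_in: "att w c \<Longrightarrow> w \<in> V \<and> lev w = n \<and> c \<in> W \<and> E (f w) (f c)"
  using att_missing unfolding missing_def by blast

lemma adj_in: "adj c c' \<Longrightarrow> c \<in> W \<and> c' \<in> W"
  unfolding adj_def using att_missing by blast

lemma adj_sym: "adj c c' \<Longrightarrow> adj c' c"
  unfolding adj_def using swap23 by metis

lemma extend_cases:
  "a \<in> V \<Longrightarrow> b \<in> V \<Longrightarrow> extend a b \<longleftrightarrow> R a b"
  "a \<in> V \<Longrightarrow> b \<in> W \<Longrightarrow> extend a b \<longleftrightarrow> att a b"
  "a \<in> W \<Longrightarrow> b \<in> V \<Longrightarrow> extend a b \<longleftrightarrow> att b a"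
  "a \<in> W \<Longrightarrow> b \<in> W \<Longrightarrow> extend a b \<longleftrightarrow> adj a b"
  unfolding extend_def using W_V att_in adj_in sin1 sin2 by blast+

lemma extend_in: "extend a b \<Longrightarrow> (a \<in> V \<or> a \<in> W) \<and> (b \<in> V \<or> b \<in> W)"
  unfolding extend_def using att_in adj_in sin1 sin2 by blast

lemma extend_sym: "extend a b \<Longrightarrow> extend b a"
  unfolding extend_def using ssym adj_sym by blast

lemma att_propagates:
  assumes "att w c" "R w w'" "T (f w) (f w') (f c)"
  shows "att w' c"
  using att_same[OF assms(1)] missing_propagates[OF _ assms(2,3)] att_missing[OF assms(1)] assms
  unfolding same_def by blast

lemma att_att:
  assumes "att w c" "att w' c" "w \<noteq> w'"
  shows "R w w'" "T (f w) (f w') (f c)"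
  using same_att[OF assms(1,2)] assms(3) unfolding same_def by blast+

text \<open>The witness of \<open>adj\<close> may differ from \<open>w\<close>; both are then
  attached to \<open>c\<close>, hence joined, and flagness of the link of the witness gives the
  triangle over \<open>w\<close>. In such names V and W tell which vertices are old and which are
  new, starting with the vertex at which the local condition is tested.\<close>

lemma T_VWW:
  assumes "att w c" "att w c'" "adj c c'"
  shows "T (f w) (f c) (f c')"
proof -
  obtain w0 where w0: "att w0 c" "att w0 c'" "T (f w0) (f c) (f c')"
    using assms(3) unfolding adj_def by blast
  show ?thesis
  proof (cases "w = w0")
    case False
    have "T (f w0) (f w) (f c)" "T (f w0) (f w) (f c')"
      using att_att[OF w0(1) assms(1)] att_att[OF w0(2) assms(2)] False by auto
    then show ?thesis using flag[OF _ w0(3)] by blast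
  qed (use w0 in simp)
qed

lemma lift_WVW:
  assumes "att w a" "adj a c" "T (f a) (f w) (f c)"
  shows "att w c"
proof -
  obtain w0 where w0: "att w0 a" "att w0 c" "T (f w0) (f a) (f c)"
    using assms(2) unfolding adj_def by blast
  show ?thesis
  proof (cases "w = w0")
    case False
    have r: "R w0 w" "T (f w0) (f w) (f a)"
      using att_att[OF w0(1) assms(1)] False by auto
    have "T (f w0) (f w) (f c)"
      using flag[OF swap12[OF swap23[OF r(2)]] assms(3) swap12[OF w0(3)]] .
    then show ?thesis using att_propagates[OF w0(2) r(1)] by blast
  qed (use w0 in simp)
qed

text \<open>If one old vertex is attached to all three, flagness of its link suffices. Otherwise let
  \<open>x\<close>, \<open>y\<close>, \<open>z\<close> be old witnesses of the three edges. In the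
  link of \<open>f x\<close> there is a square \<open>f a\<close>, \<open>f b\<close>,
  \<open>f y\<close>, \<open>f z\<close>, and either diagonal attaches a witness to the third new
  vertex after all.\<close>

lemma T_WWW:
  assumes "adj a b" "adj b c" "adj a c"
  shows "T (f a) (f b) (f c)"
proof -
  have common: ?thesis if "att w a" "att w b" "att w c" for w
    using flag[OF T_VWW[OF that(1,2) assms(1)] T_VWW[OF that(2,3) assms(2)] T_VWW[OF that(1,3) assms(3)]] .
  obtain x where x: "att x a" "att x b"
    using assms(1) unfolding adj_def by blast
  obtain y where y: "att y b" "att y c"
    using assms(2) unfolding adj_def by blast
  obtain z where z: "att z a" "att z c"
    using assms(3) unfolding adj_def by blast
  show ?thesis
  proof (rule ccontr)
    assume no: "\<not> ?thesis"
    then have nc: "\<not> att x c" "\<not> att y a" "\<not> att z b" using common x y z by blast+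
    then have ne: "x \<noteq> y" "y \<noteq> z" "x \<noteq> z" using x y z by blast+
    have xy: "R x y" "T (f x) (f y) (f b)" using att_att[OF x(2) y(1)] ne by auto
    have yz: "R y z" "T (f y) (f z) (f c)" using att_att[OF y(2) z(2)] ne by auto
    have xz: "R x z" "T (f x) (f z) (f a)" using att_att[OF x(1) z(1)] ne by auto
    have "T (f x) (f a) (f y) \<or> T (f x) (f b) (f z)"
      using square[OF T_VWW[OF x assms(1)] swap23[OF xy(2)] sT[OF xy(1) yz(1) xz(1)] xz(2)] .
    then have "att y a \<or> att z b"
      using att_propagates[OF x(1) xy(1) swap23] att_propagates[OF x(2) xz(1) swap23] by blast
    then show False using nc by blast
  qed
qed

lemma lift_VVW:
  assumes "att a c" "R a b" "T (f a) (f b) (f c)"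
  shows "att b c"
  using att_propagates assms by blast

text \<open>The old witness of \<open>adj a c\<close> would be joined to \<open>w\<close>, so it
  would already have a neighbour over \<open>f c\<close> and could not miss one.\<close>

lemma inj_WVW:
  assumes "att w a" "adj a c" "f w = f c"
  shows False
proof -
  obtain w0 where w0: "att w0 a" "att w0 c" "T (f w0) (f a) (f c)"
    using assms(2) unfolding adj_def by blast
  have "w \<noteq> w0" using att_in[OF w0(2)] assms(3) unfolding E_def by auto
  then have "R w0 w" using att_att[OF w0(1) assms(1)] by blast
  then show False using att_missing[OF w0(2)] assms(3) unfolding missing_def by blast
qed

lemma inj_WWW:
  assumes "adj a c" "adj a c'" "f c = f c'"
  shows "c = c'"
proof -
  obtain w where w: "att w a" "att w c" "T (f w) (f a) (f c)"
    using assms(1) unfolding adj_def by blast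
  obtain w' where w': "att w' a" "att w' c'" "T (f w') (f a) (f c')"
    using assms(2) unfolding adj_def by blast
  show ?thesis
  proof (cases "w = w'")
    case True
    then show ?thesis using att_inj w w' assms(3) by blast
  next
    case False
    then have r: "R w w'" "T (f w) (f w') (f a)" using att_att[OF w(1) w'(1)] by auto
    have "T (f w) (f w') (f c)"
      using flag[OF swap12[OF swap23[OF r(2)]] swap12[OF w'(3)[folded assms(3)]] swap12[OF w(3)]] .
    then have "att w' c" using att_propagates[OF w(2) r(1)] by blast
    then show ?thesis using att_inj w' assms(3) by blast
  qed
qed

text \<open>Let \<open>w\<close> and \<open>w'\<close> be old witnesses of the two edges at
  \<open>a\<close>. In the link of \<open>f a\<close> the points \<open>f b\<close>,
  \<open>f c\<close>, \<open>f w'\<close>, \<open>f w\<close> form a square, and either diagonal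
  attaches one witness to all three new vertices; flagness then gives the edge.\<close>

lemma lift_WWW:
  assumes "adj a b" "adj a c" "b \<noteq> c" "T (f a) (f b) (f c)"
  shows "adj b c"
proof -
  have ne: "f b \<noteq> f c" using inj_WWW[OF assms(1,2)] assms(3) by blast
  have common: "adj b c" if w: "att w a" "att w b" "att w c" for w
  proof -
    have "T (f a) (f w) (f b)" "T (f a) (f w) (f c)"
      using T_VWW[OF w(1,2) assms(1)] T_VWW[OF w(1,3) assms(2)] swap12 by auto
    then have "T (f w) (f b) (f c)" using flag assms(4) by blast
    then show ?thesis using w ne unfolding adj_def by blast
  qed
  obtain w where w: "att w a" "att w b" "T (f w) (f a) (f b)"
    using assms(1) unfolding adj_def by blast
  obtain w' where w': "att w' a" "att w' c" "T (f w') (f a) (f c)"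
    using assms(2) unfolding adj_def by blast
  show ?thesis
  proof (cases "w = w'")
    case True
    then show ?thesis using common w w' by blast
  next
    case False
    then have "T (f w) (f w') (f a)" using att_att(2)[OF w(1) w'(1)] by blast
    then have "T (f a) (f b) (f w') \<or> T (f a) (f c) (f w)"
      using square[OF assms(4) swap23[OF swap12[OF w'(3)]] swap23[OF swap12[OF swap23]] swap12[OF w(3)]]
      by blast
    then have "att w' b \<or> att w c"
      using lift_WVW[OF w'(1) assms(1) swap23] lift_WVW[OF w(1) assms(2) swap23] by blast
    then show ?thesis using common w w' by blast
  qed
qed

lemma extend_lev: "extend y a \<Longrightarrow> lev a \<le> Suc (lev y)"
  unfolding extend_def using slev_le[of y a] att_in[of y a] att_in[of a y] new_lev[of y] new_lev[of a] adj_in[of y a]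
  by auto

lemma extend_E:
  assumes "extend y a"
  shows "E (f y) (f a)"
proof -
  consider "R y a" | "att y a" | "att a y" | "adj y a" using assms unfolding extend_def by blast
  then show ?thesis
  proof cases
    case 4
    then obtain w where "f y \<noteq> f a" "T (f w) (f y) (f a)" unfolding adj_def by blast
    then show ?thesis by (rule E_T[rotated])
  qed (use sE att_in E_sym in blast)+
qed

lemma extend_inj:
  assumes h: "extend y a" "extend y b" "f a = f b"
  shows "a = b"
proof -
  have VVW: False if "y \<in> V" "a \<in> V" "b \<in> W" "extend y a" "extend y b" "f a = f b" for y a b
    using that att_missing[of y b] extend_cases(1)[of y a] extend_cases(2)[of y b] unfolding missing_def by auto
  have WVW: False if "y \<in> W" "a \<in> V" "b \<in> W" "extend y a" "extend y b" "f a = f b" for y a b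
    using that inj_WVW[of a y b] extend_cases(3)[of y a] extend_cases(4)[of y b] by auto
  have y: "y \<in> V \<or> y \<in> W" and ab: "a \<in> V \<or> a \<in> W" "b \<in> V \<or> b \<in> W" using extend_in h by blast+
  consider "a \<in> V" "b \<in> V" | "a \<in> W" "b \<in> W"
    using VVW[of y a b] VVW[of y b a] WVW[of y a b] WVW[of y b a] y ab h by metis
  then show ?thesis
  proof cases
    case 1
    show ?thesis
    proof (cases "y \<in> V")
      case True
      then show ?thesis using 1 h sinj[of y a b] extend_cases(1) by blast
    next
      case False
      then have "att a y" "att b y" using y extend_cases(3) 1 h by auto
      then show ?thesis using att_att(1)[of a y b] sE[of a b] h(3) unfolding E_def by blast
    qed
  next
    case 2
    show ?thesis
    proof (cases "y \<in> V")
      case True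
      then show ?thesis using 2 h att_inj[of y a b] extend_cases(2) by blast
    next
      case False
      then show ?thesis using 2 h inj_WWW[of y a b] y extend_cases(4) by blast
    qed
  qed
qed

lemma extend_T:
  assumes h: "extend a b" "extend b c" "extend a c"
  shows "T (f a) (f b) (f c)"
proof -
  have vvw: "T (f x) (f y) (f z)" if "x \<in> V" "y \<in> V" "z \<in> W" "extend x y" "extend y z" "extend x z" for x y z
  proof -
    have "att x z" "att y z" "R x y" using that extend_cases by auto
    moreover from this have "x \<noteq> y" using sE[of x y] unfolding E_def by auto
    ultimately show ?thesis using att_att(2) by blast
  qed
  have vww: "T (f x) (f y) (f z)" if "x \<in> V" "y \<in> W" "z \<in> W" "extend x y" "extend y z" "extend x z" for x y z
    using T_VWW[of x y z] that extend_cases(2)[of x y] extend_cases(2)[of x z] extend_cases(4)[of y z] by blast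
  have s: "extend b a" "extend c b" "extend c a" using h extend_sym by auto
  have "a \<in> V \<or> a \<in> W" "b \<in> V \<or> b \<in> W" "c \<in> V \<or> c \<in> W" using extend_in h by blast+
  then consider "a \<in> V" "b \<in> V" "c \<in> V" | "a \<in> V" "b \<in> V" "c \<in> W"
    | "a \<in> V" "b \<in> W" "c \<in> V" | "a \<in> V" "b \<in> W" "c \<in> W"
    | "a \<in> W" "b \<in> V" "c \<in> V" | "a \<in> W" "b \<in> V" "c \<in> W"
    | "a \<in> W" "b \<in> W" "c \<in> V" | "a \<in> W" "b \<in> W" "c \<in> W" by blast
  then show ?thesis
  proof cases
    case 1
    then show ?thesis using h sT[of a b c] extend_cases(1) by blast
  next
    case 2
    then show ?thesis using vvw h by blast
  next
    case 3
    then show ?thesis using swap23[OF vvw[of a c b]] h s by blast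
  next
    case 4
    then show ?thesis using vww h by blast
  next
    case 5
    then show ?thesis using swap12[OF swap23[OF vvw[of b c a]]] h s by blast
  next
    case 6
    then show ?thesis using swap12[OF vww[of b a c]] h s by blast
  next
    case 7
    then show ?thesis using swap23[OF swap12[OF vww[of c a b]]] h s by blast
  next
    case 8
    then show ?thesis using h T_WWW[of a b c] extend_cases(4) by blast
  qed
qed

lemma extend_lift:
  assumes h: "extend a b" "extend a c" "b \<noteq> c" "T (f a) (f b) (f c)"
  shows "extend b c"
proof -
  have VVW: "extend b c" if "a \<in> V" "b \<in> V" "c \<in> W" "extend a b" "extend a c" "T (f a) (f b) (f c)" for a b c
    using that lift_VVW[of a c b] extend_cases(1)[of a b] extend_cases(2)[of a c] extend_cases(2)[of b c] by blast
  have WVW: "extend b c" if "a \<in> W" "b \<in> V" "c \<in> W" "extend a b" "extend a c" "T (f a) (f b) (f c)" for a b c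
    using that lift_WVW[of b a c] extend_cases(3)[of a b] extend_cases(4)[of a c] extend_cases(2)[of b c] by blast
  have mixed: "extend b c" if "b \<in> V" "c \<in> W" "extend a b" "extend a c" "T (f a) (f b) (f c)" for b c
    using VVW[of a b c] WVW[of a b c] that extend_in by blast
  have a: "a \<in> V \<or> a \<in> W" using extend_in h by blast
  consider "b \<in> V" "c \<in> V" | "b \<in> V" "c \<in> W" | "b \<in> W" "c \<in> V" | "b \<in> W" "c \<in> W"
    using extend_in h by blast
  then show ?thesis
  proof cases
    case 1
    show ?thesis
    proof (cases "a \<in> V")
      case True
      then show ?thesis using slift[of a b c] 1 h extend_cases(1) by blast
    next
      case False
      then have "att b a" "att c a" using a 1 extend_cases(3) h by auto
      then show ?thesis using att_att(1)[of b a c] h(3) 1 extend_cases(1) by blast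
    qed
  next
    case 2
    then show ?thesis using mixed h by blast
  next
    case 3
    then show ?thesis using mixed[of c b] h(1,2) swap23[OF h(4)] extend_sym[of c b] by blast
  next
    case 4
    show ?thesis
    proof (cases "a \<in> V")
      case True
      then have "att a b" "att a c" using extend_cases(2) 4 h by auto
      moreover from this have "f b \<noteq> f c" using att_inj h(3) by blast
      ultimately show ?thesis using h(4) 4 extend_cases(4) unfolding adj_def by blast
    next
      case False
      then have "adj a b" "adj a c" using a 4 extend_cases(4) h by auto
      then show ?thesis using lift_WWW[of a b c] h(3,4) 4 extend_cases(4) by blast
    qed
  qed
qed

lemma extend_surj:
  assumes h: "y \<in> V \<union> W" "lev y < Suc n" "E (f y) z"
  shows "\<exists>a. extend y a \<and> f a = z"
proof -
  have v: "y \<in> V" using h new_lev by fastforce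
  show ?thesis
  proof (cases "missing y z")
    case True
    then show ?thesis using missing_att unfolding extend_def by blast
  next
    case False
    then have "lev y < n \<or> (\<exists>a. R y a \<and> f a = z)"
      using h v unfolding missing_def by (auto simp: less_Suc_eq)
    then show ?thesis using ssurj[OF v _ h(3)] unfolding extend_def by blast
  qed
qed

lemma extend_down:
  assumes h: "y \<in> V \<union> W" "lev y = Suc k"
  shows "\<exists>x. extend y x \<and> lev x = k"
proof (cases "y \<in> V")
  case True
  then show ?thesis using sdown h unfolding extend_def by blast
next
  case False
  then have y: "y \<in> W" using h by blast
  then obtain w where w: "att w y" using att_ex by blast
  have "lev w = n" using att_in[OF w] by blast
  then show ?thesis using w new_lev[OF y] h unfolding extend_def by (intro exI[of _ w]) auto
qed

lemma extend_old: "extend y x \<Longrightarrow> lev x \<le> n \<Longrightarrow> x \<in> V"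
  using extend_in[of y x] new_lev[of x] by auto

text \<open>The lower neighbours of a new vertex are the members of one class of
  \<open>same\<close>, and distinct members of a class are joined. This is where transitivity of
  \<open>same\<close> pays off.\<close>

lemma extend_clique:
  assumes h: "lev y = Suc k" "extend y a" "extend y b" "lev a = k" "lev b = k" "a \<noteq> b"
  shows "extend a b"
proof (cases "y \<in> V")
  case True
  then have "k < n" using h slev by fastforce
  then have ab: "a \<in> V" "b \<in> V" using extend_old[of y a] extend_old[of y b] h by auto
  then have "R y a" "R y b" using True h extend_cases(1) by blast+
  then show ?thesis using sclique[of y k a b] h unfolding extend_def by blast
next
  case False
  then have y: "y \<in> W" using extend_in h by blast
  then have "k = n" using new_lev h by fastforce
  then have "a \<in> V" "b \<in> V" using extend_old[of y a] extend_old[of y b] h by auto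
  then have "att a y" "att b y" using y h extend_cases(3) by blast+
  then show ?thesis using att_att(1)[of a y b] h unfolding extend_def by blast
qed

lemma extend_edge:
  assumes h: "lev y = Suc k" "extend y a" "lev a = Suc k"
  shows "\<exists>x. extend y x \<and> extend a x \<and> lev x = k"
proof (cases "y \<in> V")
  case True
  then have "k < n" using h slev by fastforce
  then have "a \<in> V" using extend_old[of y a] h by auto
  then have "R y a" using h True extend_cases(1) by blast
  then show ?thesis using sedge[of y k a] h unfolding extend_def by blast
next
  case False
  then have y: "y \<in> W" using extend_in h by blast
  then have k: "k = n" using new_lev h by fastforce
  then have "a \<in> W" using extend_in[of y a] slev[of a] h by fastforce
  then obtain w where w: "att w y" "att w a" using h y extend_cases(4) unfolding adj_def by blast
  have "lev w = n" using att_in[OF w(1)] by blast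
  then show ?thesis using w k unfolding extend_def by blast
qed

lemma extend_stage: "stage (Suc n) (V \<union> W) extend"
proof -
  have 1: "root \<in> V \<union> W" using sroot by blast
  have 2: "\<forall>y\<in>V \<union> W. lev y \<le> Suc n" using slev new_lev by fastforce
  have 3: "\<forall>y\<in>V \<union> W. lev y = 0 \<longrightarrow> y = root" using slev0 new_lev by fastforce
  have 4: "\<forall>y a. extend y a \<longrightarrow> y \<in> V \<union> W \<and> a \<in> V \<union> W \<and> extend a y \<and> E (f y) (f a) \<and> lev a \<le> Suc (lev y)"
    using extend_in extend_sym extend_E extend_lev by blast
  have 5: "\<forall>y a b. extend y a \<and> extend y b \<and> f a = f b \<longrightarrow> a = b" using extend_inj by blast
  have 6: "\<forall>a b c. extend a b \<and> extend b c \<and> extend a c \<longrightarrow> T (f a) (f b) (f c)" using extend_T by blast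
  have 7: "\<forall>a b c. extend a b \<and> extend a c \<and> b \<noteq> c \<and> T (f a) (f b) (f c) \<longrightarrow> extend b c" using extend_lift by blast
  have 8: "\<forall>y\<in>V \<union> W. \<forall>z. lev y < Suc n \<and> E (f y) z \<longrightarrow> (\<exists>a. extend y a \<and> f a = z)"
    using extend_surj by blast
  have 9: "\<forall>y\<in>V \<union> W. \<forall>k. lev y = Suc k \<longrightarrow> (\<exists>x. extend y x \<and> lev x = k)" using extend_down by blast
  have 10: "\<forall>y a b k. lev y = Suc k \<and> extend y a \<and> extend y b \<and> lev a = k \<and> lev b = k \<and> a \<noteq> b \<longrightarrow> extend a b"
    using extend_clique by blast
  have 11: "\<forall>y a k. lev y = Suc k \<and> extend y a \<and> lev a = Suc k \<longrightarrow> (\<exists>x. extend y x \<and> extend a x \<and> lev x = k)"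
    using extend_edge by blast
  show ?thesis unfolding stage_def layered_def
    by (intro conjI) (fact 1 2 3 4 5 6 7 8 9 10 11)+
qed

end
end
end
end
end

section \<open>The universal cover as the union of all stages\<close>

locale rooted = locally_large T for T :: "'a \<Rightarrow> 'a \<Rightarrow> 'a \<Rightarrow> bool" +
  fixes v0 :: 'a
begin

text \<open>A vertex of the universal cover is encoded by a path from \<open>v0\<close>, chosen once for the vertex.\<close>

sublocale tower T last "\<lambda>l. length l - 1" "[v0]" ..

lemma stage_extends:
  assumes st: "stage n V R"
  shows "\<exists>V' R'. stage (Suc n) V' R' \<and> V \<subseteq> V' \<and> R \<le> R'"
proof -
  define mi where "mi = missing n V R"
  define sa where "sa = same R"
  \<comment> \<open>The choice depends only on the class of \<open>w\<close>, so equivalent pairs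
    receive the same path and hence the same new vertex.\<close>
  define rep where "rep = (\<lambda>z w. SOME x. mi x z \<and> sa z w x)"
  define att where "att = (\<lambda>w c. mi w (last c) \<and> c = rep (last c) w @ [last c])"
  define W where "W = {c. \<exists>w. att w c}"
  have mi: "w \<in> V" "length w = Suc n" if "mi w z" for w z
  proof -
    show "w \<in> V" using that unfolding mi_def missing_def by blast
    have "length w - 1 = n" using that unfolding mi_def missing_def by blast
    \<comment> \<open>Truncated subtraction gives the empty list level 0 as well, but the only
      vertex of level 0 is the root.\<close>
    then show "length w = Suc n"
      using layeredD(2)[OF stage_layered[OF st] \<open>w \<in> V\<close>] by (cases "length w") auto
  qed
  have sym: "sa z x y" if "sa z y x" for x y z
    using that same_sym[OF st] unfolding sa_def by blast
  have trans: "sa z x y" if "sa z x w" "sa z w y" "mi x z" "mi y z" "mi w z" for x y z w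
    using same_trans[OF st that(5)[unfolded mi_def] that(1,2)[unfolded sa_def]]
      mi(2)[OF that(3)] mi(2)[OF that(4)] unfolding sa_def by simp
  have rep: "mi (rep z w) z \<and> sa z w (rep z w)" if "mi w z" for w z
    unfolding rep_def using someI[of "\<lambda>x. mi x z \<and> sa z w x" w] that
    by (simp add: sa_def same_def)
  have rep_eq: "rep z w = rep z w'" if "mi w z" "mi w' z" "sa z w w'" for w w' z
  proof -
    have "(mi x z \<and> sa z w x) = (mi x z \<and> sa z w' x)" for x
      using trans sym that by blast
    then show ?thesis unfolding rep_def by simp
  qed
  have "stage (Suc n) (V \<union> W) (extend R att)"
  proof (rule extend_stage[OF st])
    show "length c - 1 = Suc n" if "c \<in> W" for c
    proof -
      obtain w where "mi w (last c)" "c = rep (last c) w @ [last c]"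
        using \<open>c \<in> W\<close> unfolding W_def att_def by blast
      then have "length c = Suc (Suc n)" using mi(2) rep by (metis length_append_singleton)
      then show ?thesis by simp
    qed
    show "c \<in> W \<and> missing n V R w (last c)" if "att w c" for w c
      using that unfolding W_def att_def mi_def by blast
    show "\<exists>w. att w c" if "c \<in> W" for c
      using that unfolding W_def by blast
    show "\<exists>c. att w c \<and> last c = z" if "missing n V R w z" for w z
      using that unfolding att_def mi_def by (intro exI[of _ "rep z w @ [z]"]) simp
    show "att w' c" if "att w c" "missing n V R w' (last c)" "same R (last c) w w'" for w w' c
      using that rep_eq unfolding att_def sa_def mi_def by metis
    show "same R (last c) w w'" if "att w c" "att w' c" for w w' c
    proof -
      have "rep (last c) w = rep (last c) w'"
        using that unfolding att_def by (metis butlast_snoc)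
      then show ?thesis
        using that trans[of "last c" w "rep (last c) w" w'] rep[of w "last c"] rep[of w' "last c"] sym
        unfolding att_def sa_def by simp
    qed
    show "c = c'" if "att w c" "att w c'" "last c = last c'" for w c c'
      using that unfolding att_def by metis
  qed
  then show ?thesis
    by (intro exI[of _ "V \<union> W"] exI[of _ "extend R att"]) (simp add: le_fun_def extend_def[OF st])
qed

lemma covering_exists: "\<exists>V R. covering V R"
proof -
  have "\<exists>S. \<forall>n. stage n (fst (S n)) (snd (S n)) \<and>
      (fst (S n) \<subseteq> fst (S (Suc n)) \<and> snd (S n) \<le> snd (S (Suc n)))"
  proof (rule dependent_nat_choice)
    have "stage 0 {[v0]} (\<lambda>_ _. False)"
      unfolding stage_def layered_def by simp
    then show "\<exists>x. stage 0 (fst x) (snd x)" by (intro exI[of _ "({[v0]}, \<lambda>_ _. False)"]) simp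
    show "\<exists>y. stage (Suc n) (fst y) (snd y) \<and> fst x \<subseteq> fst y \<and> snd x \<le> snd y"
      if "stage n (fst x) (snd x)" for x n
      using stage_extends[OF that] by force
  qed
  then obtain S where st: "\<And>n. stage n (fst (S n)) (snd (S n))"
    and inc: "\<And>n. fst (S n) \<subseteq> fst (S (Suc n))" "\<And>n. snd (S n) \<le> snd (S (Suc n))"
    by blast
  define V where "V = (\<lambda>n. fst (S n))"
  define R where "R = (\<lambda>n. snd (S n))"
  have st: "stage n (V n) (R n)" for n using st unfolding V_def R_def by blast
  have V: "V m \<subseteq> V n" if "m \<le> n" for m n
    using lift_Suc_mono_le[of V] inc(1) that unfolding V_def by blast
  have R: "R m a b \<Longrightarrow> R n a b" if "m \<le> n" for m n a b
    using lift_Suc_mono_le[of R m n] inc(2) that unfolding R_def by (simp add: le_fun_def)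
  have l: "layered (V n) (R n)" for n using stage_layered[OF st] .
  define VV where "VV = (\<Union>n. V n)"
  define RR where "RR = (\<lambda>a b. \<exists>n. R n a b)"
  have in2: "\<exists>n. R n a b \<and> R n c d" if "RR a b" "RR c d" for a b c d
    using that R unfolding RR_def by (meson max.cobounded1 max.cobounded2)
  have in3: "\<exists>n. R n a b \<and> R n c d \<and> R n x y" if "RR a b" "RR c d" "RR x y" for a b c d x y
    using in2[OF that(1,2)] that(3) R unfolding RR_def by (meson max.cobounded1 max.cobounded2)
  have 1: "[v0] \<in> VV" using layeredD(1)[OF l] unfolding VV_def by blast
  have 2: "\<forall>y\<in>VV. length y - 1 = 0 \<longrightarrow> y = [v0]" using layeredD(2)[OF l] unfolding VV_def by blast
  have 3: "\<forall>y a. RR y a \<longrightarrow> y \<in> VV \<and> a \<in> VV \<and> RR a y \<and> E (last y) (last a) \<and> length a - 1 \<le> Suc (length y - 1)"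
  proof (intro allI impI)
    fix y a assume "RR y a"
    then obtain n where n: "R n y a" unfolding RR_def by blast
    show "y \<in> VV \<and> a \<in> VV \<and> RR a y \<and> E (last y) (last a) \<and> length a - 1 \<le> Suc (length y - 1)"
      using layeredD(3)[OF l n] layeredD(4)[OF l n] layeredD(5)[OF l n] layeredD(6)[OF l n]
        layeredD(7)[OF l n] unfolding VV_def RR_def by blast
  qed
  have 4: "\<forall>y a b. RR y a \<and> RR y b \<and> last a = last b \<longrightarrow> a = b"
    by (metis in2 layeredD(8)[OF l])
  have 5: "\<forall>a b c. RR a b \<and> RR b c \<and> RR a c \<longrightarrow> T (last a) (last b) (last c)"
  proof (intro allI impI; elim conjE)
    fix a b c assume "RR a b" "RR b c" "RR a c"
    from in3[OF this] show "T (last a) (last b) (last c)" using layeredD(9)[OF l] by blast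
  qed
  have 6: "\<forall>a b c. RR a b \<and> RR a c \<and> b \<noteq> c \<and> T (last a) (last b) (last c) \<longrightarrow> RR b c"
  proof (intro allI impI; elim conjE)
    fix a b c assume h: "RR a b" "RR a c" "b \<noteq> c" "T (last a) (last b) (last c)"
    from in2[OF h(1,2)] obtain n where n: "R n a b" "R n a c" by blast
    from layeredD(10)[OF l n h(3,4)] show "RR b c" unfolding RR_def by blast
  qed
  have 7: "\<forall>y\<in>VV. \<forall>k. length y - 1 = Suc k \<longrightarrow> (\<exists>x. RR y x \<and> length x - 1 = k)"
  proof (intro ballI allI impI)
    fix y k assume h: "y \<in> VV" "length y - 1 = Suc k"
    then obtain n where n: "y \<in> V n" unfolding VV_def by blast
    from layeredD(11)[OF l n h(2)] show "\<exists>x. RR y x \<and> length x - 1 = k"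
      unfolding RR_def by blast
  qed
  have 8: "\<forall>y a b k. length y - 1 = Suc k \<and> RR y a \<and> RR y b \<and> length a - 1 = k \<and> length b - 1 = k \<and> a \<noteq> b \<longrightarrow> RR a b"
  proof (intro allI impI; elim conjE)
    fix y a b k assume h: "length y - 1 = Suc k" "RR y a" "RR y b" "length a - 1 = k" "length b - 1 = k" "a \<noteq> b"
    from in2[OF h(2,3)] obtain n where n: "R n y a" "R n y b" by blast
    from layeredD(12)[OF l h(1) n h(4-6)] show "RR a b" unfolding RR_def by blast
  qed
  have 9: "\<forall>y a k. length y - 1 = Suc k \<and> RR y a \<and> length a - 1 = Suc k \<longrightarrow> (\<exists>x. RR y x \<and> RR a x \<and> length x - 1 = k)"
  proof (intro allI impI; elim conjE)
    fix y a k assume h: "length y - 1 = Suc k" "RR y a" "length a - 1 = Suc k"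
    then obtain n where n: "R n y a" unfolding RR_def by blast
    from layeredD(13)[OF l h(1) n h(3)] show "\<exists>x. RR y x \<and> RR a x \<and> length x - 1 = k"
      unfolding RR_def by blast
  qed
  have 10: "\<forall>y\<in>VV. \<forall>z. E (last y) z \<longrightarrow> (\<exists>a. RR y a \<and> last a = z)"
  proof (intro ballI allI impI)
    fix y z assume h: "y \<in> VV" "E (last y) z"
    then obtain m where m: "y \<in> V m" unfolding VV_def by blast
    \<comment> \<open>A vertex has all its neighbours as soon as the stage exceeds its
      level.\<close>
    define n where "n = Suc (max m (length y))"
    have "m \<le> n" unfolding n_def by simp
    then have "y \<in> V n" using V m by blast
    moreover have "length y - 1 < n" unfolding n_def by auto
    ultimately show "\<exists>a. RR y a \<and> last a = z"
      using ssurj[OF st, of y n z] h(2) unfolding RR_def by blast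
  qed
  have "covering VV RR" unfolding covering_def layered_def
    by (intro conjI) (fact 1 2 3 4 5 6 7 8 9 10)+
  then show ?thesis by blast
qed

end

section \<open>Links in locally 6-large complexes\<close>

lemma link_edge:
  assumes X: "abstract_simplicial_complex X" and "{v, a, b} \<in> X" "v \<noteq> a" "v \<noteq> b"
  shows "{a, b} \<in> link X v" "{a} \<in> link X v" "{b} \<in> link X v"
  unfolding link_def using assms(3,4) asc_face[OF assms(1,2)] assms(2) by auto

lemma link_vertex: "v \<noteq> a \<Longrightarrow> {v, a} \<in> X \<Longrightarrow> abstract_simplicial_complex X \<Longrightarrow> a \<in> vertices (link X v)"
  using link_edge(2)[of X v a a] unfolding vertices_def by auto

lemma link_flag:
  assumes X: "abstract_simplicial_complex X" and L: "locally_k_large 6 X"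
    and S: "finite S" "S \<noteq> {}" "v \<notin> S" "\<And>a b. a \<in> S \<Longrightarrow> b \<in> S \<Longrightarrow> {v, a, b} \<in> X"
  shows "insert v S \<in> X"
proof -
  obtain a where "a \<in> S" using S(2) by blast
  then have "{v, a} \<in> X" using S(4)[of a a] by simp
  then have "v \<in> vertices X" unfolding vertices_def by blast
  then have "flag_complex (link X v)" using L unfolding locally_k_large_def k_large_def by blast
  moreover have "S \<subseteq> vertices (link X v)"
  proof
    fix a assume "a \<in> S"
    then show "a \<in> vertices (link X v)" using link_vertex[of v a X] S(3) S(4)[of a a] X by auto
  qed
  moreover have "\<forall>a\<in>S. \<forall>b\<in>S. a \<noteq> b \<longrightarrow> {a, b} \<in> link X v"
    using link_edge(1)[OF X S(4)] S(3) by blast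
  ultimately have "S \<in> link X v" using S(1,2) unfolding flag_complex_def by blast
  then show ?thesis unfolding link_def by blast
qed

lemma link_diagonal:
  assumes X: "abstract_simplicial_complex X" and L: "locally_k_large 6 X"
    and n: "n = 4 \<or> n = 5" and u: "u n = u 0" "inj_on u {..<n}"
    and e: "\<And>i. i < n \<Longrightarrow> v \<noteq> u i \<and> {v, u i, u (Suc i)} \<in> X"
  obtains i j where "i < n" "j < n" "{v, u i, u j} \<in> X" "u i \<noteq> u j"
    "\<And>l. l < n \<Longrightarrow> {u i, u j} \<noteq> {u l, u (Suc l)}"
proof -
  have vS: "v \<noteq> u (Suc i)" if "i < n" for i
  proof (cases "Suc i < n")
    case False
    then have "Suc i = n" using that by simp
    then show ?thesis using u(1) e[of 0] n by auto
  qed (use e in blast)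
  have "{v, u 0, u (Suc 0)} \<in> X" using e[of 0] n by auto
  then have "v \<in> vertices X" unfolding vertices_def by blast
  then have "k_large 6 (link X v)" using L unfolding locally_k_large_def by blast
  moreover have "{u i} \<in> link X v \<and> {u i, u (Suc i)} \<in> link X v" if "i < n" for i
    using link_edge[OF X, of v "u i" "u (Suc i)"] e[OF that] vS[OF that] by blast
  moreover have "4 \<le> n" "n < 6" using n by auto
  ultimately obtain i j where "i < n" "j < n" "{u i, u j} \<in> link X v" "u i \<noteq> u j"
    "\<And>l. l < n \<Longrightarrow> {u i, u j} \<noteq> {u l, u (Suc l)}"
    using k_large_diagonal[OF _ _ _ u, of 6 "link X v"] by blast
  then show ?thesis using that[of i j] unfolding link_def by auto
qed

lemma locally_large_complex:
  assumes X: "abstract_simplicial_complex X" and L: "locally_k_large 6 X"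
  shows "locally_large (\<lambda>a b c. {a, b, c} \<in> X)"
proof
  fix a b c assume abc: "{a, b, c} \<in> X"
  then show "{b, a, c} \<in> X" "{a, c, b} \<in> X" by (simp_all add: insert_commute)
  show "{a, a, b} \<in> X" using asc_face[OF X abc] by simp
next
  fix a b assume "{a, a, b} \<in> X"
  then show "{a, b, b} \<in> X" by simp
next
  fix v a b c assume h: "{v, a, b} \<in> X" "{v, b, c} \<in> X" "{v, a, c} \<in> X"
  show "{a, b, c} \<in> X"
  proof (cases "v \<in> {a, b, c}")
    case True
    then show ?thesis using h by (auto simp: insert_commute)
  next
    case False
    have "insert v {a, b, c} \<in> X"
    proof (rule link_flag[OF X L])
      fix x y assume "x \<in> {a, b, c}" "y \<in> {a, b, c}"
      then show "{v, x, y} \<in> X"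
        using h asc_face[OF X h(1), of "{v, a}"] asc_face[OF X h(1), of "{v, b}"] asc_face[OF X h(2), of "{v, c}"]
        by (auto simp: insert_commute)
    qed (use False in auto)
    then show ?thesis by (rule asc_face[OF X]) auto
  qed
next
  fix v a b c d
  assume h: "{v, a, b} \<in> X" "{v, b, c} \<in> X" "{v, c, d} \<in> X" "{v, d, a} \<in> X"
  define P where "P = (\<lambda>x y. {v, x, y} \<in> X)"
  have s: "P x y \<Longrightarrow> P y x" for x y unfolding P_def by (simp add: insert_commute)
  have d: "P x y \<Longrightarrow> P x x" for x y unfolding P_def using asc_face[OF X, of "{v, x, y}" "{v, x}"] by simp
  have w: "P x y \<Longrightarrow> P v x \<and> P x v" for x y
    using d[of x y] unfolding P_def by (simp add: insert_commute)
  have p: "P a b" "P b c" "P c d" "P d a" using h unfolding P_def by auto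
  show "{v, a, c} \<in> X \<or> {v, b, d} \<in> X"
  proof (rule ccontr)
    assume "\<not> ?thesis"
    then have n: "\<not> P a c" "\<not> P b d" unfolding P_def by auto
    \<comment> \<open>The closed walk may be degenerate. Two equal opposite points would themselves
      give a diagonal, two equal neighbours would turn a side into a diagonal, and \<open>v\<close>
      is joined to every point; so without diagonals all points differ. The pentagon below is
      treated in the same way.\<close>
    have dist: "distinct [v, a, b, c, d]"
      using p n s[OF p(1)] s[OF p(2)] s[OF p(3)] s[OF p(4)] d[OF p(1)] d[OF p(2)] w[OF p(3)] w[OF p(4)] w[OF p(1)] w[OF p(2)] by auto
    define u where "u = (!) [a, b, c, d, a]"
    have "u 4 = u 0" unfolding u_def by simp
    moreover have "inj_on u {..<4}"
      using dist unfolding u_def inj_on_def by (auto simp: less_Suc_eq numeral_eq_Suc)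
    moreover have "v \<noteq> u i \<and> {v, u i, u (Suc i)} \<in> X" if "i < 4" for i
      using that h dist unfolding u_def by (auto simp: less_Suc_eq numeral_eq_Suc)
    ultimately obtain i j where ij: "i < 4" "j < 4" "{v, u i, u j} \<in> X" "u i \<noteq> u j"
      "\<And>l. l < 4 \<Longrightarrow> {u i, u j} \<noteq> {u l, u (Suc l)}"
      using link_diagonal[OF X L disjI1[OF refl], of u v] by blast
    have ne: "{u i, u j} \<noteq> {a, b}" "{u i, u j} \<noteq> {b, c}" "{u i, u j} \<noteq> {c, d}" "{u i, u j} \<noteq> {d, a}"
      using ij(5)[of 0] ij(5)[of 1] ij(5)[of 2] ij(5)[of 3] unfolding u_def by simp_all
    have "u i \<in> {a, b, c, d}" "u j \<in> {a, b, c, d}"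
      using ij(1,2) unfolding u_def by (auto simp: less_Suc_eq numeral_eq_Suc)
    moreover have "P (u i) (u j)" "P (u j) (u i)" using ij(3) s unfolding P_def by auto
    ultimately have "P a c \<or> P b d"
      using ne[unfolded doubleton_eq_iff] ij(4) by (elim insertE emptyE) simp_all
    then show False using n by blast
  qed
next
  fix v a b c d e
  assume h: "{v, a, b} \<in> X" "{v, b, c} \<in> X" "{v, c, d} \<in> X" "{v, d, e} \<in> X" "{v, e, a} \<in> X"
  define P where "P = (\<lambda>x y. {v, x, y} \<in> X)"
  have s: "P x y \<Longrightarrow> P y x" for x y unfolding P_def by (simp add: insert_commute)
  have d: "P x y \<Longrightarrow> P x x" for x y unfolding P_def using asc_face[OF X, of "{v, x, y}" "{v, x}"] by simp
  have w: "P x y \<Longrightarrow> P v x \<and> P x v" for x y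
    using d[of x y] unfolding P_def by (simp add: insert_commute)
  have p: "P a b" "P b c" "P c d" "P d e" "P e a" using h unfolding P_def by auto
  show "{v, a, c} \<in> X \<or> {v, b, d} \<in> X \<or> {v, c, e} \<in> X \<or> {v, d, a} \<in> X \<or> {v, e, b} \<in> X"
  proof (rule ccontr)
    assume "\<not> ?thesis"
    then have n: "\<not> P a c" "\<not> P b d" "\<not> P c e" "\<not> P d a" "\<not> P e b" unfolding P_def by auto
    have dist: "distinct [v, a, b, c, d, e]"
      using p n s[OF p(1)] s[OF p(2)] s[OF p(3)] s[OF p(4)] s[OF p(5)] d[OF p(1)] d[OF p(2)] d[OF p(3)]
        d[OF p(4)] d[OF p(5)] w[OF p(3)] w[OF p(4)] w[OF p(1)] w[OF p(2)] w[OF p(5)] by auto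
    define u where "u = (!) [a, b, c, d, e, a]"
    have "u 5 = u 0" unfolding u_def by simp
    moreover have "inj_on u {..<5}"
      using dist unfolding u_def inj_on_def by (auto simp: less_Suc_eq numeral_eq_Suc)
    moreover have "v \<noteq> u i \<and> {v, u i, u (Suc i)} \<in> X" if "i < 5" for i
      using that h dist unfolding u_def by (auto simp: less_Suc_eq numeral_eq_Suc)
    ultimately obtain i j where ij: "i < 5" "j < 5" "{v, u i, u j} \<in> X" "u i \<noteq> u j"
      "\<And>l. l < 5 \<Longrightarrow> {u i, u j} \<noteq> {u l, u (Suc l)}"
      using link_diagonal[OF X L disjI2[OF refl], of u v] by blast
    have ne: "{u i, u j} \<noteq> {a, b}" "{u i, u j} \<noteq> {b, c}" "{u i, u j} \<noteq> {c, d}" "{u i, u j} \<noteq> {d, e}"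
        "{u i, u j} \<noteq> {e, a}"
      using ij(5)[of 0] ij(5)[of 1] ij(5)[of 2] ij(5)[of 3] ij(5)[of 4] unfolding u_def by simp_all
    have "u i \<in> {a, b, c, d, e}" "u j \<in> {a, b, c, d, e}"
      using ij(1,2) unfolding u_def by (auto simp: less_Suc_eq numeral_eq_Suc)
    moreover have "P (u i) (u j)" "P (u j) (u i)" using ij(3) s unfolding P_def by auto
    moreover have "u i = a \<Longrightarrow> u j = c \<or> u j = d" "u i = b \<Longrightarrow> u j = d \<or> u j = e"
      "u i = c \<Longrightarrow> u j = e \<or> u j = a" "u i = d \<Longrightarrow> u j = a \<or> u j = b" "u i = e \<Longrightarrow> u j = b \<or> u j = c"
      using \<open>u j \<in> {a, b, c, d, e}\<close> ne ij(4) by auto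
    ultimately have "P a c \<or> P b d \<or> P c e \<or> P d a \<or> P e b"
      by (metis insertE emptyE)
    then show False using n by blast
  qed
qed

section \<open>Transport along homotopies\<close>

text \<open>Unique lifting of edges in a covering: \<open>t y v\<close> moves \<open>y\<close> to
  the point over \<open>v\<close> in the same sheet, which is meaningful only if \<open>f y\<close>
  and \<open>v\<close> lie in a common simplex. \<open>t_comp\<close> says that there is no
  monodromy inside a simplex.\<close>

locale transport =
  fixes X :: "'a set set" and W :: "'b set" and f :: "'b \<Rightarrow> 'a" and t :: "'b \<Rightarrow> 'a \<Rightarrow> 'b"
  assumes X: "abstract_simplicial_complex X"
    and t_over: "\<sigma> \<in> X \<Longrightarrow> y \<in> W \<Longrightarrow> f y \<in> \<sigma> \<Longrightarrow> v \<in> \<sigma> \<Longrightarrow> t y v \<in> W \<and> f (t y v) = v"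
    and t_comp: "\<sigma> \<in> X \<Longrightarrow> y \<in> W \<Longrightarrow> f y \<in> \<sigma> \<Longrightarrow> v \<in> \<sigma> \<Longrightarrow> w \<in> \<sigma> \<Longrightarrow> t (t y v) w = t y w"
    and t_refl: "y \<in> W \<Longrightarrow> t y (f y) = y"
begin

primrec along :: "'b \<Rightarrow> (nat \<Rightarrow> 'a) \<Rightarrow> nat \<Rightarrow> 'b" where
  "along y u 0 = t y (u 0)"
| "along y u (Suc i) = t (along y u i) (u (Suc i))"

lemma along_over:
  assumes "y \<in> W" "f y \<in> \<sigma>" "u 0 \<in> \<sigma>" "\<sigma> \<in> X"
    and "\<And>k. k < m \<Longrightarrow> \<exists>\<sigma>\<in>X. u k \<in> \<sigma> \<and> u (Suc k) \<in> \<sigma>" "i \<le> m"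
  shows "along y u i \<in> W \<and> f (along y u i) = u i"
  using assms(6)
proof (induction i)
  case 0
  then show ?case using t_over[OF assms(4,1,2,3)] by simp
next
  case (Suc i)
  then obtain \<tau> where "\<tau> \<in> X" "u i \<in> \<tau>" "u (Suc i) \<in> \<tau>" using assms(5)[of i] by auto
  then show ?case using Suc t_over[of \<tau> "along y u i" "u (Suc i)"] by simp
qed

text \<open>Neighbouring rows of labels share a simplex in every cell, so transport across the cells
  turns a lift of one row into a lift of the next. Closing up is inherited backwards, since
  transport across the cell at the seam can be undone.\<close>

lemma closed_row_step:
  assumes N: "0 < N"
    and r: "\<And>i. i < N \<Longrightarrow> r i \<in> W \<and> f (r i) = v i"
    and row: "\<And>i. Suc i < N \<Longrightarrow> r (Suc i) = t (r i) (v (Suc i))"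
    and box: "\<And>i. Suc i < N \<Longrightarrow> \<exists>\<sigma>\<in>X. {v i, v (Suc i), v' i, v' (Suc i)} \<subseteq> \<sigma>"
    and close: "\<sigma> \<in> X" "{v 0, v (N - 1), v' 0, v' (N - 1)} \<subseteq> \<sigma>"
    and r': "r' = (\<lambda>i. t (r i) (v' i))"
  shows "i < N \<Longrightarrow> r' i \<in> W \<and> f (r' i) = v' i"
    and "Suc i < N \<Longrightarrow> r' (Suc i) = t (r' i) (v' (Suc i))"
    and "t (r' (N - 1)) (v' 0) = r' 0 \<Longrightarrow> t (r (N - 1)) (v 0) = r 0"
proof -
  have cell: "\<exists>\<sigma>\<in>X. {v i, v' i} \<subseteq> \<sigma>" if "i < N" for i
  proof (cases "Suc i < N")
    case True
    then show ?thesis using box[OF True] by auto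
  next
    case False
    then have "i = N - 1" using that by simp
    then show ?thesis using close by (intro bexI[of _ \<sigma>]) auto
  qed
  show r1: "r' i \<in> W \<and> f (r' i) = v' i" if "i < N" for i
    using cell[OF that] r[OF that] t_over[of _ "r i" "v' i"] unfolding r' by auto
  show "r' (Suc i) = t (r' i) (v' (Suc i))" if i: "Suc i < N"
  proof -
    obtain \<sigma> where \<sigma>: "\<sigma> \<in> X" "v i \<in> \<sigma>" "v (Suc i) \<in> \<sigma>" "v' i \<in> \<sigma>" "v' (Suc i) \<in> \<sigma>"
      using box[OF i] by auto
    have ri: "r i \<in> W" "f (r i) \<in> \<sigma>" using r[of i] i \<sigma> by auto
    show ?thesis
      using t_comp[OF \<sigma>(1) ri \<sigma>(4,5)] t_comp[OF \<sigma>(1) ri \<sigma>(3,5)] row[OF i] unfolding r' by simp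
  qed
  assume c: "t (r' (N - 1)) (v' 0) = r' 0"
  have s: "v 0 \<in> \<sigma>" "v (N - 1) \<in> \<sigma>" "v' 0 \<in> \<sigma>" "v' (N - 1) \<in> \<sigma>" using close by auto
  have e: "r (N - 1) \<in> W" "f (r (N - 1)) \<in> \<sigma>" "r 0 \<in> W" "f (r 0) \<in> \<sigma>" "f (r 0) = v 0"
    using r[of "N - 1"] r[of 0] N s by auto
  have "t (r (N - 1)) (v' 0) = t (r 0) (v' 0)"
    using c t_comp[OF close(1) e(1,2) s(4,3)] unfolding r' by simp
  then have "t (t (r (N - 1)) (v' 0)) (v 0) = t (t (r 0) (v' 0)) (v 0)" by simp
  then have "t (r (N - 1)) (v 0) = t (r 0) (v 0)"
    using t_comp[OF close(1) e(1,2) s(3,1)] t_comp[OF close(1) e(3,4) s(3,1)] by simp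
  then show "t (r (N - 1)) (v 0) = r 0" using t_refl[OF e(3)] e(5) by simp
qed

text \<open>A null homotopy in combinatorial form: the last row lies in a single simplex, where
  every lift closes up, and this passes down row by row.\<close>

lemma closed_row_of_grid:
  assumes N: "0 < N" "0 < M"
    and r: "\<And>i. i < N \<Longrightarrow> r i \<in> W \<and> f (r i) = v 0 i"
    and row: "\<And>i. Suc i < N \<Longrightarrow> r (Suc i) = t (r i) (v 0 (Suc i))"
    and box: "\<And>i j. Suc i < N \<Longrightarrow> Suc j < M \<Longrightarrow> \<exists>\<sigma>\<in>X. {v j i, v j (Suc i), v (Suc j) i, v (Suc j) (Suc i)} \<subseteq> \<sigma>"
    and close: "\<And>j. Suc j < M \<Longrightarrow> \<exists>\<sigma>\<in>X. {v j 0, v j (N - 1), v (Suc j) 0, v (Suc j) (N - 1)} \<subseteq> \<sigma>"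
    and top: "\<sigma> \<in> X" "\<And>i. i < N \<Longrightarrow> v (M - 1) i \<in> \<sigma>"
  shows "t (r (N - 1)) (v 0 0) = r 0"
  using N(2) r row box close top(2)
proof (induction M arbitrary: v r)
  case 0
  then show ?case by simp
next
  case (Suc M)
  show ?case
  proof (cases "M = 0")
    case True
    have s: "v 0 i \<in> \<sigma>" if "i < N" for i using Suc.prems(6)[OF that] True by simp
    have r0: "r 0 \<in> W" "f (r 0) \<in> \<sigma>" "f (r 0) = v 0 0" using Suc.prems(2)[OF N(1)] s[OF N(1)] by auto
    have line: "r i = t (r 0) (v 0 i)" if "i < N" for i
      using that
    proof (induction i)
      case 0
      then show ?case using t_refl[OF r0(1)] r0(3) by simp
    next
      case (Suc i)
      then show ?case
        using Suc.prems Suc.IH \<open>\<And>i. Suc i < N \<Longrightarrow> r (Suc i) = t (r i) (v 0 (Suc i))\<close>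
          t_comp[OF top(1) r0(1,2) s[of i] s[of "Suc i"]] by simp
    qed
    have "r (N - 1) = t (r 0) (v 0 (N - 1))" using line[of "N - 1"] N(1) by linarith
    then have "t (r (N - 1)) (v 0 0) = t (r 0) (v 0 0)"
      using t_comp[OF top(1) r0(1,2) s[of "N - 1"] s[OF N(1)]] N(1) by simp
    then show ?thesis using t_refl[OF r0(1)] r0(3) by simp
  next
    case False
    define r' where "r' = (\<lambda>i. t (r i) (v 1 i))"
    obtain \<rho> where \<rho>: "\<rho> \<in> X" "{v 0 0, v 0 (N - 1), v 1 0, v 1 (N - 1)} \<subseteq> \<rho>"
      using Suc.prems(5)[of 0] False by auto
    have box0: "\<exists>\<sigma>\<in>X. {v 0 i, v 0 (Suc i), v 1 i, v 1 (Suc i)} \<subseteq> \<sigma>" if "Suc i < N" for i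
      using Suc.prems(4)[OF that, of 0] False by auto
    note step = closed_row_step[OF N(1) Suc.prems(2,3) box0 \<rho> r'_def]
    have "t (r' (N - 1)) (v (Suc 0) 0) = r' 0"
    proof (rule Suc.IH[of r' "\<lambda>j. v (Suc j)"])
      show "\<exists>\<sigma>\<in>X. {v (Suc j) i, v (Suc j) (Suc i), v (Suc (Suc j)) i, v (Suc (Suc j)) (Suc i)} \<subseteq> \<sigma>"
        if "Suc i < N" "Suc j < M" for i j using Suc.prems(4)[of i "Suc j"] that by simp
      show "\<exists>\<sigma>\<in>X. {v (Suc j) 0, v (Suc j) (N - 1), v (Suc (Suc j)) 0, v (Suc (Suc j)) (N - 1)} \<subseteq> \<sigma>"
        if "Suc j < M" for j using Suc.prems(5)[of "Suc j"] that by simp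
      show "v (Suc (M - 1)) i \<in> \<sigma>" if "i < N" for i using Suc.prems(6)[OF that] False by simp
    qed (use step False in auto)
    then show ?thesis using step(3) by simp
  qed
qed

text \<open>The closed edge path, as a polygon, is homotopic to a constant loop. A fine grid on the
  square of the homotopy is labelled by vertices, and the lift of the bottom row of labels is
  compared with the lift of \<open>u\<close>.\<close>

theorem simply_connected_transport:
  assumes sc: "simply_connected_space (realization X)"
    and y: "y \<in> W" and u: "u 0 = f y" "u m = f y" "0 < m"
    and e: "\<And>k. k < m \<Longrightarrow> {u k, u (Suc k)} \<in> X"
  shows "along y u m = y"
proof -
  let ?I = "{0..1::real}"
  let ?S = "?I \<times> ?I"
  define p where "p = (\<lambda>x. polygon u m (real m * x))"
  have simplex: "\<exists>k<m. p x \<in> closed_simplex {u k, u (Suc k)}" if "x \<in> ?I" for x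
  proof -
    have "0 \<le> real m * x" "real m * x \<le> real m" using that u(3) by (auto simp: mult_left_le)
    then obtain k where "k < m" "real k \<le> real m * x" "real m * x \<le> real k + 1"
      using segment_index[OF u(3)] by blast
    then show ?thesis using polygon_in_simplex unfolding p_def by blast
  qed
  have p: "pathin (realization X) p"
    unfolding pathin_def
  proof (rule continuous_map_into_realization[OF X, of "(\<lambda>k. {u k, u (Suc k)}) ` {..<m}"])
    show "continuous_on ?I p" unfolding p_def
      by (rule continuous_on_compose2[OF continuous_polygon[of UNIV u m]]) (auto intro!: continuous_intros)
    show "p ` ?I \<subseteq> (\<Union>\<sigma>\<in>(\<lambda>k. {u k, u (Suc k)}) ` {..<m}. closed_simplex \<sigma>)"
      using simplex by fastforce
  qed (use e in auto)
  have p01: "p 1 = p 0"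
    using polygon_vertex[of 0 m u] polygon_vertex[of m m u] u(1,2) unfolding p_def by simp
  have p0: "p 0 \<in> realization_set X"
    using continuous_map_image_subset_topspace[OF p[unfolded pathin_def]]
    by (auto simp: topspace_realization)
  have "pathin (realization X) (\<lambda>_. p 0)"
    unfolding pathin_def using p0 by (simp add: topspace_realization)
  then obtain h where h: "continuous_map (prod_topology (top_of_set ?I) (top_of_set ?I)) (realization X) h"
    and h0: "\<And>x. h (0, x) = p x" and h1: "\<And>x. h (1, x) = p 0"
    and hl: "\<And>s. s \<in> ?I \<Longrightarrow> h (s, 1) = h (s, 0)"
    using sc p p01 unfolding simply_connected_space_def homotopic_with_def by metis
  have hX: "h z \<in> realization_set X" if "z \<in> ?S" for z
    using continuous_map_image_subset_topspace[OF h] that by (auto simp: topspace_realization)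
  \<comment> \<open>Open sets whose part in the square is mapped into a single open star.\<close>
  define \<C> where "\<C> = {U. open U \<and> (\<exists>v. \<forall>z\<in>U \<inter> ?S. 0 < h z v)}"
  have cover: "\<exists>U\<in>\<C>. z \<in> U" if z: "z \<in> ?S" for z
  proof -
    have "{v. 0 < h z v} \<in> X" using hX[OF z] realization_set_iff[OF X] by blast
    then obtain v where v: "0 < h z v" using asc_nonempty[OF X] by blast
    have "openin (top_of_set ?S) {z \<in> ?S. h z \<in> {x \<in> realization_set X. 0 < x v}}"
      using openin_continuous_map_preimage[OF h open_star[of X v]] by simp
    then obtain U where "open U" "{z \<in> ?S. h z \<in> {x \<in> realization_set X. 0 < x v}} = ?S \<inter> U"
      unfolding openin_open by blast
    then show ?thesis unfolding \<C>_def using z v hX[OF z] by blast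
  qed
  have "compact ?S" by (intro compact_Times) auto
  moreover have "?S \<subseteq> \<Union>\<C>" using cover by blast
  moreover have "\<C> \<noteq> {}" using cover[of "(0, 0)"] by force
  moreover have "\<And>U. U \<in> \<C> \<Longrightarrow> open U" unfolding \<C>_def by blast
  ultimately obtain \<delta> where \<delta>: "0 < \<delta>" "\<And>Q. Q \<subseteq> ?S \<Longrightarrow> diameter Q < \<delta> \<Longrightarrow> \<exists>U\<in>\<C>. Q \<subseteq> U"
    using Lebesgue_number_lemma[of ?S \<C>] by metis
  obtain s where s: "2 / \<delta> < real s" using reals_Archimedean2 by blast
  have s0: "0 < s" using s \<delta>(1) by (metis divide_pos_pos less_trans of_nat_0_less_iff zero_less_numeral)
  \<comment> \<open>A multiple of \<open>m\<close> puts the vertices of the polygon on grid points.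
    A cell has diameter at most \<open>2 / N\<close>, so \<open>s > 2 / \<delta>\<close> makes the
    grid fine enough.\<close>
  define N where "N = m * s"
  have N: "0 < N" "real N = real m * real s" unfolding N_def using s0 u(3) by auto
  define I where "I = (\<lambda>i. {real i / real N .. real (Suc i) / real N})"
  have I: "I i \<subseteq> ?I" if "i < N" for i
  proof -
    have "real (Suc i) \<le> real N" using that by linarith
    then have "real (Suc i) / real N \<le> 1" using N(1) by (simp add: divide_simps)
    then show ?thesis unfolding I_def by auto
  qed
  have Il: "real i / real N \<in> I i" "real (Suc i) / real N \<in> I i" for i
    unfolding I_def by (auto simp: divide_right_mono)
  have "\<exists>v. \<forall>z\<in>I j \<times> I i. 0 < h z v" if ij: "i < N" "j < N" for i j
  proof -
    have sub: "I j \<times> I i \<subseteq> ?S" using I ij by blast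
    have w: "\<bar>a - b\<bar> \<le> 1 / real N" if "a \<in> I i" "b \<in> I i" for a b i
      using that unfolding I_def by (auto simp: add_divide_distrib abs_le_iff)
    have "norm (a - b) \<le> 2 / real N" if "a \<in> I j \<times> I i" "b \<in> I j \<times> I i" for a b
    proof -
      have "norm (a - b) \<le> norm (fst (a - b)) + norm (snd (a - b))"
        using norm_Pair_le[of "fst (a - b)" "snd (a - b)"] by (simp only: prod.collapse)
      also have "\<dots> \<le> 1 / real N + 1 / real N"
        using that w[of "fst a" j "fst b"] w[of "snd a" i "snd b"] by (intro add_mono) auto
      finally show ?thesis by simp
    qed
    then have "diameter (I j \<times> I i) \<le> 2 / real N" by (intro diameter_le) auto
    also have "\<dots> < \<delta>"
    proof -
      have "1 * real s \<le> real N" unfolding N(2) using u(3) by (intro mult_right_mono) auto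
      then have "2 < \<delta> * real N" using s \<delta>(1)
        by (metis divide_less_eq less_le_trans mult.commute mult_1 order_less_imp_le mult_right_mono)
      then show ?thesis using N(1) by (simp add: divide_simps mult.commute)
    qed
    finally obtain U where "U \<in> \<C>" "I j \<times> I i \<subseteq> U" using \<delta>(2)[OF sub] by blast
    then show ?thesis unfolding \<C>_def using sub by blast
  qed
  then have "\<forall>j i. \<exists>v. i < N \<and> j < N \<longrightarrow> (\<forall>z\<in>I j \<times> I i. 0 < h z v)" by blast
  \<comment> \<open>Each cell is labelled by a vertex whose open star contains its image. The labels
    of all cells that share a grid point \<open>z\<close> lie in the support of \<open>h z\<close>,
    hence in one simplex.\<close>
  then obtain v where v: "\<And>j i z. i < N \<Longrightarrow> j < N \<Longrightarrow> z \<in> I j \<times> I i \<Longrightarrow> 0 < h z (v j i)"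
    by metis
  have supp: "{v. 0 < h z v} \<in> X" if "z \<in> ?S" for z
    using hX[OF that] realization_set_iff[OF X] by blast
  let ?g = "\<lambda>i. real i / real N"
  have g: "?g i \<in> ?I" if "i \<le> N" for i using that N(1) by (simp add: divide_simps)
  define r where "r = along y (v 0)"
  define Y where "Y = along y u"
  have pv: "0 < p x (v 0 i)" if "x \<in> I i" "i < N" for x i
    using v[of i 0 "(0, x)"] that N(1) Il(1)[of 0] h0 by simp
  have pg: "p (?g i) = polygon u m (real i / real s)" for i
    unfolding p_def N(2) using u(3) by simp
  have vA: "v 0 i \<in> {u (i div s), u (Suc (i div s))}" if i: "i < N" for i
  proof -
    have "i div s < m" using i s0 unfolding N_def by (simp add: less_mult_imp_div_less)
    moreover have "real (i div s) \<le> real i / real s" "real i / real s \<le> real (i div s) + 1"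
    proof -
      have "i = i div s * s + i mod s" "i mod s < s" using s0 by auto
      then have "real i = real (i div s) * real s + real (i mod s)" "real (i mod s) < real s"
        by (metis of_nat_add of_nat_mult) (use \<open>i mod s < s\<close> in simp)
      then show "real (i div s) \<le> real i / real s" "real i / real s \<le> real (i div s) + 1"
        using s0 by (simp_all add: field_simps)
    qed
    ultimately have "p (?g i) \<in> closed_simplex {u (i div s), u (Suc (i div s))}"
      unfolding pg by (rule polygon_in_simplex)
    then show ?thesis using pv[OF Il(1) i] closed_simplex_support by blast
  qed
  \<comment> \<open>A bottom cell that touches a vertex of the polygon must carry that vertex as
    label, because a vertex lies in no other open star.\<close>
  have vB: "v 0 i = u k" if "i < N" "k \<le> m" "i = k * s \<or> Suc i = k * s" for i k
  proof -
    have "0 < p (?g (k * s)) (v 0 i)" using pv[OF Il(1) that(1)] pv[OF Il(2) that(1)] that(3) by metis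
    then have "0 < polygon u m (real k) (v 0 i)" unfolding pg using s0 by simp
    then show ?thesis unfolding polygon_vertex[OF that(2)] by (auto split: if_splits)
  qed
  have fy: "{f y} \<in> X" using e[of 0] u(1,3) asc_face[OF X, of "{u 0, u (Suc 0)}" "{f y}"] by auto
  have Y: "Y k \<in> W" "f (Y k) = u k" if "k \<le> m" for k
    using along_over[of y "{f y}" u m k] y fy u(1) e that unfolding Y_def by blast+
  have Y0: "Y 0 = y" unfolding Y_def using t_refl[OF y] u(1) by simp
  \<comment> \<open>Within one edge the labels alternate between its two endpoints, and transport
    inside the edge forgets the intermediate labels. At the end of the edge the label is forced, so
    there the two lifts meet.\<close>
  have rY: "r i = t (Y (i div s)) (v 0 i)" if "i < N" for i
    using that
  proof (induction i)
    case 0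
    then show ?case using Y0 unfolding r_def by simp
  next
    case (Suc i)
    then have i: "i < N" by simp
    define k where "k = i div s"
    have k: "k < m" using i s0 unfolding N_def k_def by (simp add: less_mult_imp_div_less)
    have s1: "{u k, u (Suc k)} \<in> X" using e k by blast
    have Yk: "Y k \<in> W" "f (Y k) \<in> {u k, u (Suc k)}" using Y k by auto
    have vi: "v 0 i \<in> {u k, u (Suc k)}" using vA[OF i] unfolding k_def .
    have rS: "r (Suc i) = t (t (Y k) (v 0 i)) (v 0 (Suc i))"
      using Suc.IH[OF i] unfolding r_def k_def by simp
    show ?case
    proof (cases "Suc i div s = k")
      case True
      then have "v 0 (Suc i) \<in> {u k, u (Suc k)}" using vA[OF Suc.prems] by simp
      then show ?thesis using rS t_comp[OF s1 Yk vi] True by simp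
    next
      case False
      then have "Suc i mod s = 0" and S1: "Suc i div s = Suc k"
        using div_Suc[of i s] unfolding k_def by (auto split: if_splits)
      then have "Suc i = Suc k * s" using div_mult_mod_eq[of "Suc i" s] by simp
      note S = S1 this
      have v2: "v 0 i = u (Suc k)" "v 0 (Suc i) = u (Suc k)"
        using vB[OF i, of "Suc k"] vB[OF Suc.prems, of "Suc k"] k S by auto
      have "r (Suc i) = t (Y k) (u (Suc k))"
        using rS t_comp[OF s1 Yk, of "u (Suc k)" "u (Suc k)"] v2 by simp
      also have "\<dots> = Y (Suc k)" unfolding Y_def by simp
      also have "\<dots> = t (Y (Suc k)) (v 0 (Suc i))" using t_refl[of "Y (Suc k)"] Y[of "Suc k"] k v2 by simp
      finally show ?thesis using S by simp
    qed
  qed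
  have r0: "r i \<in> W \<and> f (r i) = v 0 i" if "i < N" for i
  proof -
    have k: "i div s < m" using that s0 unfolding N_def by (simp add: less_mult_imp_div_less)
    then show ?thesis
      using t_over[OF e[OF k], of "Y (i div s)" "v 0 i"] Y[of "i div s"] vA[OF that] rY[OF that] by simp
  qed
  have last: "v 0 (N - 1) = u m" "v 0 0 = u 0"
    using vB[of "N - 1" m] vB[of 0 0] N(1) unfolding N_def by auto
  have rN: "r (N - 1) = Y m"
  proof -
    obtain l where l: "m = Suc l" using u(3) by (cases m) auto
    have "(N - 1) div s = l"
    proof (rule div_nat_eqI)
      show "s * l \<le> N - 1" "N - 1 < s * Suc l" unfolding N_def l using s0 by (auto simp: algebra_simps)
    qed
    then show ?thesis using rY[of "N - 1"] N(1) last(1) l unfolding Y_def by simp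
  qed
  have "t (r (N - 1)) (v 0 0) = r 0"
  proof (rule closed_row_of_grid[where M = N and v = v and N = N and r = r])
    show "\<exists>\<sigma>\<in>X. {v j i, v j (Suc i), v (Suc j) i, v (Suc j) (Suc i)} \<subseteq> \<sigma>"
      if "Suc i < N" "Suc j < N" for i j
    proof
      let ?z = "(?g (Suc j), ?g (Suc i))"
      show "{v. 0 < h ?z v} \<in> X" using supp g that by simp
      show "{v j i, v j (Suc i), v (Suc j) i, v (Suc j) (Suc i)} \<subseteq> {v. 0 < h ?z v}"
        using v[of i j ?z] v[of "Suc i" j ?z] v[of i "Suc j" ?z] v[of "Suc i" "Suc j" ?z] Il that
        by (simp del: of_nat_Suc)
    qed
    show "\<exists>\<sigma>\<in>X. {v j 0, v j (N - 1), v (Suc j) 0, v (Suc j) (N - 1)} \<subseteq> \<sigma>" if "Suc j < N" for j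
    proof
      \<comment> \<open>The homotopy runs through loops, so the left and right sides of the square
        have the same image and the seam is a cell like any other.\<close>
      let ?z = "(?g (Suc j), 0::real)" and ?z' = "(?g (Suc j), 1::real)"
      have z: "h ?z' = h ?z" using hl g that by simp
      have "0 \<in> I 0" "1 \<in> I (N - 1)" using Il(1)[of 0] Il(2)[of "N - 1"] N(1) by auto
      then show "{v j 0, v j (N - 1), v (Suc j) 0, v (Suc j) (N - 1)} \<subseteq> {v. 0 < h ?z v}"
        using v[of 0 j ?z] v[of 0 "Suc j" ?z] v[of "N - 1" j ?z'] v[of "N - 1" "Suc j" ?z'] Il that z
        by (simp del: of_nat_Suc)
      show "{v. 0 < h ?z v} \<in> X" using supp g that by simp
    qed
    \<comment> \<open>At the final time the homotopy is constant, so all labels of the top row lie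
      in the support of one point.\<close>
    show "{v. 0 < p 0 v} \<in> X" using p0 realization_set_iff[OF X] by blast
    show "v (N - 1) i \<in> {v. 0 < p 0 v}" if "i < N" for i
    proof -
      have "1 \<in> I (N - 1)" using Il(2)[of "N - 1"] N(1) by auto
      then show ?thesis using v[OF that, of "N - 1" "(1, ?g i)"] Il(1)[of i] N(1) h1 by simp
    qed
  qed (use N r0 in \<open>auto simp: r_def\<close>)
  moreover have "r 0 = y" unfolding r_def using last(2) u(1) t_refl[OF y] by simp
  moreover have "t (Y m) (u 0) = Y m" using t_refl[of "Y m"] Y[of m] u(1,2) by simp
  ultimately show ?thesis using rN last(2) unfolding Y_def by simp
qed

end

section \<open>The level function of a systolic complex\<close>

text \<open>What the identification with the covering leaves on \<open>X\<close>: flagness of the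
  whole complex and the behaviour of the levels. Pairs may be degenerate, with \<open>{a, a}\<close>
  standing for a vertex.\<close>

locale layered_complex =
  fixes X :: "'a set set" and d :: "'a \<Rightarrow> nat" and base :: 'a
  assumes asc: "abstract_simplicial_complex X"
    and clique_simplex: "finite S \<Longrightarrow> S \<noteq> {} \<Longrightarrow> (\<And>a b. a \<in> S \<Longrightarrow> b \<in> S \<Longrightarrow> {a, b} \<in> X) \<Longrightarrow> S \<in> X"
    and square: "{v, a, b} \<in> X \<Longrightarrow> {v, b, c} \<in> X \<Longrightarrow> {v, c, e} \<in> X \<Longrightarrow> {v, e, a} \<in> X \<Longrightarrow>
      {v, a, c} \<in> X \<or> {v, b, e} \<in> X"
    and base: "{base} \<in> X" "{v} \<in> X \<Longrightarrow> d v = 0 \<Longrightarrow> v = base"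
    and d_edge: "{a, b} \<in> X \<Longrightarrow> d b \<le> Suc (d a)"
    and d_down: "{v} \<in> X \<Longrightarrow> d v = Suc k \<Longrightarrow> \<exists>x. {v, x} \<in> X \<and> d x = k"
    and d_clique: "{v, a} \<in> X \<Longrightarrow> {v, b} \<in> X \<Longrightarrow> d v = Suc k \<Longrightarrow> d a = k \<Longrightarrow> d b = k \<Longrightarrow> {a, b} \<in> X"
    and d_common: "{v, a} \<in> X \<Longrightarrow> d v = Suc k \<Longrightarrow> d a = Suc k \<Longrightarrow> \<exists>x. {v, x} \<in> X \<and> {a, x} \<in> X \<and> d x = k"

text \<open>A simplex lies entirely inside or entirely outside a set of vertices closed under
  adjacency. The points supported in \<open>C\<close> and those supported outside would therefore
  separate the realization.\<close>

lemma connected_realization_vertices: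
  assumes X: "abstract_simplicial_complex X" and con: "connected_space (realization X)"
    and C: "v0 \<in> C" "{v0} \<in> X" "\<And>a b. a \<in> C \<Longrightarrow> {a, b} \<in> X \<Longrightarrow> b \<in> C"
  shows "vertices X \<subseteq> C"
proof (rule ccontr)
  assume "\<not> ?thesis"
  then obtain w where w: "{w} \<in> X" "w \<notin> C" using asc_vertex[OF X] by blast
  have edge: "{a, b} \<in> X" if "\<sigma> \<in> X" "a \<in> \<sigma>" "b \<in> \<sigma>" for a b \<sigma>
    using asc_face[OF X that(1), of "{a, b}"] that by simp
  have simplex: "\<sigma> \<subseteq> C \<or> \<sigma> \<inter> C = {}" if "\<sigma> \<in> X" for \<sigma>
    using C(3) edge[OF that] by blast
  define U where "U = (\<lambda>D. {x \<in> realization_set X. {v. 0 < x v} \<subseteq> D})"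
  have supp: "{v. 0 < x v} \<in> X" if "x \<in> realization_set X" for x
    using that realization_set_iff[OF X] by blast
  have op: "openin (realization X) (U D)" if D: "\<And>\<sigma>. \<sigma> \<in> X \<Longrightarrow> \<sigma> \<subseteq> D \<or> \<sigma> \<inter> D = {}" for D
    unfolding openin_realization
  proof (intro conjI ballI)
    show "U D \<subseteq> realization_set X" unfolding U_def by blast
    fix \<sigma> assume \<sigma>: "\<sigma> \<in> X"
    have "U D \<inter> closed_simplex \<sigma> = closed_simplex \<sigma>" if "\<sigma> \<subseteq> D"
      using that closed_simplex_support[of _ \<sigma>] closed_simplex_subset_realization_set[OF \<sigma>]
      unfolding U_def by blast
    moreover have "U D \<inter> closed_simplex \<sigma> = {}" if "\<sigma> \<inter> D = {}"
    proof -
      have False if x: "x \<in> U D" "x \<in> closed_simplex \<sigma>" for x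
      proof -
        have "{v. 0 < x v} \<in> X" "{v. 0 < x v} \<subseteq> D" using x(1) supp unfolding U_def by auto
        moreover have "{v. 0 < x v} \<subseteq> \<sigma>" using closed_simplex_support[OF x(2)] .
        ultimately show False using asc_nonempty[OF X] \<open>\<sigma> \<inter> D = {}\<close> by blast
      qed
      then show ?thesis by blast
    qed
    ultimately show "openin (top_of_set (closed_simplex \<sigma>)) (U D \<inter> closed_simplex \<sigma>)"
      using D[OF \<sigma>] by auto
  qed
  have o: "openin (realization X) (U C)" "openin (realization X) (U (- C))"
    by (intro op; use simplex in blast)+
  have cover: "topspace (realization X) \<subseteq> U C \<union> U (- C)"
    using simplex[OF supp] unfolding topspace_realization U_def by blast
  have disj: "U C \<inter> U (- C) = {}"
    using asc_nonempty[OF X supp] unfolding U_def by blast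
  have pt: "(\<lambda>v. if v = a then 1 else 0) \<in> U D" if "{a} \<in> X" "a \<in> D" for a D
    using that by (simp add: U_def realization_set_iff[OF X])
  show False
    using con o cover disj pt[of v0 C] pt[of w "- C"] C(1,2) w unfolding connected_space_def by blast
qed

text \<open>Two vertices of the covering with the same image are joined by a path over a closed edge
  path. Transport along it follows the path to the second vertex, but by simple connectedness it
  returns to the first. So \<open>last\<close> is injective, connectedness makes it onto, and levels
  can be read on \<open>X\<close>.\<close>

theorem systolic_layered:
  assumes X: "abstract_simplicial_complex X" and sys: "systolic X"
  shows "\<exists>d base. layered_complex X d base"
proof -
  let ?T = "\<lambda>a b c. {a, b, c} \<in> X"
  have L: "locally_k_large 6 X" and con: "connected_space (realization X)"
    and sc: "simply_connected_space (realization X)" and "X \<noteq> {}"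
    using sys unfolding k_systolic_def by auto
  then obtain v0 where v0: "{v0} \<in> X"
    using asc_nonempty[OF X] asc_face[OF X] by (metis empty_subsetI ex_in_conv insert_subset insert_not_empty)
  interpret rooted ?T v0
    using locally_large_complex[OF X L] unfolding rooted_def .
  obtain V R where cov: "covering V R" using covering_exists by blast
  then have lay: "layered V R" unfolding covering_def by blast
  note D = layeredD[OF lay]
  have E: "E a b \<longleftrightarrow> a \<noteq> b \<and> {a, b} \<in> X" for a b unfolding E_def by simp
  have lift: "\<exists>a. R y a \<and> last a = z" if "y \<in> V" "{last y, z} \<in> X" "last y \<noteq> z" for y z
    using cov that unfolding covering_def E by blast
  define t where "t = (\<lambda>y v. if last y = v then y else (THE a. R y a \<and> last a = v))"
  have tR: "t y (last a) = a" if "R y a" for y a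
  proof -
    have "last y \<noteq> last a" using D(6)[OF that] unfolding E by blast
    moreover have "(THE b. R y b \<and> last b = last a) = a"
      using that D(8) by (intro the_equality) auto
    ultimately show ?thesis unfolding t_def by simp
  qed
  have tl: "t y (last y) = y" for y unfolding t_def by simp
  have edge: "{a, b} \<in> X" if "\<sigma> \<in> X" "a \<in> \<sigma>" "b \<in> \<sigma>" for a b \<sigma>
    using asc_face[OF X that(1), of "{a, b}"] that by simp
  have nbr: "t y v = y \<and> last y = v \<or> R y (t y v) \<and> last (t y v) = v \<and> last y \<noteq> v"
    if h: "y \<in> V" "{last y, v} \<in> X" for y v
  proof (cases "last y = v")
    case True
    then show ?thesis unfolding t_def by simp
  next
    case False
    then obtain a where "R y a" "last a = v" using lift[OF h] by blast
    then show ?thesis using tR[of y a] False by auto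
  qed
  interpret tr: transport X V last t
  proof
    fix \<sigma> y v w assume y: "\<sigma> \<in> X" "y \<in> V" "last y \<in> \<sigma>" "v \<in> \<sigma>"
    then have n: "t y v = y \<and> last y = v \<or> R y (t y v) \<and> last (t y v) = v \<and> last y \<noteq> v"
      using nbr[of y v] edge by blast
    then show "t y v \<in> V \<and> last (t y v) = v" using y(2) D(4) by auto
    assume w: "w \<in> \<sigma>"
    have nw: "t y w = y \<and> last y = w \<or> R y (t y w) \<and> last (t y w) = w \<and> last y \<noteq> w"
      using nbr[of y w] edge y w by blast
    show "t (t y v) w = t y w"
    proof (cases "last y = v \<or> last y = w \<or> v = w")
      case True
      then show ?thesis using n nw tl D(5) tR by metis
    next
      case False
      then have r: "R y (t y v)" "R y (t y w)" "last (t y v) = v" "last (t y w) = w" using n nw by auto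
      moreover have "{last y, v, w} \<in> X" using asc_face[OF X y(1), of "{last y, v, w}"] y w by simp
      \<comment> \<open>Two lifts starting at \<open>y\<close> inside one simplex are joined by the
        lifting of triangles; this is the absence of monodromy.\<close>
      ultimately have "R (t y v) (t y w)" using D(10)[OF r(1,2)] False by metis
      then show ?thesis using tR r by metis
    qed
  qed (use X tl in auto)
  have reach: "R\<^sup>*\<^sup>* y [v0] \<and> R\<^sup>*\<^sup>* [v0] y" if "y \<in> V" for y
    using that
  proof (induction "length y - 1" arbitrary: y)
    case 0
    then show ?case using D(2)[of y] by simp
  next
    case (Suc k)
    then obtain x where x: "R y x" "length x - 1 = k" using D(11)[of y k] by metis
    then have "R\<^sup>*\<^sup>* x [v0]" "R\<^sup>*\<^sup>* [v0] x" using Suc.hyps(1)[of x] D(4) by auto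
    then show ?case using x(1) D(5)[OF x(1)]
      by (meson converse_rtranclp_into_rtranclp rtranclp.rtrancl_into_rtrancl)
  qed
  have inj: "y = y'" if y: "y \<in> V" "y' \<in> V" "last y = last y'" for y y'
  proof -
    have "R\<^sup>*\<^sup>* y y'" using reach y by (meson rtranclp_trans)
    then obtain m g where g: "g 0 = y" "g m = y'" "\<And>i. i < m \<Longrightarrow> R (g i) (g (Suc i))"
      unfolding rtranclp_power relpowp_fun_conv by blast
    show ?thesis
    proof (cases "m = 0")
      case False
      have al: "tr.along y (\<lambda>i. last (g i)) i = g i" if "i \<le> m" for i
        using that by (induction i) (use g tl tR in auto)
      have "tr.along y (\<lambda>i. last (g i)) m = y"
        by (rule tr.simply_connected_transport[OF sc])
          (use y g False D(6)[OF g(3)] in \<open>auto simp: E\<close>)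
      then show ?thesis using al[of m] g(2) by simp
    qed (use g in simp)
  qed
  have onto: "vertices X \<subseteq> last ` V"
  proof (rule connected_realization_vertices[OF X con])
    show "v0 \<in> last ` V" using D(1) by force
    show "{v0} \<in> X" by (rule v0)
    show "b \<in> last ` V" if h: "a \<in> last ` V" "{a, b} \<in> X" for a b
    proof -
      obtain y where "y \<in> V" "a = last y" using h(1) by blast
      then show ?thesis using tr.t_over[OF h(2), of y b] by (metis imageI insertCI)
    qed
  qed
  define g where "g = inv_into V last"
  have gV: "g v \<in> V" "last (g v) = v" if "{v} \<in> X" for v
  proof -
    have "v \<in> last ` V" using onto that asc_vertex[OF X] by blast
    then show "g v \<in> V" "last (g v) = v" unfolding g_def by (simp_all add: inv_into_into f_inv_into_f)
  qed
  have last_X: "{last y} \<in> X" if h: "y \<in> V" for y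
  proof (cases "y = [v0]")
    case False
    then have "length y - 1 \<noteq> 0" using D(2)[OF h] by blast
    then obtain k where "length y - 1 = Suc k" using not0_implies_Suc by blast
    then obtain x where "R y x" using D(11)[OF h] by blast
    then show ?thesis using D(6) asc_face[OF X, of "{last y, last x}" "{last y}"] unfolding E by blast
  qed (use v0 in simp)
  have gl: "g (last y) = y" if "y \<in> V" for y
    using inj gV[OF last_X[OF that]] that by blast
  have face1: "{a} \<in> X" "{b} \<in> X" if "{a, b} \<in> X" for a b
    using edge[OF that, of a a] edge[OF that, of b b] by auto
  have gR: "R (g a) (g b)" if h: "{a, b} \<in> X" "a \<noteq> b" for a b
  proof -
    have g: "g a \<in> V" "last (g a) = a" "g b \<in> V" using gV face1[OF h(1)] by auto
    obtain y where "R (g a) y" "last y = b" using lift[of "g a" b] g h by auto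
    then show ?thesis using gl D(4) by metis
  qed
  have Rl: "{last y, last x} \<in> X" "last y \<noteq> last x" "g (last x) = x" if "R y x" for x y
    using D(6)[OF that] gl D(4)[OF that] unfolding E by auto
  define d where "d = (\<lambda>v. length (g v) - 1)"
  have dl: "d (last y) = length y - 1" if "y \<in> V" for y unfolding d_def gl[OF that] ..
  have "layered_complex X d v0"
  proof
    show "abstract_simplicial_complex X" by (rule X)
    show "S \<in> X" if S: "finite S" "S \<noteq> {}" "\<And>a b. a \<in> S \<Longrightarrow> b \<in> S \<Longrightarrow> {a, b} \<in> X" for S
    proof -
      obtain a where a: "a \<in> S" using S(2) by blast
      show ?thesis
      proof (cases "S = {a}")
        case True
        then show ?thesis using S(3)[of a a] by simp
      next
        case False
        have "insert a (S - {a}) \<in> X"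
        proof (rule link_flag[OF X L])
          fix b c assume bc: "b \<in> S - {a}" "c \<in> S - {a}"
          show "{a, b, c} \<in> X"
          proof (cases "b = c")
            case True
            then show ?thesis using S(3) a bc by simp
          next
            case False
            \<comment> \<open>Three pairwise adjacent vertices span a triangle because their lifts
              do; flagness of the link of \<open>a\<close> then fills the whole clique.\<close>
            have "R (g a) (g b)" "R (g b) (g c)" "R (g a) (g c)" using gR S(3) a bc False by auto
            from D(9)[OF this] show ?thesis using gV(2) S(3) a bc by (metis DiffD1 insert_absorb2)
          qed
        qed (use S(1) a False in auto)
        then show ?thesis using a by (simp add: insert_absorb)
      qed
    qed
    show "{v, a, c} \<in> X \<or> {v, b, e} \<in> X"
      if "{v, a, b} \<in> X" "{v, b, c} \<in> X" "{v, c, e} \<in> X" "{v, e, a} \<in> X" for v a b c e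
      using square[OF that] .
    show "{v0} \<in> X" by (rule v0)
    show "v = v0" if "{v} \<in> X" "d v = 0" for v
      using D(2)[of "g v"] gV[OF that(1)] that(2) unfolding d_def by (metis last.simps)
    show "d b \<le> Suc (d a)" if "{a, b} \<in> X" for a b
      using D(7)[OF gR[OF that]] unfolding d_def by (cases "a = b") auto
    show "\<exists>x. {v, x} \<in> X \<and> d x = k" if v: "{v} \<in> X" "d v = Suc k" for v k
    proof -
      obtain x where x: "R (g v) x" "length x - 1 = k" using D(11)[OF gV(1)[OF v(1)]] v(2) unfolding d_def by blast
      then show ?thesis using Rl[OF x(1)] dl[OF D(4)[OF x(1)]] gV(2)[OF v(1)] by metis
    qed
    show "{a, b} \<in> X" if h: "{v, a} \<in> X" "{v, b} \<in> X" "d v = Suc k" "d a = k" "d b = k" for v a b k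
    proof (cases "a = b")
      case False
      have r: "R (g v) (g a)" "R (g v) (g b)" using gR h by fastforce+
      have g: "last (g a) = a" "last (g b) = b" using gV(2) face1 h by auto
      have "R (g a) (g b)" using D(12)[OF _ r] h False g unfolding d_def by metis
      then show ?thesis using Rl(1) g by metis
    qed (use face1 h in auto)
    show "\<exists>x. {v, x} \<in> X \<and> {a, x} \<in> X \<and> d x = k"
      if h: "{v, a} \<in> X" "d v = Suc k" "d a = Suc k" for v a k
    proof (cases "v = a")
      case True
      have v: "{v} \<in> X" using face1 h by blast
      obtain x where x: "R (g v) x" "length x - 1 = k" using D(11)[OF gV(1)[OF v]] h(2) unfolding d_def by blast
      then show ?thesis using Rl[OF x(1)] dl[OF D(4)[OF x(1)]] gV(2)[OF v] True by metis
    next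
      case False
      have g: "last (g v) = v" "last (g a) = a" using gV(2) face1 h by auto
      obtain x where x: "R (g v) x" "R (g a) x" "length x - 1 = k"
        using D(13)[OF _ gR[OF h(1) False]] h(2,3) unfolding d_def by blast
      then show ?thesis using Rl(1)[OF x(1)] Rl(1)[OF x(2)] dl[OF D(4)[OF x(1)]] g by metis
    qed
  qed
  then show ?thesis by blast
qed

section \<open>Contraction\<close>

context layered_complex
begin

lemma edge_in_simplex: "\<sigma> \<in> X \<Longrightarrow> a \<in> \<sigma> \<Longrightarrow> b \<in> \<sigma> \<Longrightarrow> {a, b} \<in> X"
  using asc_face[OF asc, of \<sigma> "{a, b}"] by simp

lemma edge_sym: "{a, b} \<in> X \<Longrightarrow> {b, a} \<in> X"
  by (simp add: insert_commute)

lemma edge_vertex: "{a, b} \<in> X \<Longrightarrow> {a} \<in> X"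
  using asc_face[OF asc, of "{a, b}" "{a}"] by simp

definition below :: "nat \<Rightarrow> 'a set \<Rightarrow> 'a set" where
  "below k A = {u. d u = k \<and> (\<forall>a\<in>A. {u, a} \<in> X)}"

text \<open>A Helly property for the cliques \<open>below k {a}\<close>. The induction step needs only that links have
  no induced squares.\<close>

lemma below_nonempty:
  assumes "A \<in> X" "\<And>a. a \<in> A \<Longrightarrow> d a = Suc k"
  shows "below k A \<noteq> {}"
  using assms
proof (induction "card A" arbitrary: A rule: less_induct)
  case less
  have fin: "finite A" and ne: "A \<noteq> {}" using asc_finite[OF asc less.prems(1)] asc_nonempty[OF asc less.prems(1)] .
  have e: "{a, b} \<in> X" if "a \<in> A" "b \<in> A" for a b using edge_in_simplex[OF less.prems(1) that] .
  obtain a1 where a1: "a1 \<in> A" using ne by blast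
  show ?case
  proof (cases "A = {a1}")
    case True
    obtain x where "{a1, x} \<in> X" "d x = k"
      using d_down[of a1 k] less.prems(2)[OF a1] e[OF a1 a1] by auto
    then show ?thesis using True edge_sym unfolding below_def by blast
  next
    case False
    then obtain a2 where a2: "a2 \<in> A" "a2 \<noteq> a1" using a1 by blast
    show ?thesis
    proof (cases "A = {a1, a2}")
      case True
      obtain x where "{a1, x} \<in> X" "{a2, x} \<in> X" "d x = k"
        using d_common[OF e[OF a1 a2(1)] less.prems(2)[OF a1] less.prems(2)[OF a2(1)]] by blast
      then have "x \<in> below k A" using True edge_sym unfolding below_def by auto
      then show ?thesis by blast
    next
      case False
      then obtain a3 where a3: "a3 \<in> A" "a3 \<noteq> a1" "a3 \<noteq> a2" using a1 a2 by blast
      have "\<exists>x. x \<in> below k (A - {b})" if "b \<in> A" "b \<noteq> a1" for b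
      proof -
        have "A - {b} \<in> X" using asc_face[OF asc less.prems(1), of "A - {b}"] a1 that by blast
        moreover have "card (A - {b}) < card A" using fin that(1) by (rule card_Diff1_less)
        ultimately have "below k (A - {b}) \<noteq> {}"
          using less.hyps less.prems(2) by blast
        then show ?thesis by blast
      qed
      \<comment> \<open>\<open>x\<close> is known to be joined to all of \<open>A\<close> except
        \<open>a2\<close>, and \<open>y\<close> to all except \<open>a3\<close>; both lie below
        \<open>a1\<close>, so they are joined to each other.\<close>
      then obtain x y where x: "x \<in> below k (A - {a2})" and y: "y \<in> below k (A - {a3})"
        using a2 a3 by metis
      have dx: "d x = k" "d y = k" using x y unfolding below_def by auto
      have ex: "{x, a1} \<in> X" "{x, a3} \<in> X" "{y, a1} \<in> X" "{y, a2} \<in> X"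
        using x y a1 a2 a3 unfolding below_def by auto
      have xy: "{x, y} \<in> X"
        using d_clique[OF edge_sym[OF ex(1)] edge_sym[OF ex(3)] less.prems(2)[OF a1] dx] .
      have tri: "{p, q, r} \<in> X" if "{p, q} \<in> X" "{q, r} \<in> X" "{p, r} \<in> X" for p q r
      proof (rule clique_simplex)
        fix a b assume "a \<in> {p, q, r}" "b \<in> {p, q, r}"
        then show "{a, b} \<in> X"
          using that edge_sym[OF that(1)] edge_sym[OF that(2)] edge_sym[OF that(3)]
            edge_vertex[OF that(1)] edge_vertex[OF that(2)] edge_vertex[OF edge_sym[OF that(2)]] by auto
      qed auto
      \<comment> \<open>The square \<open>a2\<close>, \<open>a3\<close>, \<open>x\<close>,
        \<open>y\<close> in the link of \<open>a1\<close>: its diagonals are exactly the two missing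
        edges.\<close>
      have "{a1, a2, x} \<in> X \<or> {a1, a3, y} \<in> X"
      proof (rule square)
        show "{a1, a2, a3} \<in> X" using tri[OF e e e] a1 a2(1) a3(1) by blast
        show "{a1, a3, x} \<in> X" using tri[OF e[OF a1 a3(1)] edge_sym[OF ex(2)] edge_sym[OF ex(1)]] .
        show "{a1, x, y} \<in> X" using tri[OF edge_sym[OF ex(1)] xy edge_sym[OF ex(3)]] .
        show "{a1, y, a2} \<in> X" using tri[OF edge_sym[OF ex(3)] ex(4) e[OF a1 a2(1)]] .
      qed
      then have "{x, a2} \<in> X \<or> {y, a3} \<in> X"
        using edge_in_simplex[of "{a1, a2, x}" x a2] edge_in_simplex[of "{a1, a3, y}" y a3] by auto
      then have "x \<in> below k A \<or> y \<in> below k A"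
        using x y unfolding below_def by blast
      then show ?thesis by blast
    qed
  qed
qed

section \<open>Sublevel complexes and the flow from one to the next\<close>

definition sub :: "nat \<Rightarrow> 'a set set" where
  "sub n = {\<sigma> \<in> X. \<forall>v\<in>\<sigma>. d v \<le> n}"

lemma sub_asc: "abstract_simplicial_complex (sub n)"
  using asc unfolding abstract_simplicial_complex_def sub_def by blast

lemma sub_mono: "m \<le> n \<Longrightarrow> sub m \<subseteq> sub n"
  unfolding sub_def by fastforce

lemma realization_set_mono: "K \<subseteq> L \<Longrightarrow> realization_set K \<subseteq> realization_set L"
  unfolding realization_set_def by blast

lemma sub_0: "sub 0 = {{base}}"
proof -
  have only: "\<sigma> = {base}" if "\<sigma> \<in> X" "\<forall>v\<in>\<sigma>. d v \<le> 0" for \<sigma>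
    using that base(2) edge_in_simplex[OF that(1)] asc_nonempty[OF asc that(1)] by fastforce
  \<comment> \<open>The level of \<open>base\<close> is not prescribed, but descending from it
    reaches a vertex of level 0, which can only be \<open>base\<close>.\<close>
  have "d base = 0"
  proof (rule ccontr)
    assume "d base \<noteq> 0"
    have desc: "\<exists>v. {v} \<in> X \<and> d v = n" if "n \<le> d base" for n
      using that
    proof (induction n rule: inc_induct)
      case (step n)
      then obtain v where "{v} \<in> X" "d v = Suc n" by blast
      then obtain x where "{v, x} \<in> X" "d x = n" using d_down by blast
      then show ?case using edge_vertex[OF edge_sym] by blast
    qed (use base in blast)
    obtain v where v: "{v} \<in> X" "d v = 0" using desc[of 0] by auto
    then have "v = base" by (rule base(2))
    then show False using v(2) \<open>d base \<noteq> 0\<close> by simp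
  qed
  then have "{base} \<in> sub 0" using base(1) unfolding sub_def by simp
  moreover have "\<sigma> = {base}" if "\<sigma> \<in> sub 0" for \<sigma>
    using that only unfolding sub_def by simp
  ultimately show ?thesis by blast
qed

text \<open>In \<open>sink\<close> a vertex \<open>v\<close> of level \<open>k\<close> receives the length of the set of times \<open>u < s\<close> for which the superlevel set \<open>{w. x w > u}\<close> on
  level \<open>Suc k\<close> is nonempty and lies in the star of \<open>v\<close>. Total mass is restored by normalising.\<close>

definition peak :: "('a \<Rightarrow> bool) \<Rightarrow> ('a \<Rightarrow> real) \<Rightarrow> real" where
  "peak P x = Max (insert 0 (x ` Collect P))"

definition sink :: "nat \<Rightarrow> real \<Rightarrow> ('a \<Rightarrow> real) \<Rightarrow> 'a \<Rightarrow> real" where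
  "sink k s x v =
    (if d v = Suc k then max 0 (x v - s)
     else if d v = k then
       x v + max 0 (min s (peak (\<lambda>w. d w = Suc k) x) - peak (\<lambda>w. d w = Suc k \<and> {v, w} \<notin> X) x)
     else x v)"

definition flow :: "nat \<Rightarrow> real \<times> ('a \<Rightarrow> real) \<Rightarrow> 'a \<Rightarrow> real" where
  "flow k = (\<lambda>(s, x) v. sink k s x v / sum (sink k s x) {v. 0 < sink k s x v})"

text \<open>An a priori bound for the supports of all points that the flow reaches from the closed
  simplex on \<open>\<tau>\<close>. The empty \<open>A\<close> is left out because
  \<open>below k {}\<close> is an entire level.\<close>

definition reach :: "nat \<Rightarrow> 'a set \<Rightarrow> 'a set" where
  "reach k \<tau> = \<tau> \<union> (\<Union>A\<in>{A. A \<subseteq> \<tau> \<and> A \<noteq> {} \<and> (\<forall>a\<in>A. d a = Suc k)}. below k A)"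

lemma peak_simplex:
  assumes "finite \<tau>" "x \<in> closed_simplex \<tau>"
  shows "peak P x = Max (insert 0 (x ` {w \<in> \<tau>. P w}))"
    and "finite (insert 0 (x ` Collect P))"
proof -
  have "insert 0 (x ` Collect P) = insert 0 (x ` {w \<in> \<tau>. P w})"
    using assms(2) unfolding closed_simplex_def by force
  then show "peak P x = Max (insert 0 (x ` {w \<in> \<tau>. P w}))" "finite (insert 0 (x ` Collect P))"
    unfolding peak_def using assms(1) by simp_all
qed

lemma realization_set_simplex:
  assumes "abstract_simplicial_complex K" "x \<in> realization_set K"
  shows "{v. 0 < x v} \<in> K" "x \<in> closed_simplex {v. 0 < x v}" "0 \<le> x v" "sum x {v. 0 < x v} = 1"
proof -
  have r: "\<forall>v. 0 \<le> x v" "{v. 0 < x v} \<in> K" "sum x {v. 0 < x v} = 1"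
    using assms(2) unfolding realization_set_iff[OF assms(1)] by auto
  show "{v. 0 < x v} \<in> K" "0 \<le> x v" "sum x {v. 0 < x v} = 1" using r by auto
  have "x v = 0" if "v \<notin> {v. 0 < x v}" for v using that r(1)[rule_format, of v] by simp
  then show "x \<in> closed_simplex {v. 0 < x v}" unfolding closed_simplex_def using r by blast
qed

context
  fixes k :: nat and x :: "'a \<Rightarrow> real"
  assumes x: "x \<in> realization_set (sub (Suc k))"
begin

lemmas xs = realization_set_simplex[OF sub_asc x]

lemma x_simplex: "{v. 0 < x v} \<in> X" "0 < x v \<Longrightarrow> d v \<le> Suc k"
  using xs(1) unfolding sub_def by auto

lemma peak_ge: "P w \<Longrightarrow> x w \<le> peak P x"
  and peak_nonneg: "0 \<le> peak P x"
  and peak_less: "0 < c \<Longrightarrow> (\<And>w. P w \<Longrightarrow> x w < c) \<Longrightarrow> peak P x < c"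
  and peak_attained: "peak P x = 0 \<or> (\<exists>w. P w \<and> x w = peak P x)"
proof -
  have fin: "finite (insert 0 (x ` Collect P))"
    using peak_simplex(2)[OF asc_finite[OF asc x_simplex(1)] xs(2)] .
  show "P w \<Longrightarrow> x w \<le> peak P x" "0 \<le> peak P x" "0 < c \<Longrightarrow> (\<And>w. P w \<Longrightarrow> x w < c) \<Longrightarrow> peak P x < c"
    unfolding peak_def using fin by auto
  show "peak P x = 0 \<or> (\<exists>w. P w \<and> x w = peak P x)"
    using Max_in[OF fin] unfolding peak_def[symmetric] by auto
qed

lemma sink_nonneg: "0 \<le> sink k s x v"
  unfolding sink_def using xs(3)[of v] by auto

lemma sink_0: "sink k 0 x = x"
proof
  fix v
  show "sink k 0 x v = x v"
    unfolding sink_def using xs(3)[of v] peak_nonneg[of "\<lambda>w. d w = Suc k"]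
      peak_nonneg[of "\<lambda>w. d w = Suc k \<and> {v, w} \<notin> X"] by auto
qed

lemma sink_trivial:
  assumes "0 \<le> s" "\<And>w. 0 < x w \<Longrightarrow> d w \<noteq> Suc k"
  shows "sink k s x = x"
proof
  fix v
  have z: "x w = 0" if "d w = Suc k" for w using assms(2)[of w] xs(3)[of w] that by force
  have "peak (\<lambda>w. d w = Suc k) x = 0"
    using peak_attained[of "\<lambda>w. d w = Suc k"] z by auto
  then show "sink k s x v = x v"
    unfolding sink_def using z[of v] assms(1) xs(3)[of v]
      peak_nonneg[of "\<lambda>w. d w = Suc k \<and> {v, w} \<notin> X"] by auto
qed

text \<open>The mass at time \<open>s\<close> sits on a face \<open>A\<close> of the upper level and
  on \<open>below k A\<close>. These two sets together form a clique, hence a simplex, and the Helly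
  property keeps it nonempty after the upper level has been emptied.\<close>

lemma sink_support:
  assumes s: "0 \<le> s" "s \<le> 1" and fin: "\<And>S. (\<And>a b. a \<in> S \<Longrightarrow> b \<in> S \<Longrightarrow> {a, b} \<in> X) \<Longrightarrow> finite S"
  shows "{v. 0 < sink k s x v} \<in> X"
    and "{v. 0 < sink k s x v} \<subseteq> reach k {v. 0 < x v}"
    and "0 < sink k s x v \<Longrightarrow> d v \<le> Suc k"
    and "s = 1 \<Longrightarrow> 0 < sink k s x v \<Longrightarrow> d v \<le> k"
proof -
  let ?\<sigma> = "{v. 0 < x v}" and ?y = "sink k s x"
  let ?M = "peak (\<lambda>w. d w = Suc k) x"
  have main: "{v. 0 < ?y v} \<in> X \<and> {v. 0 < ?y v} \<subseteq> reach k ?\<sigma> \<and> (\<forall>v. 0 < ?y v \<longrightarrow> d v \<le> Suc k) \<and>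
      (s = 1 \<longrightarrow> (\<forall>v. 0 < ?y v \<longrightarrow> d v \<le> k))"
  proof (cases "\<exists>w. 0 < x w \<and> d w = Suc k")
    case False
    then have "?y = x" using sink_trivial[OF s(1)] by blast
    moreover have "d v \<le> k" if "0 < x v" for v
      using x_simplex(2)[OF that] False that by (metis le_SucE)
    ultimately show ?thesis using x_simplex unfolding reach_def by auto
  next
    case True
    then obtain w where w: "0 < x w" "d w = Suc k" by blast
    then have M: "0 < ?M" using peak_ge[of "\<lambda>w. d w = Suc k" w] by simp
    have low: "k \<le> d v" if "0 < x v" for v
      using d_edge[OF edge_in_simplex[OF x_simplex(1), of v w]] that w by auto
    \<comment> \<open>\<open>A\<close> is the superlevel set at height \<open>s\<close>. Once
      \<open>s\<close> reaches the maximum that set is empty, and the last nonempty one, where the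
      maximum is attained, takes its place.\<close>
    define A where "A = (if s < ?M then {w. d w = Suc k \<and> s < x w} else {w. d w = Suc k \<and> x w = ?M})"
    have A\<sigma>: "A \<subseteq> ?\<sigma>" using s(1) M unfolding A_def by auto
    have Ad: "d a = Suc k" if "a \<in> A" for a using that unfolding A_def by (auto split: if_splits)
    have Amin: "min s ?M \<le> x a" if "a \<in> A" for a using that unfolding A_def by (auto split: if_splits)
    obtain m where m: "d m = Suc k" "x m = ?M" using peak_attained[of "\<lambda>w. d w = Suc k"] M by auto
    have mA: "m \<in> A" using m unfolding A_def by auto
    have AX: "A \<in> X" using asc_face[OF asc x_simplex(1) A\<sigma>] mA by blast
    have adj: "v \<in> below k A" if "0 < ?y v" "d v = k" for v
      unfolding below_def
    proof (intro CollectI conjI ballI that(2))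
      fix a assume a: "a \<in> A"
      have "0 < x v \<or> peak (\<lambda>w. d w = Suc k \<and> {v, w} \<notin> X) x < min s ?M"
        using that unfolding sink_def by (auto simp: max_def split: if_splits)
      then show "{v, a} \<in> X"
      proof
        assume "0 < x v"
        then show ?thesis using edge_in_simplex[OF x_simplex(1), of v a] A\<sigma> a by blast
      next
        assume less: "peak (\<lambda>w. d w = Suc k \<and> {v, w} \<notin> X) x < min s ?M"
        show ?thesis
        proof (rule ccontr)
          assume "{v, a} \<notin> X"
          then have "x a \<le> peak (\<lambda>w. d w = Suc k \<and> {v, w} \<notin> X) x"
            using Ad[OF a] by (intro peak_ge) auto
          then show False using less Amin[OF a] by linarith
        qed
      qed
    qed
    have pos: "v \<in> A \<and> s < ?M \<or> v \<in> below k A" if v: "0 < ?y v" for v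
    proof -
      consider "d v = Suc k" | "d v = k" | "d v \<noteq> Suc k" "d v \<noteq> k" by blast
      then show ?thesis
      proof cases
        case 1
        then have "s < x v" using v unfolding sink_def by (auto simp: max_def split: if_splits)
        moreover have "x v \<le> ?M" using 1 by (intro peak_ge)
        ultimately show ?thesis using 1 unfolding A_def by auto
      next
        case 2
        then show ?thesis using adj v by blast
      next
        case 3
        then have "0 < x v" using v unfolding sink_def by auto
        then show ?thesis using low x_simplex(2) 3 by (metis le_SucE le_antisym)
      qed
    qed
    have clique: "{a, b} \<in> X" if "a \<in> {v. 0 < ?y v}" "b \<in> {v. 0 < ?y v}" for a b
    proof -
      have ab: "a \<in> A \<or> a \<in> below k A" "b \<in> A \<or> b \<in> below k A" using pos that by auto
      have "{u, v} \<in> X" if "u \<in> below k A" "v \<in> below k A" for u v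
        using d_clique[of m u v k] that mA m(1) edge_sym unfolding below_def by blast
      moreover have "{u, v} \<in> X" if "u \<in> A" "v \<in> A" for u v
        using edge_in_simplex[OF AX that] .
      moreover have "{u, v} \<in> X" "{v, u} \<in> X" if "u \<in> below k A" "v \<in> A" for u v
        using that edge_sym unfolding below_def by auto
      ultimately show ?thesis using ab by blast
    qed
    have ne: "{v. 0 < ?y v} \<noteq> {}"
    proof (cases "s < ?M")
      case True
      then have "0 < ?y m" using m unfolding sink_def by simp
      then show ?thesis by blast
    next
      case False
      obtain u where u: "u \<in> below k A" using below_nonempty[OF AX Ad] by blast
      \<comment> \<open>A vertex below all maximal points has gained mass: those not joined to it
        have strictly smaller coordinates.\<close>
      have "peak (\<lambda>w. d w = Suc k \<and> {u, w} \<notin> X) x < ?M"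
      proof (rule peak_less[OF M])
        fix w assume w: "d w = Suc k \<and> {u, w} \<notin> X"
        then have "w \<notin> A" using u unfolding below_def by blast
        then have "x w \<noteq> ?M" using w False unfolding A_def by simp
        moreover have "x w \<le> ?M" using w by (intro peak_ge) simp
        ultimately show "x w < ?M" by simp
      qed
      moreover have "d u = k" using u unfolding below_def by blast
      ultimately have "0 < ?y u" using False xs(3)[of u] unfolding sink_def by simp
      then show ?thesis by blast
    qed
    have "{v. 0 < ?y v} \<in> X"
      by (rule clique_simplex[OF fin ne]) (use clique in auto)
    moreover have "{v. 0 < ?y v} \<subseteq> reach k ?\<sigma>"
      using pos A\<sigma> mA Ad unfolding reach_def by blast
    moreover have "d v \<le> Suc k" if "0 < ?y v" for v
      using pos[OF that] Ad[of v] unfolding below_def by auto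
    moreover have "d v \<le> k" if "s = 1" "0 < ?y v" for v
    proof -
      \<comment> \<open>The coordinates sum to 1, so the maximum is at most 1 and time 1 suffices to
        empty the upper level.\<close>
      have "x m \<le> sum x ?\<sigma>"
        using mA A\<sigma> asc_finite[OF asc x_simplex(1)] by (intro member_le_sum) auto
      then have "?M \<le> 1" using m(2) xs(4) by simp
      then show ?thesis using pos[OF that(2)] that(1) unfolding below_def by auto
    qed
    ultimately show ?thesis by blast
  qed
  then show "{v. 0 < ?y v} \<in> X" "{v. 0 < ?y v} \<subseteq> reach k ?\<sigma>" "0 < ?y v \<Longrightarrow> d v \<le> Suc k"
    "s = 1 \<Longrightarrow> 0 < ?y v \<Longrightarrow> d v \<le> k"
    by blast+
qed

lemma flow_id:
  assumes "sink k s x = x"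
  shows "flow k (s, x) = x"
  unfolding flow_def assms prod.case using xs(4) by simp

lemma flow_0: "flow k (0, x) = x"
  by (rule flow_id[OF sink_0])

end

lemma flow_fixes:
  assumes "x \<in> realization_set (sub k)" "0 \<le> s"
  shows "flow k (s, x) = x"
proof -
  have x: "x \<in> realization_set (sub (Suc k))"
    using realization_set_mono[OF sub_mono[of k "Suc k"]] assms(1) by auto
  have "d w \<noteq> Suc k" if "0 < x w" for w
    using realization_set_simplex(1)[OF sub_asc assms(1)] that unfolding sub_def by auto
  then show ?thesis using flow_id[OF x sink_trivial[OF x assms(2)]] by blast
qed

end

section \<open>Continuity of the flow in the CW topology\<close>

lemma continuous_on_Max_image:
  fixes g :: "'b \<Rightarrow> 'z::topological_space \<Rightarrow> real"
  assumes "finite W" "\<And>w. w \<in> W \<Longrightarrow> continuous_on S (g w)"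
  shows "continuous_on S (\<lambda>z. Max (insert 0 ((\<lambda>w. g w z) ` W)))"
  using assms
proof (induction W rule: finite_induct)
  case (insert w W)
  have "Max (insert 0 ((\<lambda>w. g w z) ` insert w W)) = max (g w z) (Max (insert 0 ((\<lambda>w. g w z) ` W)))" for z
    using insert.hyps(1) by (simp add: insert_commute[of 0])
  moreover have "continuous_on S (\<lambda>z. max (g w z) (Max (insert 0 ((\<lambda>w. g w z) ` W))))"
    using insert by (intro continuous_on_max) auto
  ultimately show ?case by (metis (no_types, lifting) continuous_on_cong)
qed simp

text \<open>Finite dimension enters as finiteness of cliques: \<open>below k A\<close> and the
  supports of \<open>sink\<close> are cliques and have to be finite in order to be
  simplices.\<close>

locale bounded_layered_complex = layered_complex +
  assumes clique_finite: "(\<And>a b. a \<in> S \<Longrightarrow> b \<in> S \<Longrightarrow> {a, b} \<in> X) \<Longrightarrow> finite S"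
begin

lemma reach_finite:
  assumes "finite \<tau>"
  shows "finite (reach k \<tau>)"
proof -
  have "finite (below k A)" if "A \<noteq> {}" "\<forall>a\<in>A. d a = Suc k" for A
  proof (rule clique_finite)
    fix u v assume uv: "u \<in> below k A" "v \<in> below k A"
    obtain a where "a \<in> A" using \<open>A \<noteq> {}\<close> by blast
    then show "{u, v} \<in> X"
      using d_clique[of a u v k] uv \<open>\<forall>a\<in>A. d a = Suc k\<close> edge_sym unfolding below_def by blast
  qed
  moreover have "finite {A. A \<subseteq> \<tau> \<and> A \<noteq> {} \<and> (\<forall>a\<in>A. d a = Suc k)}"
    using assms by (intro finite_subset[OF _ finite_Pow_iff[THEN iffD2, OF assms]]) auto
  ultimately show ?thesis unfolding reach_def using assms by auto
qed

lemma reach_mono: "\<sigma> \<subseteq> \<tau> \<Longrightarrow> reach k \<sigma> \<subseteq> reach k \<tau>"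
  unfolding reach_def by blast

lemma flow_in_simplex:
  assumes "x \<in> realization_set (sub (Suc k))" "0 \<le> s" "s \<le> 1"
  shows "flow k (s, x) \<in> closed_simplex {v. 0 < sink k s x v}"
    and "{v. 0 < sink k s x v} \<in> sub (Suc k)"
    and "s = 1 \<Longrightarrow> {v. 0 < sink k s x v} \<in> sub k"
    and "{v. 0 < sink k s x v} \<subseteq> reach k {v. 0 < x v}"
    and "0 < sum (sink k s x) {v. 0 < sink k s x v}"
proof -
  let ?y = "sink k s x" and ?\<rho> = "{v. 0 < sink k s x v}"
  note supp = sink_support[OF assms(1) assms(2,3) clique_finite]
  show "?\<rho> \<in> sub (Suc k)" "s = 1 \<Longrightarrow> ?\<rho> \<in> sub k" "?\<rho> \<subseteq> reach k {v. 0 < x v}"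
    using supp unfolding sub_def by auto
  show pos: "0 < sum ?y ?\<rho>"
    using asc_finite[OF asc supp(1)] asc_nonempty[OF asc supp(1)] by (intro sum_pos) auto
  have z: "?y v = 0" if "v \<notin> ?\<rho>" for v using sink_nonneg[OF assms(1), of s v] that by simp
  have "(\<Sum>v\<in>?\<rho>. ?y v / sum ?y ?\<rho>) = 1"
    using pos by (simp add: sum_divide_distrib[symmetric])
  moreover have "0 \<le> ?y v / sum ?y ?\<rho>" for v
    using pos sink_nonneg[OF assms(1), of s v] by simp
  moreover have "?y v / sum ?y ?\<rho> = 0" if "v \<notin> ?\<rho>" for v
    using z[OF that] by simp
  ultimately show "flow k (s, x) \<in> closed_simplex ?\<rho>"
    unfolding flow_def closed_simplex_def prod.case by blast
qed

lemma continuous_on_sink: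
  assumes \<tau>: "\<tau> \<in> X"
  shows "continuous_on ({0..1} \<times> closed_simplex \<tau>) (\<lambda>z. sink k (fst z) (snd z) v)"
proof -
  let ?S = "{0..1::real} \<times> closed_simplex \<tau>"
  have fin: "finite \<tau>" using asc_finite[OF asc \<tau>] .
  have c: "continuous_on ?S (\<lambda>z. snd z w)" for w :: 'a
    by (rule continuous_on_compose2[OF continuous_on_coordinate[of UNIV w]]) (auto intro: continuous_intros)
  have p: "continuous_on ?S (\<lambda>z. peak P (snd z))" for P
  proof -
    have "continuous_on ?S (\<lambda>z. Max (insert 0 ((\<lambda>w. snd z w) ` {w \<in> \<tau>. P w})))"
      using fin c by (intro continuous_on_Max_image) auto
    moreover have "peak P (snd z) = Max (insert 0 ((\<lambda>w. snd z w) ` {w \<in> \<tau>. P w}))" if "z \<in> ?S" for z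
      using peak_simplex(1)[OF fin, of "snd z" P] that by auto
    ultimately show ?thesis by (auto elim!: continuous_on_eq)
  qed
  show ?thesis
    unfolding sink_def
    by (cases "d v = Suc k"; cases "d v = k") (auto intro!: continuous_intros c p)
qed

lemma continuous_on_flow:
  assumes \<tau>: "\<tau> \<in> sub (Suc k)"
  shows "continuous_on ({0..1} \<times> closed_simplex \<tau>) (flow k)"
proof (rule continuous_on_coordinatewise_then_product)
  fix v
  let ?S = "{0..1::real} \<times> closed_simplex \<tau>"
  have \<tau>X: "\<tau> \<in> X" using \<tau> unfolding sub_def by blast
  have fin: "finite (reach k \<tau>)" using reach_finite asc_finite[OF asc \<tau>X] .
  \<comment> \<open>The normalising sum runs over a support that varies with the point; over the
    fixed finite set \<open>reach k \<tau>\<close> it has the same value and is continuous.\<close>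
  let ?D = "\<lambda>z. sum (sink k (fst z) (snd z)) (reach k \<tau>)"
  have eq: "flow k z v = sink k (fst z) (snd z) v / ?D z" and pos: "0 < ?D z" if "z \<in> ?S" for z
  proof -
    obtain s x where z: "z = (s, x)" "0 \<le> s" "s \<le> 1" "x \<in> closed_simplex \<tau>" using \<open>z \<in> ?S\<close> by auto
    have x: "x \<in> realization_set (sub (Suc k))" using z(4) \<tau> unfolding realization_set_def by blast
    have "{v. 0 < sink k s x v} \<subseteq> reach k \<tau>"
      using flow_in_simplex(4)[OF x z(2,3)] reach_mono[OF closed_simplex_support[OF z(4)]] by blast
    then have "sum (sink k s x) {v. 0 < sink k s x v} = sum (sink k s x) (reach k \<tau>)"
      using fin sink_nonneg[OF x, of s] by (intro sum.mono_neutral_left) (auto simp: order_le_less)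
    then show "flow k z v = sink k (fst z) (snd z) v / ?D z" "0 < ?D z"
      using flow_in_simplex(5)[OF x z(2,3)] unfolding z(1) flow_def by simp_all
  qed
  have "continuous_on ?S (\<lambda>z. sink k (fst z) (snd z) v / ?D z)"
    using pos by (intro continuous_on_divide continuous_on_sink[OF \<tau>X] continuous_on_sum) force
  then show "continuous_on ?S (\<lambda>z. flow k z v)"
    by (rule continuous_on_eq) (rule eq[symmetric])
qed

text \<open>Two targets are served at once: the whole flow stays in \<open>sub (Suc k)\<close>, and
  its time 1 map lands in \<open>sub k\<close>. The second needs its own proof, because continuity
  is wanted for the topology of the smaller complex.\<close>

lemma continuous_map_flow_simplex:
  assumes \<tau>: "\<tau> \<in> sub (Suc k)" and S: "S \<subseteq> {0..1} \<times> closed_simplex \<tau>"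
    and n: "n = Suc k \<or> n = k \<and> (\<forall>z\<in>S. fst z = 1)"
  shows "continuous_map (top_of_set S) (realization (sub n)) (flow k)"
proof (rule continuous_map_into_realization[OF sub_asc])
  have \<tau>X: "\<tau> \<in> X" using \<tau> unfolding sub_def by blast
  let ?F = "{\<rho> \<in> sub n. \<rho> \<subseteq> reach k \<tau>}"
  show "finite ?F"
    using reach_finite[OF asc_finite[OF asc \<tau>X], of k] by (rule finite_subset[rotated, OF finite_Pow_iff[THEN iffD2]]) blast
  show "?F \<subseteq> sub n" by blast
  show "continuous_on S (flow k)" using continuous_on_subset[OF continuous_on_flow[OF \<tau>] S] .
  show "flow k ` S \<subseteq> (\<Union>\<sigma>\<in>?F. closed_simplex \<sigma>)"
  proof
    fix p assume "p \<in> flow k ` S"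
    then obtain s x where z: "p = flow k (s, x)" "(s, x) \<in> S" by auto
    then have s: "0 \<le> s" "s \<le> 1" "x \<in> closed_simplex \<tau>" using S by auto
    have x: "x \<in> realization_set (sub (Suc k))" using s(3) \<tau> unfolding realization_set_def by blast
    let ?\<rho> = "{v. 0 < sink k s x v}"
    have "?\<rho> \<in> sub n" using flow_in_simplex(2,3)[OF x s(1,2)] n z(2) by auto
    moreover have "?\<rho> \<subseteq> reach k \<tau>"
      using flow_in_simplex(4)[OF x s(1,2)] reach_mono[OF closed_simplex_support[OF s(3)]] by blast
    ultimately show "p \<in> (\<Union>\<sigma>\<in>?F. closed_simplex \<sigma>)"
      using flow_in_simplex(1)[OF x s(1,2)] z(1) by blast
  qed
qed

lemma continuous_map_flow:
  "continuous_map (prod_topology (top_of_set {0..1}) (realization (sub (Suc k)))) (realization (sub (Suc k))) (flow k)"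
  by (rule continuous_map_from_interval_times_realization)
    (simp add: continuous_map_flow_simplex)

text \<open>The idle time coordinate is kept so that the gluing over simplices and the composition
  in \<open>contract\<close> both apply to the product.\<close>

lemma continuous_map_flow_end:
  "continuous_map (prod_topology (top_of_set {0..1::real}) (realization (sub (Suc k)))) (realization (sub k)) (\<lambda>z. flow k (1, snd z))"
proof (rule continuous_map_from_interval_times_realization)
  fix \<tau> assume \<tau>: "\<tau> \<in> sub (Suc k)"
  have "continuous_map (top_of_set ({0..1::real} \<times> closed_simplex \<tau>)) (top_of_set ({1} \<times> closed_simplex \<tau>))
      (\<lambda>z. (1::real, snd z))"
    by (auto intro!: continuous_on_Pair continuous_on_const continuous_on_snd continuous_on_id)
  moreover have "continuous_map (top_of_set ({1} \<times> closed_simplex \<tau>)) (realization (sub k)) (flow k)"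
    by (rule continuous_map_flow_simplex[OF \<tau>]) auto
  ultimately have "continuous_map (top_of_set ({0..1::real} \<times> closed_simplex \<tau>)) (realization (sub k)) (flow k \<circ> (\<lambda>z. (1::real, snd z)))"
    by (rule continuous_map_compose)
  then show "continuous_map (prod_topology (top_of_set {0..1::real}) (top_of_set (closed_simplex \<tau>))) (realization (sub k))
      (\<lambda>z. flow k (1, snd z))"
    by (simp add: o_def)
qed

text \<open>The flow that empties level \<open>Suc n\<close> runs during the time interval \<open>[2\<^sup>-\<^sup>n\<^sup>-\<^sup>1, 2\<^sup>-\<^sup>n]\<close>, so at every
  positive time only finitely many levels are still to be emptied.\<close>

primrec contract :: "nat \<Rightarrow> real \<times> ('a \<Rightarrow> real) \<Rightarrow> 'a \<Rightarrow> real" where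
  "contract 0 = snd"
| "contract (Suc n) = (\<lambda>z. if fst z \<le> (1/2)^n then flow n (max 0 (min 1 (2^Suc n * fst z - 1)), snd z)
     else contract n (fst z, flow n (1, snd z)))"

lemma flow_end_in: "x \<in> realization_set (sub (Suc k)) \<Longrightarrow> flow k (1, x) \<in> realization_set (sub k)"
  using flow_in_simplex(1,3)[of x k 1] unfolding realization_set_def by auto

lemma contract_early:
  assumes "x \<in> realization_set (sub n)" "t \<le> (1/2)^n"
  shows "contract n (t, x) = x"
proof (cases n)
  case (Suc m)
  have "2^Suc m * t \<le> 1" using assms(2) unfolding Suc by (simp add: field_simps)
  moreover have "t \<le> (1/2)^m"
  proof -
    have "(1/2::real)^Suc m \<le> (1/2)^m" by simp
    then show ?thesis using assms(2) unfolding Suc by linarith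
  qed
  ultimately show ?thesis using flow_0[of x m] assms(1) unfolding Suc by simp
qed simp

text \<open>The flow that empties level \<open>Suc n\<close> rests on \<open>sub n\<close>. This
  compatibility glues the contractions of all sublevel complexes into a single map.\<close>

lemma contract_Suc:
  assumes "x \<in> realization_set (sub n)"
  shows "contract (Suc n) (t, x) = contract n (t, x)"
  using flow_fixes[OF assms] contract_early[OF assms, of t] by simp

lemma contract_mono:
  assumes "x \<in> realization_set (sub m)" "m \<le> n"
  shows "contract n (t, x) = contract m (t, x)"
  using assms(2)
proof (induction n rule: dec_induct)
  case (step n)
  have "x \<in> realization_set (sub n)"
    using realization_set_mono[OF sub_mono[OF step(1)]] assms(1) by blast
  then show ?case using contract_Suc step.IH by simp
qed simp

lemma realization_set_sub_0: "x \<in> realization_set (sub 0) \<Longrightarrow> x = (\<lambda>v. if v = base then 1 else 0)"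
  unfolding sub_0 realization_set_def closed_simplex_def by auto

lemma contract_end:
  "x \<in> realization_set (sub n) \<Longrightarrow> contract n (1, x) = (\<lambda>v. if v = base then 1 else 0)"
proof (induction n arbitrary: x)
  case 0
  then show ?case using realization_set_sub_0 by simp
next
  case (Suc n)
  have f: "flow n (1, x) \<in> realization_set (sub n)" using flow_end_in[OF Suc.prems] .
  show ?case
  proof (cases "n = 0")
    case True
    \<comment> \<open>For \<open>n = 0\<close> time 1 still belongs to the first branch, and the
      flow has just been completed.\<close>
    then show ?thesis using realization_set_sub_0 f by simp
  next
    case False
    then have "\<not> 1 \<le> (1/2::real)^n" by (simp add: power_less_one_iff not_le)
    then show ?thesis using Suc.IH[OF f] by simp
  qed
qed

lemma continuous_map_contract:
  "continuous_map (prod_topology (top_of_set {0..1}) (realization (sub n))) (realization (sub n)) (contract n)"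
proof (induction n)
  case 0
  show ?case by (simp add: continuous_map_snd)
next
  case (Suc n)
  let ?P = "prod_topology (top_of_set {0..1::real}) (realization (sub (Suc n)))"
  have fst_c: "continuous_map ?P euclideanreal fst"
    using continuous_map_into_fulltopology[OF continuous_map_fst] by blast
  have "continuous_map ?P (top_of_set {0..1}) (\<lambda>z. max 0 (min 1 (2^Suc n * fst z - 1)))"
    unfolding continuous_map_in_subtopology
    by (auto intro!: continuous_map_real_max continuous_map_real_min continuous_map_diff
        continuous_map_real_mult fst_c)
  then have "continuous_map ?P (prod_topology (top_of_set {0..1}) (realization (sub (Suc n))))
      (\<lambda>z. (max 0 (min 1 (2^Suc n * fst z - 1)), snd z))"
    by (intro continuous_map_pairedI continuous_map_snd)
  from continuous_map_compose[OF this continuous_map_flow]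
  have 1: "continuous_map ?P (realization (sub (Suc n))) (\<lambda>z. flow n (max 0 (min 1 (2^Suc n * fst z - 1)), snd z))"
    by (simp add: o_def)
  have "continuous_map ?P (prod_topology (top_of_set {0..1}) (realization (sub n))) (\<lambda>z. (fst z, flow n (1, snd z)))"
    by (intro continuous_map_pairedI continuous_map_fst continuous_map_flow_end)
  from continuous_map_compose[OF this Suc.IH]
  have "continuous_map ?P (realization (sub n)) (\<lambda>z. contract n (fst z, flow n (1, snd z)))"
    by (simp add: o_def)
  from continuous_map_compose[OF this continuous_map_subcomplex[OF sub_mono[of n "Suc n"]]]
  have 2: "continuous_map ?P (realization (sub (Suc n))) (\<lambda>z. contract n (fst z, flow n (1, snd z)))"
    by (simp add: o_def)
  have "continuous_map ?P (realization (sub (Suc n))) (\<lambda>z. if fst z \<le> (1/2)^n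
      then flow n (max 0 (min 1 (2^Suc n * fst z - 1)), snd z) else contract n (fst z, flow n (1, snd z)))"
  proof (rule continuous_map_cases_le)
    fix z assume z: "z \<in> topspace ?P" "fst z = (1/2)^n"
    then have x: "snd z \<in> realization_set (sub (Suc n))" by (auto simp: topspace_realization)
    \<comment> \<open>At the moment of transition the flow from the top level has ended and the
      contraction of \<open>sub n\<close> has not yet begun to move, so the two formulas
      agree.\<close>
    have "max 0 (min 1 (2^Suc n * fst z - 1)) = 1" unfolding z(2) by (simp add: power_divide)
    then show "flow n (max 0 (min 1 (2^Suc n * fst z - 1)), snd z) = contract n (fst z, flow n (1, snd z))"
      using contract_early[OF flow_end_in[OF x], of "fst z"] z(2) by simp
  qed (rule fst_c continuous_map_from_subtopology[OF 1] continuous_map_from_subtopology[OF 2] | simp)+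
  then show ?case by simp
qed

theorem contractible: "contractible_space (realization X)"
proof -
  \<comment> \<open>Any \<open>n\<close> with the point in \<open>sub n\<close> gives the same
    value; the least one is just a choice. On a closed simplex, whose levels are bounded,
    \<open>h\<close> therefore coincides with one fixed \<open>contract n\<close>, although the
    levels of \<open>X\<close> may be unbounded.\<close>
  define lv where "lv = (\<lambda>x. LEAST n. x \<in> realization_set (sub n))"
  define h where "h = (\<lambda>z. contract (lv (snd z)) z)"
  have sub_X: "sub n \<subseteq> X" for n unfolding sub_def by blast
  have simplex: "\<exists>n. \<sigma> \<in> sub n" if "\<sigma> \<in> X" for \<sigma>
    using that asc_finite[OF asc that] by (intro exI[of _ "Max (d ` \<sigma>)"]) (auto simp: sub_def)
  have lv: "x \<in> realization_set (sub (lv x)) \<and> lv x \<le> n" if "x \<in> realization_set (sub n)" for x n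
    unfolding lv_def using that by (auto intro: LeastI Least_le)
  have h: "h (t, x) = contract n (t, x)" if "x \<in> realization_set (sub n)" for t x n
    using contract_mono[of x "lv x" n t] lv[OF that] unfolding h_def by simp
  have ex: "\<exists>n. x \<in> realization_set (sub n)" if "x \<in> realization_set X" for x
    using that simplex unfolding realization_set_def by blast
  have "continuous_map (prod_topology (top_of_set {0..1}) (realization X)) (realization X) h"
  proof (rule continuous_map_from_interval_times_realization)
    fix \<sigma> assume "\<sigma> \<in> X"
    then obtain n where n: "\<sigma> \<in> sub n" using simplex by blast
    let ?Q = "prod_topology (top_of_set {0..1::real}) (top_of_set (closed_simplex \<sigma>))"
    have "continuous_map ?Q (prod_topology (top_of_set {0..1}) (realization (sub n))) (\<lambda>z. (fst z, id (snd z)))"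
      by (intro continuous_map_pairedI continuous_map_fst
          continuous_map_compose[OF continuous_map_snd continuous_map_simplex_realization[OF sub_asc n], unfolded o_def])
    from continuous_map_compose[OF continuous_map_compose[OF this continuous_map_contract] continuous_map_subcomplex[OF sub_X]]
    have "continuous_map ?Q (realization X) (contract n)" by (simp add: o_def)
    moreover have "contract n z = h z" if "z \<in> topspace ?Q" for z
    proof -
      have "snd z \<in> realization_set (sub n)"
        using that closed_simplex_subset_realization_set[OF n] by auto
      then show ?thesis using h[of "snd z" n "fst z"] by simp
    qed
    ultimately show "continuous_map ?Q (realization X) h"
      by (rule continuous_map_eq)
  qed
  moreover have "h (0, x) = id x" "h (1, x) = (\<lambda>v. if v = base then 1 else 0)"
    if x: "x \<in> topspace (realization X)" for x
  proof -
    obtain n where n: "x \<in> realization_set (sub n)" using ex x unfolding topspace_realization by blast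
    show "h (0, x) = id x" "h (1, x) = (\<lambda>v. if v = base then 1 else 0)"
      using h[OF n] contract_early[OF n, of 0] contract_end[OF n] by simp_all
  qed
  ultimately have "homotopic_with (\<lambda>_. True) (realization X) (realization X) id (\<lambda>_ v. if v = base then 1 else 0)"
    by (subst homotopic_with) auto
  then show ?thesis unfolding contractible_space_def by blast
qed

end

text \<open>An infinite clique would contain finite cliques of every size, and these are
  simplices.\<close>

lemma finite_dimensional_clique:
  assumes "finite_dimensional X"
    and simplex: "\<And>S. finite S \<Longrightarrow> S \<noteq> {} \<Longrightarrow> (\<And>a b. a \<in> S \<Longrightarrow> b \<in> S \<Longrightarrow> {a, b} \<in> X) \<Longrightarrow> S \<in> X"
    and clique: "\<And>a b. a \<in> S \<Longrightarrow> b \<in> S \<Longrightarrow> {a, b} \<in> X"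
  shows "finite S"
proof (rule ccontr)
  assume "infinite S"
  obtain n where n: "\<And>\<sigma>. \<sigma> \<in> X \<Longrightarrow> card \<sigma> \<le> n + 1"
    using assms(1) unfolding finite_dimensional_def by blast
  obtain B where B: "finite B" "card B = n + 2" "B \<subseteq> S"
    using infinite_arbitrarily_large[OF \<open>infinite S\<close>] by blast
  have "B \<noteq> {}" using B(2) by auto
  then have "B \<in> X" by (rule simplex[OF B(1) _ clique]) (use B(3) in blast)+
  from n[OF this] show False using B(2) by simp
qed

theorem theorem5p1:
  fixes X :: "'a set set"
  assumes "abstract_simplicial_complex X"
    and "finite_dimensional X"
    and "systolic X"
  shows "contractible_space (realization X)"
proof -
  obtain d base where "layered_complex X d base"
    using systolic_layered[OF assms(1,3)] by blast
  then interpret layered_complex X d base .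
  interpret bounded_layered_complex X d base
    by unfold_locales (rule finite_dimensional_clique[OF assms(2) clique_simplex])
  show ?thesis by (rule contractible)
qed

end
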